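(* For every $\varepsilon>0$ and $\lambda>0$ there exist $c>0$ and $\lambda'>0$ such that, for all sufficiently large $n$ and all $p$ with $\lambda' n^{-3/5}\log n\leq p\leq\lambda n^{-1/2}$, the following holds: if majority dynamics on $G=G(n,p)$ is started from the evening opinion $\tilde s_0$ (defined in the context with parameter $c$), then with probability at least $1-\varepsilon$ unanimity is achieved after a finite number of days, i.e. there is $t$ such that $\tilde s_t$ is constant on $[n]$.
   Context: $G(n,p)$ is the Erdős–Rényi random graph on $[n]$. Majority dynamics: from $s_0:[n]\to\{\pm1\}$, for $t\geq1$ set $s_t(v)=\mathrm{sgn}\sum_{u\sim v}s_{t-1}(u)$ if the sum is nonzero and $s_t(v)=s_{t-1}(v)$ otherwise. The morning opinion $r_0$ is obtained by choosing a uniformly random set of $\lceil n/2\rceil$ vertices to receive $+1$ and giving $-1$ to the other $\lfloor n/2\rfloor$ vertices. Then $\lceil c\sqrt n\rceil$ "swing" vertices are chosen uniformly at random among the vertices $v$ with $r_0(v)=-1$, and their signs are changed to $+1$; the resulting assignment is the evening opinion $\tilde s_0$, and $\tilde s_t$ denotes the Day $t$ opinion of majority dynamics started from $\tilde s_0$. The graph $G(n,p)$ is independent of $r_0$ and of the choice of swing vertices. Logarithms are natural. *)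

theory Defs
  imports "HOL-Probability.Probability"
begin

text \<open>A simple graph on \<open>[n] = {1..n}\<close> is given by its edge set, a set of two-element subsets
  of \<open>[n]\<close>.\<close>

definition vertex_pairs :: "nat \<Rightarrow> nat set set" where
  "vertex_pairs n = {e. e \<subseteq> {1..n} \<and> card e = 2}"

definition gnp :: "nat \<Rightarrow> real \<Rightarrow> nat set set pmf" where
  "gnp n p = map_pmf (\<lambda>X. {e \<in> vertex_pairs n. X e})
     (Pi_pmf (vertex_pairs n) False (\<lambda>_. bernoulli_pmf p))"

definition neighbours :: "nat set set \<Rightarrow> nat \<Rightarrow> nat set" where
  "neighbours E v = {u. {u, v} \<in> E}"

primrec majority_dynamics :: "nat set set \<Rightarrow> (nat \<Rightarrow> int) \<Rightarrow> nat \<Rightarrow> nat \<Rightarrow> int" where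
  "majority_dynamics E s 0 = s"
| "majority_dynamics E s (Suc t) = (\<lambda>v.
     let S = (\<Sum>u\<in>neighbours E v. majority_dynamics E s t u)
     in if S \<noteq> 0 then sgn S else majority_dynamics E s t v)"

text \<open>Opinions are total functions; their values outside \<open>[n]\<close> are irrelevant.\<close>

definition morning_opinion :: "nat \<Rightarrow> (nat \<Rightarrow> int) pmf" where
  "morning_opinion n = map_pmf (\<lambda>A v. if v \<in> A then 1 else -1)
     (pmf_of_set {A. A \<subseteq> {1..n} \<and> card A = nat \<lceil>real n / 2\<rceil>})"

text \<open>The swing set exists only if \<open>\<lceil>c * sqrt n\<rceil> \<le> \<lfloor>n / 2\<rfloor>\<close>, which for fixed \<open>c\<close> holds for all
  large \<open>n\<close>; otherwise \<open>pmf_of_set {}\<close> is unspecified.\<close>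

definition evening_opinion :: "real \<Rightarrow> nat \<Rightarrow> (nat \<Rightarrow> int) pmf" where
  "evening_opinion c n = bind_pmf (morning_opinion n) (\<lambda>r.
     map_pmf (\<lambda>S v. if v \<in> S then 1 else r v)
       (pmf_of_set {S. S \<subseteq> {v \<in> {1..n}. r v = -1} \<and> card S = nat \<lceil>c * sqrt (real n)\<rceil>}))"

end

theory Submission
  imports Defs "HOL-Real_Asymp.Real_Asymp"
begin

text \<open>Fix the evening opinion, so that only the lead \<open>2 * sqrt n\<close> of \<open>+1\<close> matters (\<open>c = 1\<close> suffices),
  and write \<open>q = sqrt n * p\<close> and \<open>X = sqrt (n * p)\<close>. For two vertices \<open>v\<close> and \<open>w\<close>, expose the graph
  on the remaining vertices first: up to a perturbation of total effect
  \<open>O (p + q^2 / X)\<close>, the second-day sums at \<open>v\<close> and \<open>w\<close> are then independent differences of binomial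
  variables, and their sign depends on the exposed graph only through the number \<open>a\<close> of first-day
  \<open>+1\<close> opinions, via a function \<open>F a\<close> that is Lipschitz with constant of order \<open>p / X\<close> and has slope of
  that order near \<open>a = n / 2\<close>. As \<open>a\<close> has standard deviation \<open>O (sqrt n)\<close> and mean exceeding
  \<open>n / 2\<close> by about \<open>n * sqrt p\<close>, each vertex gains a bias of order \<open>q\<close>, and the
  covariances are small enough for Chebyshev's inequality to give a lead of order \<open>n * q\<close> on day 2.
  Since \<open>n * p * q^2\<close> tends to infinity, a Chernoff bound and a union bound over all
  opinions with such a lead show that on day 3 fewer than \<open>n / 10\<close> vertices have opinion \<open>-1\<close>, and
  from then on the minority at least halves every day.\<close>

section \<open>Elementary facts\<close>

text \<open>The obstacle is that a vertex \<open>v\<close> influences its own second-day score: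
  every neighbour of \<open>v\<close> saw \<open>s v\<close> on the first day. Seen from
  \<open>v\<close>, this shifts the mean number of first-day \<open>+1\<close> opinions by order
  \<open>sqrt (n / p)\<close>, about \<open>1 / q\<close> times the gain \<open>n * sqrt p\<close>,
  and it changes the second-day probability by a constant. A single vertex therefore need not lean
  to \<open>+1\<close>. A \<open>+1\<close> vertex and a \<open>-1\<close> vertex are treated
  together: their shifts are opposite and cancel by the symmetry of \<open>F\<close> about
  \<open>N / 2\<close>. The symmetry holds only up to ties, which cost order \<open>1 / X\<close>,
  so a gain of order \<open>q\<close> asks for \<open>q * X\<close> to be large. The upper bound on
  \<open>q\<close> keeps the first-day means within a bounded multiple of
  \<open>sqrt (n / p)\<close>, the scale on which \<open>F\<close> varies, so that its slope is
  bounded below there; hence the dependence of \<open>lead_const\<close> on \<open>lam\<close>. All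
  local estimates come from multiplying ratios of consecutive binomial probabilities; no central
  limit theorem enters, and the factors \<open>exp 12\<close> stem from these products.\<close>

lemma card_nat_interval_ge:
  fixes u v :: real
  assumes "0 \<le> u"
  shows "v - u - 1 \<le> real (card {nat \<lceil>u\<rceil>..nat \<lfloor>v\<rfloor>})"
  using assms by (simp add: of_nat_diff) linarith

lemma card_nat_interval_le:
  fixes u v :: real
  assumes "0 \<le> v" "u \<le> v"
  shows "real (card {nat \<lceil>u\<rceil>..nat \<lfloor>v\<rfloor>}) \<le> max 0 (v - u + 1)"
  using assms by (auto simp: of_nat_diff) linarith+

lemma nearly_equal_bounds:
  fixes a b N :: real
  assumes "\<bar>a - b\<bar> * 48 \<le> N" "3 * N \<le> 4 * (a + b)" "a + b \<le> N + 2" "10368 \<le> N"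
  shows "N / 4 \<le> a \<and> a \<le> N \<and> N / 4 \<le> b \<and> b \<le> N"
  using assms by (cases "a \<le> b") (auto simp: abs_if split: if_splits)

text \<open>Serves to bound covariances from above: lower bounds for two means give one for their
  product.\<close>

lemma mult_unit_diff_le:
  fixes f g x y :: real
  assumes "0 \<le> f" "f \<le> 1" "0 \<le> g" "g \<le> 1" "0 \<le> x" "x \<le> 1" "0 \<le> y" "y \<le> 1"
    and "f - \<delta> \<le> x" "g - \<delta> \<le> y" "0 \<le> \<delta>"
  shows "f * g - 2 * \<delta> \<le> x * y"
proof -
  have "f * (g - y) \<le> \<delta>"
  proof -
    have "f * (g - y) \<le> f * \<delta>" using assms by (intro mult_left_mono) auto
    also have "\<dots> \<le> 1 * \<delta>" using assms by (intro mult_right_mono) auto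
    finally show ?thesis by simp
  qed
  moreover have "y * (f - x) \<le> \<delta>"
  proof -
    have "y * (f - x) \<le> y * \<delta>" using assms by (intro mult_left_mono) auto
    also have "\<dots> \<le> 1 * \<delta>" using assms by (intro mult_right_mono) auto
    finally show ?thesis by simp
  qed
  ultimately show ?thesis by (simp add: algebra_simps)
qed

lemma exp_le_quadratic:
  fixes y :: real
  assumes "\<bar>y\<bar> \<le> 1"
  shows "exp y \<le> 1 + y + y\<^sup>2"
proof (cases "0 \<le> y")
  case True
  then show ?thesis using assms by (intro exp_bound) auto
next
  case False
  define z where "z = - y"
  have z: "0 \<le> z" using False by (simp add: z_def)
  \<comment> \<open>For negative \<open>y\<close> the reciprocal is estimated:
    \<open>1 - z + z^2\<close> times the Taylor polynomial of \<open>exp z\<close> is at least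
    1.\<close>
  have "1 + z + z\<^sup>2 / 2 \<le> exp z" using z by (rule exp_lower_Taylor_quadratic)
  moreover have "0 \<le> 1 - z + z\<^sup>2"
  proof -
    have "0 \<le> (z - 1/2)\<^sup>2" by simp
    then show ?thesis by (simp add: power2_eq_square algebra_simps)
  qed
  ultimately have "(1 - z + z\<^sup>2) * (1 + z + z\<^sup>2 / 2) \<le> (1 - z + z\<^sup>2) * exp z"
    by (intro mult_left_mono) auto
  moreover have "(1 - z + z\<^sup>2) * (1 + z + z\<^sup>2 / 2) = 1 + z\<^sup>2 / 2 + z ^ 3 / 2 + z ^ 4 / 2"
    by (simp add: power2_eq_square power3_eq_cube power4_eq_xxxx field_simps)
  ultimately have "1 \<le> (1 - z + z\<^sup>2) * exp z" using z by (smt (verit) zero_le_power divide_nonneg_nonneg)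
  then have "exp (- z) \<le> 1 - z + z\<^sup>2" by (simp add: exp_minus field_simps)
  then show ?thesis by (simp add: z_def)
qed

lemma sum_power_card: "finite V \<Longrightarrow> (\<Sum>C\<in>Pow V. x ^ card C) = (1 + x :: real) ^ card V"
proof (induction V rule: finite_induct)
  case (insert a V)
  have inj: "inj_on (insert a) (Pow V)" using insert by (auto simp: inj_on_def)
  have "(\<Sum>C\<in>insert a ` Pow V. x ^ card C) = (\<Sum>C\<in>Pow V. x * x ^ card C)"
    unfolding sum.reindex[OF inj] o_def
    by (rule sum.cong[OF refl], subst card_insert_disjoint) (use insert in \<open>auto intro: finite_subset\<close>)
  moreover have "(\<Sum>C\<in>Pow V \<union> insert a ` Pow V. x ^ card C)
      = (\<Sum>C\<in>Pow V. x ^ card C) + (\<Sum>C\<in>insert a ` Pow V. x ^ card C)"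
    by (rule sum.union_disjoint) (use insert in auto)
  ultimately show ?case
    using insert by (simp add: Pow_insert sum_distrib_left[symmetric] algebra_simps)
qed simp

lemma of_bool_le_sum3:
  "(a \<Longrightarrow> b \<or> c \<or> d) \<Longrightarrow> (of_bool a :: real) \<le> of_bool b + of_bool c + of_bool d"
  by auto

section \<open>Constants\<close>

text \<open>Within \<open>L\<close> standard deviations, the local probabilities of a difference of two binomial
  variables with \<open>N\<close> trials in total are at least \<open>gam L / sqrt (N * p)\<close>.\<close>

definition gam :: "real \<Rightarrow> real" where
  "gam L = exp (- 24 * (4 * L + 2)\<^sup>2) / 128"

lemma gam_pos [simp]: "0 < gam L" and gam_le_1: "gam L \<le> 1"
proof -
  show "0 < gam L" by (simp add: gam_def)
  have "exp (- 24 * (4 * L + 2)\<^sup>2) \<le> 1" by simp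
  then show "gam L \<le> 1" unfolding gam_def by linarith
qed

text \<open>The number of \<open>+1\<close> opinions of \<open>N\<close> vertices after the first day has variance at most
  \<open>sd_const * N\<close>.\<close>

definition sd_const :: real where
  "sd_const = 1 + 16 * (exp 12)\<^sup>2"

text \<open>The argument of \<open>gam\<close> is a window width: it leaves room for all deviations
  of the first-day means from \<open>N / 2\<close>, which \<open>F_mean_ge\<close> bounds by
  \<open>(9 * lam + 16 * exp 12 + 1) * X / p\<close> after doubling.\<close>

definition lead_const :: "real \<Rightarrow> real" where
  "lead_const lam = gam (10 * lam + 64 * exp 12 + 5)"

text \<open>Coefficient of \<open>q / X\<close> in the losses of second-day bias: the fluctuation of
  the first-day count, twice the edge between the two observed vertices, and twice their
  interference through common neighbours.\<close>

definition err_const :: "real \<Rightarrow> real" where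
  "err_const lam = 16 * exp 12 * sqrt sd_const + 2 + 16 * exp 12 * lam"

text \<open>Collects every lower bound asked of \<open>X\<close> and of \<open>q * X\<close>. A sum
  of nonnegative terms replaces their maximum.\<close>

definition threshold :: "real \<Rightarrow> real" where
  "threshold lam = 1 + 12 * (4 * (10 * lam + 64 * exp 12 + 5) + 2) + 32 / lead_const lam
     + 4 * err_const lam / (lead_const lam)\<^sup>2 + 16 * exp 12 / (lead_const lam)\<^sup>2
     + 15360 / (lead_const lam) ^ 4"

text \<open>The factor in front comes from dividing by the square of \<open>N * g / 4\<close> with
  \<open>g = (lead_const lam)^2 * q / 2\<close> in Chebyshev's inequality.\<close>

definition var_const :: "real \<Rightarrow> real" where
  "var_const lam = 64 / (lead_const lam) ^ 4 * (5 + 64 * (exp 12)\<^sup>2 * sd_const + 32 * exp 12)"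

lemma lead_const_bounds: "0 < lead_const lam" "lead_const lam \<le> 1"
  by (auto simp: lead_const_def gam_le_1)

lemma sd_const_pos: "0 < sd_const"
  by (simp add: sd_const_def add_pos_nonneg)

lemma threshold_ge:
  assumes "0 < lam"
  shows "1 \<le> threshold lam" "12 * (4 * (10 * lam + 64 * exp 12 + 5) + 2) \<le> threshold lam"
    "32 / lead_const lam \<le> threshold lam" "4 * err_const lam / (lead_const lam)\<^sup>2 \<le> threshold lam"
    "16 * exp 12 / (lead_const lam)\<^sup>2 \<le> threshold lam" "15360 / (lead_const lam) ^ 4 \<le> threshold lam"
proof -
  define a1 a2 a3 a4 a5 where a: "a1 = 12 * (4 * (10 * lam + 64 * exp 12 + 5) + 2)" "a2 = 32 / lead_const lam"
    "a3 = 4 * err_const lam / (lead_const lam)\<^sup>2" "a4 = 16 * exp 12 / (lead_const lam)\<^sup>2" "a5 = 15360 / (lead_const lam) ^ 4"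
  have "0 \<le> err_const lam" using assms sd_const_pos by (simp add: err_const_def)
  then have "0 \<le> a1" "0 \<le> a2" "0 \<le> a3" "0 \<le> a4" "0 \<le> a5"
    using assms lead_const_bounds[of lam] by (auto simp: a)
  moreover have "threshold lam = 1 + a1 + a2 + a3 + a4 + a5" by (simp add: threshold_def a)
  ultimately have "1 \<le> threshold lam \<and> a1 \<le> threshold lam \<and> a2 \<le> threshold lam \<and> a3 \<le> threshold lam
    \<and> a4 \<le> threshold lam \<and> a5 \<le> threshold lam" by auto
  then show "1 \<le> threshold lam" "12 * (4 * (10 * lam + 64 * exp 12 + 5) + 2) \<le> threshold lam"
    "32 / lead_const lam \<le> threshold lam" "4 * err_const lam / (lead_const lam)\<^sup>2 \<le> threshold lam"
    "16 * exp 12 / (lead_const lam)\<^sup>2 \<le> threshold lam" "15360 / (lead_const lam) ^ 4 \<le> threshold lam"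
    by (simp_all add: a)
qed

section \<open>Graphs and majority dynamics\<close>

definition pairs :: "nat set \<Rightarrow> nat set set" where
  "pairs V = {e. e \<subseteq> V \<and> card e = 2}"

definition star :: "nat \<Rightarrow> nat set \<Rightarrow> nat set set" where
  "star v A = (\<lambda>x. {v, x}) ` A"

lemma finite_pairs [simp]: "finite V \<Longrightarrow> finite (pairs V)"
  by (rule finite_subset[of _ "Pow V"]) (auto simp: pairs_def)

lemma star_insert: "star v (insert w A) = insert {v, w} (star v A)"
  by (simp add: star_def)

lemma doubleton_in_star: "{u, x} \<in> star v A \<longleftrightarrow> (u = v \<and> x \<in> A) \<or> (x = v \<and> u \<in> A)"
  by (auto simp: star_def doubleton_eq_iff)

lemma pairs_insert: "v \<notin> W \<Longrightarrow> pairs (insert v W) = pairs W \<union> star v W"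
proof (intro equalityI subsetI)
  fix e assume v: "v \<notin> W" and "e \<in> pairs (insert v W)"
  then have e: "e \<subseteq> insert v W" "card e = 2" by (auto simp: pairs_def)
  then obtain x y where "e = {x, y}" "x \<noteq> y" by (meson card_2_iff)
  then show "e \<in> pairs W \<union> star v W"
    using e v by (auto simp: pairs_def star_def doubleton_eq_iff)
qed (auto simp: pairs_def star_def card_insert_if)

lemma star_disjoint: "v \<notin> W \<Longrightarrow> pairs W \<inter> star v A = {}"
  by (auto simp: pairs_def star_def)

lemma neighbours_insert_star:
  assumes "G \<subseteq> pairs W" "v \<notin> W" "A \<subseteq> W"
  shows "neighbours (G \<union> star v A) v = A"
    and "u \<noteq> v \<Longrightarrow> neighbours (G \<union> star v A) u = neighbours G u \<union> (if u \<in> A then {v} else {})"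
proof -
  have "{x, v} \<notin> G" for x using assms by (auto simp: pairs_def)
  then show "neighbours (G \<union> star v A) v = A"
    using assms by (auto simp: neighbours_def doubleton_in_star)
  show "u \<noteq> v \<Longrightarrow> neighbours (G \<union> star v A) u = neighbours G u \<union> (if u \<in> A then {v} else {})"
    by (auto simp: neighbours_def doubleton_in_star)
qed

lemma neighbours_subset:
  assumes "G \<subseteq> pairs W"
  shows "neighbours G u \<subseteq> W" "u \<notin> neighbours G u"
proof -
  have *: "x \<in> W \<and> x \<noteq> u" if "{x, u} \<in> G" for x
  proof -
    have "{x, u} \<subseteq> W" "card {x, u} = 2" using that assms by (auto simp: pairs_def)
    then show ?thesis by auto
  qed
  show "neighbours G u \<subseteq> W" using * by (auto simp: neighbours_def)
  show "u \<notin> neighbours G u" using *[of u] unfolding neighbours_def by blast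
qed

definition score :: "(nat \<Rightarrow> int) \<Rightarrow> nat set set \<Rightarrow> nat \<Rightarrow> int" where
  "score s G u = (\<Sum>x\<in>neighbours G u. s x)"

definition maj :: "int \<Rightarrow> int \<Rightarrow> int" where
  "maj z t = (if z \<noteq> 0 then sgn z else t)"

lemma majority_dynamics_Suc:
  "majority_dynamics E s (Suc t) v = maj (score (majority_dynamics E s t) E v) (majority_dynamics E s t v)"
  by (simp add: maj_def score_def Let_def)

lemma majority_dynamics_shift:
  "majority_dynamics E s (t + k) = majority_dynamics E (majority_dynamics E s t) k"
  by (induction k) (simp_all add: fun_eq_iff)

lemma maj_values: "t = 1 \<or> t = -1 \<Longrightarrow> maj z t = 1 \<or> maj z t = -1"
  by (auto simp: maj_def sgn_if)

lemma maj_eq_1_iff: "t = 1 \<or> t = -1 \<Longrightarrow> maj z t = 1 \<longleftrightarrow> (if t = 1 then 0 else 1) \<le> z"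
  by (auto simp: maj_def sgn_if)

lemma maj_mono: "y \<le> z \<Longrightarrow> t = 1 \<or> t = -1 \<Longrightarrow> maj y t \<le> maj z t"
  by (auto simp: maj_def sgn_if)

lemma neighbours_insert_edge:
  "neighbours (insert {v, w} E) v = insert w (neighbours E v)"
  "neighbours (insert {v, w} E) w = insert v (neighbours E w)"
  by (auto simp: neighbours_def doubleton_eq_iff)

lemma real_card_eq_sum: "finite U \<Longrightarrow> real (card {u\<in>U. Q u}) = (\<Sum>u\<in>U. of_bool (Q u))"
  by (simp add: sum_of_bool_eq Int_def)

lemma card_signs:
  assumes "finite U" "\<And>u. u \<in> U \<Longrightarrow> s u = 1 \<or> s u = (-1::int)"
  shows "card {x\<in>U. s x = 1} + card {x\<in>U. s x = -1} = card U"
proof -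
  have "card ({x\<in>U. s x = 1} \<union> {x\<in>U. s x = -1}) = card {x\<in>U. s x = 1} + card {x\<in>U. s x = -1}"
    using assms(1) by (intro card_Un_disjoint) auto
  moreover have "{x\<in>U. s x = 1} \<union> {x\<in>U. s x = -1} = U" using assms(2) by blast
  ultimately show ?thesis by simp
qed

text \<open>The first-day opinion of \<open>u\<close> in \<open>G\<close> when its neighbours outside \<open>G\<close> contribute \<open>\<tau>\<close>.\<close>

definition opin :: "(nat \<Rightarrow> int) \<Rightarrow> nat set set \<Rightarrow> int \<Rightarrow> nat \<Rightarrow> int" where
  "opin s G \<tau> u = maj (score s G u + \<tau>) (s u)"

definition num_plus :: "nat set \<Rightarrow> (nat \<Rightarrow> int) \<Rightarrow> nat set set \<Rightarrow> int \<Rightarrow> nat" where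
  "num_plus U s G \<tau> = card {u \<in> U. opin s G \<tau> u = 1}"

definition signs :: "nat set \<Rightarrow> nat \<Rightarrow> int" where
  "signs B v = (if v \<in> B then -1 else 1)"

text \<open>A vertex with opinion \<open>-1\<close> after a step had a negative score or kept
  \<open>-1\<close> in a tie. If \<open>B\<close> is today's minority and \<open>C\<close>
  tomorrow's, this condition therefore holds. It no longer mentions the dynamics, so a union bound
  over all \<open>B\<close> and \<open>C\<close> avoids every dependence between the days.\<close>

definition stuck :: "nat set \<Rightarrow> nat set \<Rightarrow> nat set set \<Rightarrow> bool" where
  "stuck B C E \<longleftrightarrow> (\<forall>v\<in>C. score (signs B) E v \<le> 0)"

definition stuck_large :: "nat set \<Rightarrow> real \<Rightarrow> nat set set \<Rightarrow> bool" where
  "stuck_large V D E \<longleftrightarrow> (\<exists>B\<in>Pow V. \<exists>C\<in>Pow V. 2 * D * real (card V) \<le> real (card V) - 2 * real (card B)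
      \<and> real (card V) \<le> 10 * real (card C) \<and> stuck B C E)"

text \<open>Its negation says that a minority of at most a tenth more than halves in one step unless
  it vanishes.\<close>

definition stuck_small :: "nat set \<Rightarrow> nat set set \<Rightarrow> bool" where
  "stuck_small V E \<longleftrightarrow> (\<exists>C\<in>Pow V. \<exists>B\<in>Pow V.
      C \<noteq> {} \<and> 10 * real (card B) \<le> real (card V) \<and> card B \<le> 2 * card C \<and> stuck B C E)"

lemma sum_signs:
  assumes "finite V" "B \<subseteq> V"
  shows "real_of_int (\<Sum>x\<in>V. signs B x) = real (card V) - 2 * real (card B)"
proof -
  have "(\<Sum>x\<in>V. signs B x) = (\<Sum>x\<in>B. signs B x) + (\<Sum>x\<in>V - B. signs B x)"
    using assms by (metis add.commute sum.subset_diff)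
  also have "\<dots> = - int (card B) + int (card (V - B))" by (simp add: signs_def)
  also have "int (card (V - B)) = int (card V) - int (card B)"
    using assms by (simp add: card_Diff_subset finite_subset of_nat_diff card_mono)
  finally show ?thesis by simp
qed

lemma majority_values:
  assumes "\<And>u. u \<in> V \<Longrightarrow> s u = 1 \<or> s u = (-1::int)" "v \<in> V"
  shows "majority_dynamics E s t v = 1 \<or> majority_dynamics E s t v = -1"
proof (induction t)
  case (Suc t)
  then show ?case unfolding majority_dynamics_Suc by (rule maj_values)
qed (use assms in simp)

lemma majority_step_stuck:
  assumes E: "E \<subseteq> pairs V" and s: "\<And>u. u \<in> V \<Longrightarrow> s u = 1 \<or> s u = (-1::int)"
  shows "stuck {u\<in>V. s u = -1} {u\<in>V. majority_dynamics E s 1 u = -1} E"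
  unfolding stuck_def
proof
  fix v assume v: "v \<in> {u\<in>V. majority_dynamics E s 1 u = -1}"
  have "score (signs {u\<in>V. s u = -1}) E v = score s E v"
    unfolding score_def
  proof (rule sum.cong[OF refl])
    fix x assume "x \<in> neighbours E v"
    then have "x \<in> V" using neighbours_subset(1)[OF E] by auto
    then show "signs {u\<in>V. s u = -1} x = s x" using s[of x] by (auto simp: signs_def)
  qed
  moreover have "maj (score s E v) (s v) = -1"
    using v majority_dynamics_Suc[of E s 0 v] by simp
  ultimately show "score (signs {u\<in>V. s u = -1}) E v \<le> 0"
    by (auto simp: maj_def sgn_if split: if_splits)
qed

text \<open>Strong induction on the size of the minority: the next minority is empty or strictly
  smaller, hence again at most a tenth.\<close>

lemma unanimity_of_small_minority:
  assumes V: "finite V" and E: "E \<subseteq> pairs V" and s: "\<And>u. u \<in> V \<Longrightarrow> s u = 1 \<or> s u = (-1::int)"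
    and small: "10 * card {u\<in>V. s u = -1} \<le> card V"
    and ok: "\<And>B C. B \<subseteq> V \<Longrightarrow> C \<subseteq> V \<Longrightarrow> C \<noteq> {} \<Longrightarrow> 10 * card B \<le> card V \<Longrightarrow> card B \<le> 2 * card C \<Longrightarrow> \<not> stuck B C E"
  shows "\<exists>t. \<forall>v\<in>V. majority_dynamics E s t v = 1"
  using s small
proof (induction "card {u\<in>V. s u = -1}" arbitrary: s rule: less_induct)
  case less
  let ?B = "{u\<in>V. s u = -1}"
  let ?s = "majority_dynamics E s 1"
  let ?C = "{u\<in>V. ?s u = -1}"
  have val: "?s u = 1 \<or> ?s u = -1" if "u \<in> V" for u
    using less.prems(1) that by (rule majority_values)
  show ?case
  proof (cases "?C = {}")
    case True
    then have "\<forall>v\<in>V. ?s v = 1" using val by blast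
    then show ?thesis by blast
  next
    case False
    have "stuck ?B ?C E" using E less.prems(1) by (rule majority_step_stuck)
    then have "\<not> card ?B \<le> 2 * card ?C"
      using ok[of ?B ?C, OF _ _ False less.prems(2)] by blast
    then have lt: "card ?C < card ?B" by linarith
    then have "10 * card ?C \<le> card V" using less.prems(2) by linarith
    then obtain t where "\<forall>v\<in>V. majority_dynamics E ?s t v = 1"
      using less.hyps[OF lt val] by blast
    then show ?thesis unfolding majority_dynamics_shift[symmetric] by blast
  qed
qed

section \<open>Random subsets\<close>

locale bernoulli_param =
  fixes p :: real
  assumes p_pos: "0 < p" and p_half: "p \<le> 1/2"
begin

lemma p_simps [simp]: "0 \<le> p" "p \<le> 1" "0 \<le> 1 - p" "0 < 1 - p" "p < 1"
  using p_pos p_half by auto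

text \<open>The expectation of \<open>f S\<close> for a random subset \<open>S\<close> of \<open>A\<close> that contains each element
  independently with probability \<open>p\<close>.\<close>

definition expect :: "'a set \<Rightarrow> ('a set \<Rightarrow> real) \<Rightarrow> real" where
  "expect A f = (\<Sum>S\<in>Pow A. p ^ card S * (1 - p) ^ card (A - S) * f S)"

lemma expect_empty [simp]: "expect {} f = f {}"
  by (simp add: expect_def)

lemma expect_cong: "A = B \<Longrightarrow> (\<And>S. S \<subseteq> B \<Longrightarrow> f S = g S) \<Longrightarrow> expect A f = expect B g"
  unfolding expect_def by (auto intro!: sum.cong)

text \<open>Conditioning on the choice at \<open>a\<close>. Most later rules for
  \<open>expect\<close> are inductions over the ground set with this step.\<close>

lemma expect_insert:
  assumes "finite A" "a \<notin> A"
  shows "expect (insert a A) f = p * expect A (\<lambda>S. f (insert a S)) + (1 - p) * expect A f"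
proof -
  have inj: "inj_on (insert a) (Pow A)"
    using assms by (auto simp: inj_on_def)
  have disj: "Pow A \<inter> insert a ` Pow A = {}"
    using assms by auto
  have 1: "(\<Sum>S\<in>Pow A. p ^ card S * (1 - p) ^ card (insert a A - S) * f S) = (1 - p) * expect A f"
    unfolding expect_def sum_distrib_left
  proof (rule sum.cong)
    fix S assume "S \<in> Pow A"
    then have "insert a A - S = insert a (A - S)" "a \<notin> A - S" "finite (A - S)"
      using assms by auto
    then show "p ^ card S * (1 - p) ^ card (insert a A - S) * f S
      = (1 - p) * (p ^ card S * (1 - p) ^ card (A - S) * f S)"
      by simp
  qed simp
  have 2: "(\<Sum>S\<in>insert a ` Pow A. p ^ card S * (1 - p) ^ card (insert a A - S) * f S)
      = p * expect A (\<lambda>S. f (insert a S))"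
    unfolding expect_def sum_distrib_left sum.reindex[OF inj] o_def
  proof (rule sum.cong)
    fix S assume S: "S \<in> Pow A"
    then have "insert a A - insert a S = A - S" "a \<notin> S" "finite S"
      using assms by (auto intro: finite_subset)
    then show "p ^ card (insert a S) * (1 - p) ^ card (insert a A - insert a S) * f (insert a S)
      = p * (p ^ card S * (1 - p) ^ card (A - S) * f (insert a S))"
      by simp
  qed simp
  show ?thesis
    unfolding expect_def[of "insert a A"] Pow_insert
    by (subst sum.union_disjoint) (use assms disj 1 2 in auto)
qed

lemma expect_add: "expect A (\<lambda>S. f S + g S) = expect A f + expect A g"
  by (simp add: expect_def algebra_simps sum.distrib)

lemma expect_diff: "expect A (\<lambda>S. f S - g S) = expect A f - expect A g"
  by (simp add: expect_def algebra_simps sum_subtractf)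

lemma expect_cmult: "expect A (\<lambda>S. c * f S) = c * expect A f"
  by (simp add: expect_def algebra_simps sum_distrib_left)

lemma expect_multc: "expect A (\<lambda>S. f S * c) = expect A f * c"
  by (simp add: expect_def algebra_simps sum_distrib_left)

lemma expect_sum: "expect A (\<lambda>S. \<Sum>i\<in>I. f i S) = (\<Sum>i\<in>I. expect A (f i))"
  unfolding expect_def by (subst sum.swap) (simp add: sum_distrib_left)

lemma expect_const [simp]: "finite A \<Longrightarrow> expect A (\<lambda>S. c) = c"
  by (induction A rule: finite_induct) (simp_all add: expect_insert algebra_simps)

lemma expect_mono: "(\<And>S. S \<subseteq> A \<Longrightarrow> f S \<le> g S) \<Longrightarrow> expect A f \<le> expect A g"
  unfolding expect_def by (intro sum_mono mult_left_mono) auto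

lemma expect_nonneg: "(\<And>S. S \<subseteq> A \<Longrightarrow> 0 \<le> f S) \<Longrightarrow> 0 \<le> expect A f"
  unfolding expect_def by (intro sum_nonneg mult_nonneg_nonneg) auto

lemma expect_le_const: "finite A \<Longrightarrow> (\<And>S. S \<subseteq> A \<Longrightarrow> f S \<le> c) \<Longrightarrow> expect A f \<le> c"
  using expect_mono[of A f "\<lambda>_. c"] by simp

lemma expect_commute: "expect A (\<lambda>S. expect B (f S)) = expect B (\<lambda>T. expect A (\<lambda>S. f S T))"
  unfolding expect_def sum_distrib_left by (subst sum.swap) (simp add: mult_ac)

lemma expect_Un:
  assumes "finite A" "finite B" "A \<inter> B = {}"
  shows "expect (A \<union> B) f = expect A (\<lambda>S. expect B (\<lambda>T. f (S \<union> T)))"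
  using assms
proof (induction A arbitrary: f rule: finite_induct)
  case (insert a A)
  then have "a \<notin> A \<union> B" "finite (A \<union> B)" "A \<inter> B = {}" by auto
  then show ?case
    using insert by (simp add: expect_insert)
qed simp

lemma expect_image:
  assumes "finite A" "inj_on h A"
  shows "expect (h ` A) f = expect A (\<lambda>S. f (h ` S))"
  using assms
proof (induction A arbitrary: f rule: finite_induct)
  case (insert a A)
  then have "h a \<notin> h ` A" "inj_on h A" by (auto simp: inj_on_def)
  then show ?case
    using insert by (simp add: expect_insert)
qed simp

text \<open>Independence in the form of a moment generating function: the Chernoff bound takes an
  exponential for \<open>g\<close>.\<close>

lemma expect_prod:
  assumes "finite A"
  shows "expect A (\<lambda>S. \<Prod>e\<in>S. g e) = (\<Prod>e\<in>A. p * g e + (1 - p))"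
  using assms
proof (induction A rule: finite_induct)
  case (insert a A)
  have "expect A (\<lambda>S. prod g (insert a S)) = expect A (\<lambda>S. g a * prod g S)"
    by (rule expect_cong[OF refl], subst prod.insert) (use insert in \<open>auto intro: finite_subset\<close>)
  then show ?case
    using insert by (simp add: expect_insert expect_cmult algebra_simps)
qed simp

lemma expect_card: "finite A \<Longrightarrow> expect A (\<lambda>S. real (card S)) = p * real (card A)"
proof (induction A rule: finite_induct)
  case (insert a A)
  have "expect A (\<lambda>S. real (card (insert a S))) = expect A (\<lambda>S. real (card S) + 1)"
    by (rule expect_cong[OF refl], subst card_insert_disjoint) (use insert in \<open>auto intro: finite_subset\<close>)
  then show ?case
    using insert by (simp add: expect_insert expect_add algebra_simps)
qed simp

lemma expect_Cauchy_Schwarz_const: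
  assumes "finite A"
  shows "(expect A f)\<^sup>2 \<le> expect A (\<lambda>S. (f S)\<^sup>2)"
proof -
  have "0 \<le> expect A (\<lambda>S. (f S - expect A f)\<^sup>2)" by (rule expect_nonneg) simp
  also have "\<dots> = expect A (\<lambda>S. (f S)\<^sup>2 - 2 * expect A f * f S + (expect A f)\<^sup>2)"
    by (rule expect_cong) (auto simp: power2_eq_square algebra_simps)
  also have "\<dots> = expect A (\<lambda>S. (f S)\<^sup>2) - (expect A f)\<^sup>2"
    using assms by (simp add: expect_add expect_diff expect_cmult power2_eq_square)
  finally show ?thesis by simp
qed

section \<open>Variance, covariance and Chebyshev's inequality\<close>

definition Var :: "'a set \<Rightarrow> ('a set \<Rightarrow> real) \<Rightarrow> real" where
  "Var A f = expect A (\<lambda>S. (f S)\<^sup>2) - (expect A f)\<^sup>2"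

definition Cov :: "'a set \<Rightarrow> ('a set \<Rightarrow> real) \<Rightarrow> ('a set \<Rightarrow> real) \<Rightarrow> real" where
  "Cov A f g = expect A (\<lambda>S. f S * g S) - expect A f * expect A g"

lemma Var_centered: "finite A \<Longrightarrow> Var A f = expect A (\<lambda>S. (f S - expect A f)\<^sup>2)"
proof -
  assume A: "finite A"
  have "expect A (\<lambda>S. (f S - expect A f)\<^sup>2) = expect A (\<lambda>S. (f S)\<^sup>2 - 2 * expect A f * f S + (expect A f)\<^sup>2)"
    by (rule expect_cong) (auto simp: power2_eq_square algebra_simps)
  also have "\<dots> = expect A (\<lambda>S. (f S)\<^sup>2) - (expect A f)\<^sup>2"
    using A by (simp add: expect_add expect_diff expect_cmult power2_eq_square)
  finally show ?thesis by (simp add: Var_def)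
qed

lemma Var_sum:
  "Var A (\<lambda>S. \<Sum>i\<in>I. f i S) = (\<Sum>i\<in>I. \<Sum>j\<in>I. Cov A (f i) (f j))"
  unfolding Var_def Cov_def
  by (simp add: power2_eq_square sum_product expect_sum sum_subtractf)

lemma Cov_eq_centered:
  "finite A \<Longrightarrow> Cov A f g = expect A (\<lambda>S. (f S - expect A f) * (g S - expect A g))"
proof -
  assume A: "finite A"
  have "expect A (\<lambda>S. (f S - expect A f) * (g S - expect A g))
     = expect A (\<lambda>S. f S * g S - expect A f * g S - expect A g * f S + expect A f * expect A g)"
    by (rule expect_cong) (auto simp: algebra_simps)
  also have "\<dots> = expect A (\<lambda>S. f S * g S) - expect A f * expect A g"
    using A by (simp add: expect_add expect_diff expect_cmult)
  finally show ?thesis by (simp add: Cov_def)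
qed

lemma Cov_le_Var: "finite A \<Longrightarrow> Cov A f g \<le> (Var A f + Var A g) / 2"
proof -
  assume A: "finite A"
  have "Cov A f g \<le> expect A (\<lambda>S. (1/2) * ((f S - expect A f)\<^sup>2 + (g S - expect A g)\<^sup>2))"
    unfolding Cov_eq_centered[OF A]
  proof (rule expect_mono)
    fix S
    have "0 \<le> ((f S - expect A f) - (g S - expect A g))\<^sup>2" by simp
    then show "(f S - expect A f) * (g S - expect A g) \<le> 1/2 * ((f S - expect A f)\<^sup>2 + (g S - expect A g)\<^sup>2)"
      by (simp add: power2_eq_square algebra_simps)
  qed
  also have "\<dots> = (Var A f + Var A g) / 2"
    unfolding expect_cmult expect_add Var_centered[OF A] by simp
  finally show ?thesis .
qed

text \<open>With two independent copies the mean disappears, so a Lipschitz relation between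
  functions passes directly to their variances.\<close>

lemma Var_two_copies:
  assumes "finite A"
  shows "2 * Var A f = expect A (\<lambda>S. expect A (\<lambda>T. (f S - f T)\<^sup>2))"
proof -
  have "(\<lambda>S. expect A (\<lambda>T. (f S - f T)\<^sup>2)) = (\<lambda>S. (f S)\<^sup>2 + expect A (\<lambda>T. (f T)\<^sup>2) - 2 * expect A f * f S)"
  proof
    fix S
    have "expect A (\<lambda>T. (f S - f T)\<^sup>2) = expect A (\<lambda>T. (f S)\<^sup>2 + (f T)\<^sup>2 - (2 * f S) * f T)"
      by (rule expect_cong) (auto simp: power2_eq_square algebra_simps)
    then show "expect A (\<lambda>T. (f S - f T)\<^sup>2) = (f S)\<^sup>2 + expect A (\<lambda>T. (f T)\<^sup>2) - 2 * expect A f * f S"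
      using assms by (simp add: expect_add expect_diff expect_cmult)
  qed
  then show ?thesis
    using assms by (simp add: expect_add expect_diff expect_cmult Var_def power2_eq_square)
qed

lemma Var_Lipschitz:
  assumes "finite A" "0 \<le> L"
    and "\<And>S T. S \<subseteq> A \<Longrightarrow> T \<subseteq> A \<Longrightarrow> \<bar>f S - f T\<bar> \<le> L * \<bar>g S - g T\<bar>"
  shows "Var A f \<le> L\<^sup>2 * Var A g"
proof -
  have "expect A (\<lambda>S. expect A (\<lambda>T. (f S - f T)\<^sup>2)) \<le> expect A (\<lambda>S. expect A (\<lambda>T. L\<^sup>2 * (g S - g T)\<^sup>2))"
  proof (intro expect_mono)
    fix S T assume "S \<subseteq> A" "T \<subseteq> A"
    then have "\<bar>f S - f T\<bar>\<^sup>2 \<le> (L * \<bar>g S - g T\<bar>)\<^sup>2"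
      using assms by (intro power_mono) auto
    then show "(f S - f T)\<^sup>2 \<le> L\<^sup>2 * (g S - g T)\<^sup>2" by (simp add: power_mult_distrib)
  qed
  also have "\<dots> = L\<^sup>2 * expect A (\<lambda>S. expect A (\<lambda>T. (g S - g T)\<^sup>2))"
    by (simp add: expect_cmult)
  finally show ?thesis
    using assms by (simp add: Var_two_copies[symmetric])
qed

lemma expect_abs_dev_le:
  assumes "finite A" "Var A f \<le> V"
  shows "expect A (\<lambda>S. \<bar>f S - expect A f\<bar>) \<le> sqrt V"
proof -
  have "(expect A (\<lambda>S. \<bar>f S - expect A f\<bar>))\<^sup>2 \<le> expect A (\<lambda>S. \<bar>f S - expect A f\<bar>\<^sup>2)"
    by (rule expect_Cauchy_Schwarz_const[OF assms(1)])
  also have "\<dots> \<le> V" using assms by (simp add: Var_centered)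
  finally show ?thesis by (rule real_le_rsqrt)
qed

lemma expect_Chebyshev_lower:
  assumes "finite A" "Var A f \<le> V" "m \<le> expect A f" "0 < t"
  shows "expect A (\<lambda>S. of_bool (f S < m - t)) \<le> V / t\<^sup>2"
proof -
  have "expect A (\<lambda>S. of_bool (f S < m - t)) \<le> expect A (\<lambda>S. (1 / t\<^sup>2) * (f S - expect A f)\<^sup>2)"
  proof (rule expect_mono)
    fix S
    show "of_bool (f S < m - t) \<le> (1 / t\<^sup>2) * (f S - expect A f)\<^sup>2"
    proof (cases "f S < m - t")
      case True
      then have "t \<le> \<bar>f S - expect A f\<bar>" using assms by linarith
      then have "t\<^sup>2 \<le> (f S - expect A f)\<^sup>2" using assms by (metis abs_le_square_iff abs_of_pos)
      then show ?thesis using True assms by (simp add: field_simps)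
    qed simp
  qed
  also have "\<dots> = Var A f / t\<^sup>2"
    unfolding expect_cmult Var_centered[OF assms(1)] by simp
  also have "\<dots> \<le> V / t\<^sup>2"
    using assms by (simp add: divide_right_mono)
  finally show ?thesis .
qed

section \<open>Differences of two binomial variables\<close>

definition plus_step :: "(int \<Rightarrow> real) \<Rightarrow> int \<Rightarrow> real" where
  "plus_step \<phi> = (\<lambda>z. p * \<phi> (z + 1) + (1 - p) * \<phi> z)"

definition minus_step :: "(int \<Rightarrow> real) \<Rightarrow> int \<Rightarrow> real" where
  "minus_step \<phi> = (\<lambda>z. p * \<phi> (z - 1) + (1 - p) * \<phi> z)"

text \<open>\<open>walk a b \<phi> z\<close> is the expectation of \<open>\<phi> (z + X - Y)\<close> for independent binomial variables
  \<open>X\<close> and \<open>Y\<close> with \<open>a\<close> and \<open>b\<close> trials.\<close>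

definition walk :: "nat \<Rightarrow> nat \<Rightarrow> (int \<Rightarrow> real) \<Rightarrow> int \<Rightarrow> real" where
  "walk a b \<phi> = (plus_step ^^ a) ((minus_step ^^ b) \<phi>)"

lemma walk_0_0 [simp]: "walk 0 0 \<phi> = \<phi>"
  by (simp add: walk_def)

lemma walk_Suc1: "walk (Suc a) b \<phi> z = p * walk a b \<phi> (z + 1) + (1 - p) * walk a b \<phi> z"
  by (simp add: walk_def plus_step_def)

text \<open>Since the two kinds of steps commute, \<open>walk\<close> can be unfolded in either of
  its counts.\<close>

lemma plus_minus_step: "(plus_step ^^ a) (minus_step \<phi>) = minus_step ((plus_step ^^ a) \<phi>)"
proof (induction a)
  case (Suc a)
  then show ?case
    by (auto simp: plus_step_def minus_step_def algebra_simps)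
qed simp

lemma walk_Suc2: "walk a (Suc b) \<phi> z = p * walk a b \<phi> (z - 1) + (1 - p) * walk a b \<phi> z"
  by (simp add: walk_def plus_minus_step) (simp add: minus_step_def)

lemma walk_induct [case_names zero plus minus]:
  assumes "P 0 0" "\<And>a b. P a b \<Longrightarrow> P (Suc a) b" "\<And>a b. P a b \<Longrightarrow> P a (Suc b)"
  shows "P a b"
proof (induction a)
  case 0
  show ?case using assms by (induction b) auto
qed (use assms in auto)

lemma walk_const [simp]: "walk a b (\<lambda>_. c) z = c"
  by (induction a b arbitrary: z rule: walk_induct) (auto simp: walk_Suc1 walk_Suc2 algebra_simps)

lemma walk_add: "walk a b (\<lambda>y. \<phi> y + \<psi> y) z = walk a b \<phi> z + walk a b \<psi> z"
  by (induction a b arbitrary: z rule: walk_induct) (auto simp: walk_Suc1 walk_Suc2 algebra_simps)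

lemma walk_shift: "walk a b \<phi> (z + k) = walk a b (\<lambda>y. \<phi> (y + k)) z"
proof (induction a b arbitrary: z rule: walk_induct)
  case (plus a b)
  then show ?case
    using plus[of "z + 1"] plus[of z] by (simp add: walk_Suc1 algebra_simps)
next
  case (minus a b)
  then show ?case
    using minus[of "z - 1"] minus[of z] by (simp add: walk_Suc2 algebra_simps)
qed simp

lemma walk_reflect: "walk a b \<phi> z = walk b a (\<lambda>y. \<phi> (- y)) (- z)"
  by (induction a b arbitrary: z rule: walk_induct) (auto simp: walk_Suc1 walk_Suc2 algebra_simps)

lemma walk_mono: "(\<And>y. \<phi> y \<le> \<psi> y) \<Longrightarrow> walk a b \<phi> z \<le> walk a b \<psi> z"
  by (induction a b arbitrary: z rule: walk_induct)
     (auto simp: walk_Suc1 walk_Suc2 intro!: add_mono mult_left_mono)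

lemma expect_signed_sum:
  assumes "finite W" "\<And>x. x \<in> W \<Longrightarrow> s x = 1 \<or> s x = (-1::int)"
  shows "expect W (\<lambda>T. \<phi> (z + (\<Sum>x\<in>T. s x)))
       = walk (card {x\<in>W. s x = 1}) (card {x\<in>W. s x = -1}) \<phi> z"
  using assms
proof (induction W arbitrary: z rule: finite_induct)
  case (insert a W)
  have "expect W (\<lambda>S. \<phi> (z + sum s (insert a S))) = expect W (\<lambda>S. \<phi> ((z + s a) + sum s S))"
    by (rule expect_cong[OF refl], subst sum.insert)
       (use insert in \<open>auto intro: finite_subset simp: algebra_simps\<close>)
  also have "\<dots> = walk (card {x \<in> W. s x = 1}) (card {x \<in> W. s x = - 1}) \<phi> (z + s a)"
    using insert by simp
  finally have eq: "expect W (\<lambda>S. \<phi> (z + sum s (insert a S)))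
      = walk (card {x \<in> W. s x = 1}) (card {x \<in> W. s x = - 1}) \<phi> (z + s a)" .
  have IH: "expect W (\<lambda>S. \<phi> (z + sum s S)) = walk (card {x \<in> W. s x = 1}) (card {x \<in> W. s x = - 1}) \<phi> z"
    using insert by simp
  consider "s a = 1" | "s a = -1" using insert by auto
  then show ?case
  proof cases
    case 1
    have "{x \<in> insert a W. s x = 1} = insert a {x\<in>W. s x = 1}"
         "{x \<in> insert a W. s x = -1} = {x\<in>W. s x = -1}" using 1 by auto
    then show ?thesis using insert 1 eq IH by (simp add: expect_insert walk_Suc1)
  next
    case 2
    have "{x \<in> insert a W. s x = -1} = insert a {x\<in>W. s x = -1}"
         "{x \<in> insert a W. s x = 1} = {x\<in>W. s x = 1}" using 2 by auto
    then show ?thesis using insert 2 eq IH by (simp add: expect_insert walk_Suc2)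
  qed
qed simp

section \<open>Point and tail probabilities of the difference\<close>

definition PT :: "nat \<Rightarrow> nat \<Rightarrow> int \<Rightarrow> real" where
  "PT a b k = walk a b (\<lambda>z. of_bool (z = k)) 0"

definition GT :: "nat \<Rightarrow> nat \<Rightarrow> int \<Rightarrow> real" where
  "GT a b k = walk a b (\<lambda>z. of_bool (k \<le> z)) 0"

lemma walk_ge_at: "walk a b (\<lambda>y. of_bool (k \<le> y)) z = GT a b (k - z)"
proof -
  have "(\<lambda>y. of_bool (k \<le> y + z)) = (\<lambda>y. of_bool (k - z \<le> y) :: real)" by (auto simp: fun_eq_iff)
  then show ?thesis using walk_shift[of a b "\<lambda>y. of_bool (k \<le> y)" 0 z] by (simp add: GT_def)
qed

lemma GT_Suc_arg: "GT a b k = GT a b (k + 1) + PT a b k"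
proof -
  have "(\<lambda>z. of_bool (k \<le> z) :: real) = (\<lambda>z. of_bool (k + 1 \<le> z) + of_bool (z = k))"
    by auto
  then show ?thesis unfolding GT_def PT_def by (simp only: walk_add)
qed

text \<open>A further positive trial matters only if it succeeds while the difference is
  \<open>k - 1\<close>. This exact increment and its companion for negative trials turn bounds on
  point probabilities into Lipschitz and slope bounds for tails.\<close>

lemma GT_Suc1: "GT (Suc a) b k = GT a b k + p * PT a b (k - 1)"
proof -
  have "GT (Suc a) b k = p * walk a b (\<lambda>z. of_bool (k \<le> z)) (0 + 1) + (1 - p) * walk a b (\<lambda>z. of_bool (k \<le> z)) 0"
    unfolding GT_def by (rule walk_Suc1)
  then have 1: "GT (Suc a) b k = p * GT a b (k - 1) + (1 - p) * GT a b k"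
    unfolding walk_ge_at by simp
  have 2: "GT a b (k - 1) = GT a b k + PT a b (k - 1)"
    using GT_Suc_arg[of a b "k - 1"] by (simp only: diff_add_cancel)
  show ?thesis unfolding 1 2 by (simp add: algebra_simps)
qed

lemma GT_Suc2: "GT a (Suc b) k = GT a b k - p * PT a b k"
proof -
  have "GT a (Suc b) k = p * walk a b (\<lambda>z. of_bool (k \<le> z)) (0 - 1) + (1 - p) * walk a b (\<lambda>z. of_bool (k \<le> z)) 0"
    unfolding GT_def by (rule walk_Suc2)
  then have 1: "GT a (Suc b) k = p * GT a b (k + 1) + (1 - p) * GT a b k"
    unfolding walk_ge_at by simp
  have 2: "GT a b (k + 1) = GT a b k - PT a b k"
    unfolding GT_Suc_arg[of a b k] by (rule add_diff_cancel_right'[symmetric])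
  show ?thesis unfolding 1 2 by (simp add: algebra_simps)
qed

lemma PT_nonneg [simp]: "0 \<le> PT a b k"
proof -
  have "walk a b (\<lambda>_. 0) 0 \<le> PT a b k" unfolding PT_def by (rule walk_mono) simp
  then show ?thesis by simp
qed

lemma GT_nonneg [simp]: "0 \<le> GT a b k"
proof -
  have "walk a b (\<lambda>_. 0) 0 \<le> GT a b k" unfolding GT_def by (rule walk_mono) simp
  then show ?thesis by simp
qed

lemma GT_le_1 [simp]: "GT a b k \<le> 1"
proof -
  have "GT a b k \<le> walk a b (\<lambda>_. 1) 0" unfolding GT_def by (rule walk_mono) simp
  then show ?thesis by simp
qed

lemma PT_commute: "PT a b k = PT b a (- k)"
proof -
  have "(\<lambda>y. of_bool (- y = k)) = (\<lambda>y. of_bool (y = - k) :: real)" by (auto simp: fun_eq_iff)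
  then show ?thesis unfolding PT_def by (subst walk_reflect) simp
qed

text \<open>For integers, \<open>X - Y \<ge> k\<close> fails exactly when
  \<open>Y - X \<ge> 1 - k\<close>.\<close>

lemma GT_reflect: "GT a b k + GT b a (1 - k) = 1"
proof -
  have "GT b a (1 - k) = walk a b (\<lambda>z. of_bool (1 - k \<le> - z)) 0"
    unfolding GT_def by (subst walk_reflect) simp
  then have "GT a b k + GT b a (1 - k) = walk a b (\<lambda>z. of_bool (k \<le> z) + of_bool (1 - k \<le> - z)) 0"
    by (simp only: walk_add GT_def)
  also have "(\<lambda>z. of_bool (k \<le> z) + of_bool (1 - k \<le> - z)) = (\<lambda>_. 1::real)"
    by auto
  finally show ?thesis by simp
qed

section \<open>Binomial probabilities\<close>

lemma Bernstein_Suc_Suc: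
  "Bernstein (Suc a) (Suc i) x = x * Bernstein a i x + (1 - x) * Bernstein a (Suc i) x"
proof (cases "i < a")
  case True
  then have "Suc (a - Suc i) = a - i" by simp
  then have e: "(1 - x) ^ (a - i) = (1 - x) * (1 - x) ^ (a - Suc i)" by (metis power_Suc)
  show ?thesis by (simp add: Bernstein_def e algebra_simps)
qed (auto simp: Bernstein_def not_less binomial_eq_0 le_less)

text \<open>\<open>Bernstein a i p\<close> is the probability of \<open>i\<close> successes in
  \<open>a\<close> trials, so the library facts on Bernstein polynomials supply total mass and
  second moment.\<close>

lemma walk_plus_eq_sum: "walk a 0 \<phi> z = (\<Sum>i\<le>a. Bernstein a i p * \<phi> (z + int i))"
proof (induction a arbitrary: z)
  case (Suc a)
  have 1: "(\<Sum>i\<le>Suc a. Bernstein a i p * \<phi> (z + int i)) = (\<Sum>i\<le>a. Bernstein a i p * \<phi> (z + int i))"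
    by (simp add: Bernstein_def)
  have "(\<Sum>i\<le>Suc a. Bernstein (Suc a) i p * \<phi> (z + int i))
     = (1 - p) * (Bernstein a 0 p * \<phi> z) + (\<Sum>i\<le>a. Bernstein (Suc a) (Suc i) p * \<phi> (z + int (Suc i)))"
    by (subst sum.atMost_Suc_shift) (simp add: Bernstein_def)
  also have "(\<Sum>i\<le>a. Bernstein (Suc a) (Suc i) p * \<phi> (z + int (Suc i)))
     = p * (\<Sum>i\<le>a. Bernstein a i p * \<phi> (z + 1 + int i))
     + (1 - p) * (\<Sum>i\<le>a. Bernstein a (Suc i) p * \<phi> (z + int (Suc i)))"
    unfolding sum_distrib_left sum.distrib[symmetric]
    by (rule sum.cong) (auto simp: Bernstein_Suc_Suc algebra_simps)
  finally have "(\<Sum>i\<le>Suc a. Bernstein (Suc a) i p * \<phi> (z + int i))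
     = p * (\<Sum>i\<le>a. Bernstein a i p * \<phi> (z + 1 + int i))
     + (1 - p) * (\<Sum>i\<le>Suc a. Bernstein a i p * \<phi> (z + int i))"
    by (subst sum.atMost_Suc_shift) (simp add: algebra_simps)
  then show ?case
    using Suc 1 by (simp only: walk_Suc1)
qed (simp add: Bernstein_def)

lemma walk_eq_sum:
  "walk a b \<phi> z = (\<Sum>j\<le>b. Bernstein b j p * (\<Sum>i\<le>a. Bernstein a i p * \<phi> (z + int i - int j)))"
proof -
  have "(plus_step ^^ a) ((minus_step ^^ b) \<phi>) = (minus_step ^^ b) ((plus_step ^^ a) \<phi>)"
    by (induction b) (auto simp: plus_minus_step)
  then have "walk a b \<phi> z = walk 0 b (walk a 0 \<phi>) z" by (simp add: walk_def)
  also have "\<dots> = (\<Sum>j\<le>b. Bernstein b j p * walk a 0 \<phi> (z - int j))"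
    by (subst walk_reflect) (simp add: walk_plus_eq_sum[of b "\<lambda>y. walk a 0 \<phi> (- y)"])
  finally show ?thesis unfolding walk_plus_eq_sum diff_add_eq .
qed

lemma PT_eq_sum:
  "PT a b k = (\<Sum>j\<le>b. Bernstein b j p * (\<Sum>i\<le>a. Bernstein a i p * of_bool (int i - int j = k)))"
  by (simp add: PT_def walk_eq_sum)

lemma Bernstein_p_nonneg [simp]: "0 \<le> Bernstein a i p"
  by (rule Bernstein_nonneg) auto

lemma sum_Bernstein_le_1:
  assumes "finite J"
  shows "(\<Sum>j\<in>J. Bernstein a j p) \<le> 1"
proof -
  have "(\<Sum>j\<in>J. Bernstein a j p) \<le> (\<Sum>j\<in>J \<union> {..a}. Bernstein a j p)"
    using assms by (intro sum_mono2) auto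
  also have "\<dots> = (\<Sum>j\<in>{..a}. Bernstein a j p)"
    using assms by (intro sum.mono_neutral_right) (auto simp: Bernstein_def binomial_eq_0)
  finally show ?thesis by (simp add: sum_Bernstein)
qed

text \<open>The ratio of consecutive binomial probabilities, cleared of denominators.\<close>

lemma Bernstein_step:
  assumes "j < a"
  shows "Bernstein a (Suc j) p * (real (Suc j) * (1 - p)) = Bernstein a j p * ((real a - real j) * p)"
proof -
  have c: "real (Suc j) * real (a choose Suc j) = (real a - real j) * real (a choose j)"
  proof -
    have "Suc j * (a choose Suc j) = (a - j) * (a choose j)"
      by (metis binomial_absorb_comp binomial_absorption mult.commute)
    then show ?thesis using assms by (metis of_nat_diff of_nat_mult less_imp_le)
  qed
  have "Suc (a - Suc j) = a - j" using assms by simp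
  then have e: "(1 - p) ^ (a - j) = (1 - p) * (1 - p) ^ (a - Suc j)" by (metis power_Suc)
  have "Bernstein a (Suc j) p * (real (Suc j) * (1 - p))
      = (real (Suc j) * real (a choose Suc j)) * (p ^ Suc j * ((1 - p) * (1 - p) ^ (a - Suc j)))"
    by (simp add: Bernstein_def algebra_simps)
  also have "\<dots> = Bernstein a j p * ((real a - real j) * p)"
    unfolding c by (simp add: Bernstein_def e algebra_simps)
  finally show ?thesis .
qed

context
  fixes a :: nat and x L :: real
  defines "x \<equiv> sqrt (real a * p)"
  assumes L: "1 \<le> L" "6 * L \<le> x"
begin

lemma x_sq: "x\<^sup>2 = real a * p" and x_ge: "6 \<le> x" and a_pos: "0 < a"
proof -
  show "x\<^sup>2 = real a * p" by (simp add: x_def)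
  show "6 \<le> x" using L by linarith
  then show "0 < a" unfolding x_def by (cases "a = 0") auto
qed

text \<open>Up to the factor \<open>1 - p\<close>, numerator and denominator of the worst ratio of
  consecutive probabilities within distance \<open>L * x\<close> of the mean \<open>x^2\<close> are
  \<open>x^2 - L * x\<close> and \<open>x^2 + L * x + 1\<close>.\<close>

lemma ratio_arith: "(1 - 3 * L / x) * (x\<^sup>2 + L * x + 1) \<le> x\<^sup>2 - L * x"
proof -
  have x: "6 \<le> x" by (rule x_ge)
  have "(1 - 3 * L / x) * (x\<^sup>2 + L * x + 1) = x\<^sup>2 - 2 * L * x + 1 - 3 * L\<^sup>2 - 3 * L / x"
    using x by (simp add: field_simps power2_eq_square)
  moreover have "1 \<le> L * x" using L x mult_mono[of 1 L 1 x] by auto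
  moreover have "0 \<le> 3 * L / x" "0 \<le> 3 * L\<^sup>2" using L x by auto
  ultimately show ?thesis by linarith
qed

lemma ratio_bounds: "1/2 \<le> 1 - 3 * L / x" "1 - 3 * L / x \<le> 1"
  using L x_ge by (auto simp: field_simps)

lemma Bernstein_ratio_up:
  assumes "real j \<le> x\<^sup>2 + L * x"
  shows "(1 - 3 * L / x) * Bernstein a j p \<le> Bernstein a (Suc j) p"
proof -
  have Lx: "L * x \<le> x\<^sup>2 / 6" using L x_ge by (simp add: power2_eq_square)
  have "real a * p \<le> real a / 2" using mult_left_mono[OF p_half, of "real a"] by simp
  then have "real j < real a" using assms Lx x_sq a_pos by linarith
  then have ja: "j < a" by simp
  have q: "0 < real (Suc j) * (1 - p)" by (rule mult_pos_pos) auto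
  \<comment> \<open>Here \<open>p \<le> 1/2\<close> is used: it lets \<open>1 - p\<close> be
    factored out of the lower bound for \<open>(a - j) * p\<close>.\<close>
  have pL: "p * (L * x) \<le> (1 - p) * (L * x)"
    using L x_ge p_half by (intro mult_right_mono) auto
  have "real j * p \<le> (x\<^sup>2 + L * x) * p" using assms by (intro mult_right_mono) auto
  then have 1: "(x\<^sup>2 - L * x) * (1 - p) \<le> (real a - real j) * p"
    using pL x_sq by (simp add: algebra_simps)
  have "(1 - 3 * L / x) * (real (Suc j) * (1 - p)) \<le> (1 - 3 * L / x) * (x\<^sup>2 + L * x + 1) * (1 - p)"
    using assms ratio_bounds by (simp add: mult_left_mono mult_right_mono)
  also have "\<dots> \<le> (x\<^sup>2 - L * x) * (1 - p)"
    by (rule mult_right_mono[OF ratio_arith]) auto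
  also note 1
  finally have "Bernstein a j p * ((1 - 3 * L / x) * (real (Suc j) * (1 - p)))
      \<le> Bernstein a j p * ((real a - real j) * p)"
    by (rule mult_left_mono) auto
  also have "\<dots> = Bernstein a (Suc j) p * (real (Suc j) * (1 - p))"
    by (rule Bernstein_step[OF ja, symmetric])
  finally have "((1 - 3 * L / x) * Bernstein a j p) * (real (Suc j) * (1 - p))
      \<le> Bernstein a (Suc j) p * (real (Suc j) * (1 - p))"
    by (simp only: mult_ac)
  then show ?thesis using q by (rule mult_right_le_imp_le)
qed

lemma Bernstein_ratio_down:
  assumes "x\<^sup>2 - L * x \<le> real (Suc j)"
  shows "(1 - 3 * L / x) * Bernstein a (Suc j) p \<le> Bernstein a j p"
proof (cases "j < a")
  case True
  have q: "0 < (real a - real j) * p" using True p_pos by simp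
  have "p * (L * x + 1) \<le> (1 - p) * (L * x + 1)"
    using L x_ge p_half by (intro mult_right_mono) auto
  moreover have "(x\<^sup>2 - L * x) * p \<le> real (Suc j) * p" using assms by (intro mult_right_mono) auto
  ultimately have 1: "(real a - real j) * p \<le> (x\<^sup>2 + L * x + 1) * (1 - p)"
    using x_sq by (simp add: algebra_simps)
  have "(1 - 3 * L / x) * ((real a - real j) * p)
      \<le> (1 - 3 * L / x) * ((x\<^sup>2 + L * x + 1) * (1 - p))"
    using 1 ratio_bounds by (intro mult_left_mono) auto
  also have "\<dots> = (1 - 3 * L / x) * (x\<^sup>2 + L * x + 1) * (1 - p)" by simp
  also have "\<dots> \<le> (x\<^sup>2 - L * x) * (1 - p)"
    by (rule mult_right_mono[OF ratio_arith]) auto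
  also have "\<dots> \<le> real (Suc j) * (1 - p)" using assms by (intro mult_right_mono) auto
  finally have "Bernstein a (Suc j) p * ((1 - 3 * L / x) * ((real a - real j) * p))
      \<le> Bernstein a (Suc j) p * (real (Suc j) * (1 - p))"
    by (rule mult_left_mono) auto
  also have "\<dots> = Bernstein a j p * ((real a - real j) * p)"
    by (rule Bernstein_step[OF True])
  finally have "((1 - 3 * L / x) * Bernstein a (Suc j) p) * ((real a - real j) * p)
      \<le> Bernstein a j p * ((real a - real j) * p)"
    by (simp only: mult_ac)
  then show ?thesis using q by (rule mult_right_le_imp_le)
next
  case False
  then show ?thesis by (simp add: Bernstein_def binomial_eq_0)
qed

text \<open>With \<open>y = 3 * L / x \<le> 1/2\<close> one has
  \<open>1 - y \<ge> exp (- 2 * y)\<close>, and at most \<open>2 * L * x\<close> steps are taken;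
  this is the origin of \<open>12 * L^2\<close>.\<close>

lemma ratio_power_ge:
  assumes "real d \<le> 2 * L * x"
  shows "exp (- 12 * L\<^sup>2) \<le> (1 - 3 * L / x) ^ d"
proof -
  define y where "y = 3 * L / x"
  have y: "0 \<le> y" "y \<le> 1/2" using ratio_bounds L x_ge by (auto simp: y_def)
  have "- (2 * y) \<le> - y - 2 * y\<^sup>2" using y mult_left_mono[of y "1/2" y] by (simp add: power2_eq_square)
  also have "\<dots> \<le> ln (1 - y)" by (rule ln_one_minus_pos_lower_bound) (use y in auto)
  finally have "exp (- (2 * y)) \<le> 1 - y" using y by (subst (asm) ln_ge_iff) auto
  then have "exp (- (2 * y)) ^ d \<le> (1 - y) ^ d" by (intro power_mono) auto
  moreover have "exp (- 12 * L\<^sup>2) \<le> exp (- (2 * y)) ^ d"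
  proof -
    have "y * real d \<le> y * (2 * L * x)" using y assms by (intro mult_left_mono) auto
    also have "\<dots> = 6 * L\<^sup>2" using x_ge by (simp add: y_def power2_eq_square)
    finally have "- 12 * L\<^sup>2 \<le> real d * (- (2 * y))" by (simp add: algebra_simps)
    then show ?thesis by (simp flip: exp_of_nat_mult)
  qed
  ultimately show ?thesis by (simp add: y_def)
qed

text \<open>Only the upper end of the path is confined to the window, because the ratio bound for a
  step up also holds arbitrarily far below the mean.\<close>

lemma Bernstein_up:
  assumes "i \<le> j" "real j \<le> x\<^sup>2 + L * x" "real j - real i \<le> 2 * L * x"
  shows "exp (- 12 * L\<^sup>2) * Bernstein a i p \<le> Bernstein a j p"
proof -
  have "(1 - 3 * L / x) ^ (j - i) * Bernstein a i p \<le> Bernstein a j p"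
    using assms(1,2)
  proof (induction j rule: dec_induct)
    case (step m)
    have "(1 - 3 * L / x) ^ (Suc m - i) * Bernstein a i p
        = (1 - 3 * L / x) * ((1 - 3 * L / x) ^ (m - i) * Bernstein a i p)"
      using step by (simp add: Suc_diff_le)
    also have "\<dots> \<le> (1 - 3 * L / x) * Bernstein a m p"
      using step ratio_bounds by (intro mult_left_mono) auto
    also have "\<dots> \<le> Bernstein a (Suc m) p"
      using step by (intro Bernstein_ratio_up) auto
    finally show ?case .
  qed simp
  moreover have "exp (- 12 * L\<^sup>2) \<le> (1 - 3 * L / x) ^ (j - i)"
    using assms by (intro ratio_power_ge) (auto simp: of_nat_diff)
  ultimately show ?thesis
    by (meson Bernstein_p_nonneg mult_right_mono order_trans)
qed

lemma Bernstein_down: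
  assumes "j \<le> i" "x\<^sup>2 - L * x \<le> real j" "real i - real j \<le> 2 * L * x"
  shows "exp (- 12 * L\<^sup>2) * Bernstein a i p \<le> Bernstein a j p"
proof -
  have "(1 - 3 * L / x) ^ (i - j) * Bernstein a i p \<le> Bernstein a j p"
    using assms(1,2)
  proof (induction i rule: dec_induct)
    case (step m)
    have "(1 - 3 * L / x) ^ (Suc m - j) * Bernstein a (Suc m) p
        = (1 - 3 * L / x) ^ (m - j) * ((1 - 3 * L / x) * Bernstein a (Suc m) p)"
      using step by (simp add: Suc_diff_le)
    also have "\<dots> \<le> (1 - 3 * L / x) ^ (m - j) * Bernstein a m p"
      using step ratio_bounds by (intro mult_left_mono Bernstein_ratio_down) auto
    also have "\<dots> \<le> Bernstein a j p"
      using step by auto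
    finally show ?case .
  qed simp
  moreover have "exp (- 12 * L\<^sup>2) \<le> (1 - 3 * L / x) ^ (i - j)"
    using assms by (intro ratio_power_ge) (auto simp: of_nat_diff)
  ultimately show ?thesis
    by (meson Bernstein_p_nonneg mult_right_mono order_trans)
qed

end

text \<open>A value at \<open>i\<close> forces values at least \<open>exp (- 12)\<close> times as
  large at about \<open>x\<close> further points, taken upwards if \<open>i\<close> is at most the
  mean and downwards otherwise. All of them sum to at most 1. The window is \<open>L = 1\<close>;
  for \<open>x < 6\<close> the claim is weaker than the trivial bound 1.\<close>

lemma Bernstein_le:
  assumes "0 < a"
  shows "Bernstein a i p \<le> exp 12 / sqrt (real a * p)"
proof -
  define x where "x = sqrt (real a * p)"
  have x0: "0 < x" using assms p_pos by (simp add: x_def)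
  have e12: "6 \<le> exp (12::real)" using exp_ge_add_one_self[of "12::real"] by linarith
  have B1: "Bernstein a i p \<le> 1" using sum_Bernstein_le_1[of "{i}" a] by simp
  show ?thesis
  proof (cases "x < 6")
    case True
    then have "Bernstein a i p * x \<le> 1 * exp 12" using B1 e12 x0 by (intro mult_mono) auto
    then show ?thesis unfolding x_def[symmetric] using x0 by (simp add: pos_le_divide_eq)
  next
    case False
    then have L: "1 \<le> (1::real)" "6 * 1 \<le> x" by auto
    define J where "J = (if real i \<le> x\<^sup>2 then {i..i + nat \<lfloor>x\<rfloor>} else {i - nat \<lfloor>x\<rfloor>..i})"
    have fl: "real (nat \<lfloor>x\<rfloor>) \<le> x" "x \<le> real (nat \<lfloor>x\<rfloor>) + 1" using x0 by linarith+
    have "nat \<lfloor>x\<rfloor> \<le> i" if "\<not> real i \<le> x\<^sup>2"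
    proof -
      have "x * 1 \<le> x * x" using False by (intro mult_left_mono) auto
      then have "x \<le> real i" using that by (simp add: power2_eq_square)
      then show ?thesis by linarith
    qed
    then have "card J = Suc (nat \<lfloor>x\<rfloor>)" by (auto simp: J_def)
    then have cardJ: "x \<le> real (card J)" using fl(2) by (simp only: of_nat_Suc)
    have "exp (- 12) * Bernstein a i p \<le> Bernstein a j p" if "j \<in> J" for j
    proof (cases "real i \<le> x\<^sup>2")
      case True
      then have j: "i \<le> j" "j \<le> i + nat \<lfloor>x\<rfloor>" using that by (auto simp: J_def)
      then have "real j \<le> real i + x" using fl by linarith
      then show ?thesis
        using Bernstein_up[OF L(1), of a i j] L j True x0 by (simp add: x_def)
    next
      case False
      then have j: "j \<le> i" "i - nat \<lfloor>x\<rfloor> \<le> j" using that by (auto simp: J_def)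
      then have "real i \<le> real j + x" using fl by linarith
      then show ?thesis
        using Bernstein_down[OF L(1), of a j i] L j False x0 by (simp add: x_def)
    qed
    then have "(\<Sum>j\<in>J. exp (- 12) * Bernstein a i p) \<le> (\<Sum>j\<in>J. Bernstein a j p)"
      by (intro sum_mono) auto
    also have "\<dots> \<le> 1" by (rule sum_Bernstein_le_1) (auto simp: J_def)
    finally have "real (card J) * (exp (- 12) * Bernstein a i p) \<le> 1" by simp
    moreover have "x * (exp (- 12) * Bernstein a i p) \<le> real (card J) * (exp (- 12) * Bernstein a i p)"
      using cardJ by (intro mult_right_mono) auto
    ultimately have "x * (exp (- 12) * Bernstein a i p) \<le> 1" by linarith
    then have "x * Bernstein a i p \<le> exp 12" by (simp add: exp_minus field_simps)
    then show ?thesis unfolding x_def[symmetric] using x0 by (simp add: pos_le_divide_eq mult.commute)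
  qed
qed

lemma Bernstein_variance: "(\<Sum>k\<le>a. (real k - real a * p)\<^sup>2 * Bernstein a k p) \<le> real a * p"
proof -
  have "(\<Sum>k\<le>a. (real k - real a * p)\<^sup>2 * Bernstein a k p)
      = (\<Sum>k\<le>a. real k * (real k - 1) * Bernstein a k p) + (1 - 2 * (real a * p)) * (\<Sum>k\<le>a. real k * Bernstein a k p)
        + (real a * p)\<^sup>2 * (\<Sum>k\<le>a. Bernstein a k p)"
    unfolding sum_distrib_left sum.distrib[symmetric]
    by (rule sum.cong) (auto simp: power2_eq_square algebra_simps)
  also have "\<dots> = real a * p - real a * p\<^sup>2"
    unfolding sum_kk_Bernstein sum_k_Bernstein sum_Bernstein by (simp add: power2_eq_square algebra_simps)
  finally show ?thesis by simp
qed

text \<open>By Chebyshev's inequality mass at least 3/4 lies within \<open>2 * x\<close> of the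
  mean. At most \<open>5 * x\<close> integers lie there, so some \<open>k\<close> has probability at
  least \<open>1 / (8 * x)\<close>, and a path from \<open>k\<close> to \<open>j\<close> inside the
  window loses only the exponential factor.\<close>

lemma Bernstein_ge:
  assumes L: "2 \<le> L" "6 * L \<le> sqrt (real a * p)"
    and j: "\<bar>real j - real a * p\<bar> \<le> L * sqrt (real a * p)"
  shows "exp (- 12 * L\<^sup>2) / (8 * sqrt (real a * p)) \<le> Bernstein a j p"
proof -
  define x where "x = sqrt (real a * p)"
  have x: "12 \<le> x" and x2: "x\<^sup>2 = real a * p" using L p_pos by (auto simp: x_def)
  define W where "W = {k. k \<le> a \<and> \<bar>real k - x\<^sup>2\<bar> \<le> 2 * x}"
  have finW: "finite W" by (simp add: W_def)
  have "4 * x\<^sup>2 * (\<Sum>k\<in>{..a} - W. Bernstein a k p) \<le> (\<Sum>k\<in>{..a} - W. (real k - real a * p)\<^sup>2 * Bernstein a k p)"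
    unfolding sum_distrib_left
  proof (intro sum_mono mult_right_mono)
    fix k assume "k \<in> {..a} - W"
    then have "2 * x \<le> \<bar>real k - x\<^sup>2\<bar>" by (auto simp: W_def)
    then have "(2 * x)\<^sup>2 \<le> \<bar>real k - x\<^sup>2\<bar>\<^sup>2" using x by (intro power_mono) auto
    then show "4 * x\<^sup>2 \<le> (real k - real a * p)\<^sup>2" by (simp add: x2[symmetric] power_mult_distrib)
  qed simp
  also have "\<dots> \<le> (\<Sum>k\<le>a. (real k - real a * p)\<^sup>2 * Bernstein a k p)"
    by (intro sum_mono2) auto
  also have "\<dots> \<le> x\<^sup>2" using Bernstein_variance x2 by simp
  finally have "(\<Sum>k\<in>{..a} - W. Bernstein a k p) \<le> 1/4" using x by simp
  moreover have "(\<Sum>k\<in>{..a} - W. Bernstein a k p) + (\<Sum>k\<in>W. Bernstein a k p) = 1"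
    by (subst sum.subset_diff[of W "{..a}", symmetric]) (auto simp: W_def sum_Bernstein)
  ultimately have mass: "3/4 \<le> (\<Sum>k\<in>W. Bernstein a k p)" by linarith
  have "W \<subseteq> {nat \<lceil>x\<^sup>2 - 2 * x\<rceil>..nat \<lfloor>x\<^sup>2 + 2 * x\<rfloor>}"
    by (auto simp: W_def) linarith+
  then have "real (card W) \<le> real (card {nat \<lceil>x\<^sup>2 - 2 * x\<rceil>..nat \<lfloor>x\<^sup>2 + 2 * x\<rfloor>})"
    by (simp add: card_mono del: card_atLeastAtMost)
  also have "\<dots> \<le> max 0 (x\<^sup>2 + 2 * x - (x\<^sup>2 - 2 * x) + 1)"
    by (rule card_nat_interval_le) (use x in auto)
  finally have cardW: "real (card W) \<le> 5 * x" using x by auto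
  have "\<exists>k\<in>W. 1 / (8 * x) \<le> Bernstein a k p"
  proof (rule ccontr)
    assume "\<not> ?thesis"
    then have "(\<Sum>k\<in>W. Bernstein a k p) \<le> (\<Sum>k\<in>W. 1 / (8 * x))"
      by (intro sum_mono) force
    also have "\<dots> = real (card W) / (8 * x)" by simp
    also have "\<dots> \<le> 5 * x / (8 * x)" using cardW x by (intro divide_right_mono) auto
    also have "\<dots> < 3/4" using x by simp
    finally show False using mass by simp
  qed
  then obtain k where k: "k \<in> W" "1 / (8 * x) \<le> Bernstein a k p" by blast
  have kx: "\<bar>real k - x\<^sup>2\<bar> \<le> L * x"
  proof -
    have "2 * x \<le> L * x" using L x by (intro mult_right_mono) auto
    then show ?thesis using k unfolding W_def by auto
  qed
  have jx: "\<bar>real j - x\<^sup>2\<bar> \<le> L * x" using j x2 by (simp add: x_def)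
  have L1: "1 \<le> L" "6 * L \<le> sqrt (real a * p)" using L by auto
  have "exp (- 12 * L\<^sup>2) * Bernstein a k p \<le> Bernstein a j p"
  proof (cases "k \<le> j")
    case True
    show ?thesis
      by (rule Bernstein_up[OF L1 True]) (use kx jx in \<open>auto simp flip: x_def\<close>)
  next
    case False
    then have "j \<le> k" by simp
    then show ?thesis
      by (rule Bernstein_down[OF L1]) (use kx jx in \<open>auto simp flip: x_def\<close>)
  qed
  moreover have "exp (- 12 * L\<^sup>2) * (1 / (8 * x)) \<le> exp (- 12 * L\<^sup>2) * Bernstein a k p"
    using k by (intro mult_left_mono) auto
  ultimately show ?thesis by (simp add: x_def)
qed

section \<open>Local bounds for the difference of two binomial variables\<close>

lemma PT_le_left:
  assumes "0 < a"
  shows "PT a b k \<le> exp 12 / sqrt (real a * p)"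
proof -
  define M where "M = exp 12 / sqrt (real a * p)"
  have "PT a b k \<le> (\<Sum>j\<le>b. Bernstein b j p * M)"
    unfolding PT_eq_sum
  proof (intro sum_mono mult_left_mono)
    fix j
    have "(\<Sum>i\<le>a. Bernstein a i p * of_bool (int i - int j = k))
        = (\<Sum>i\<le>a. if i = nat (k + int j) then (if 0 \<le> k + int j then Bernstein a i p else 0) else 0)"
      by (rule sum.cong) auto
    also have "\<dots> \<le> M"
      using Bernstein_le[OF assms] p_pos by (auto simp: M_def)
    finally show "(\<Sum>i\<le>a. Bernstein a i p * of_bool (int i - int j = k)) \<le> M" .
  qed simp
  also have "\<dots> = M" by (simp add: sum_distrib_right[symmetric] sum_Bernstein)
  finally show ?thesis by (simp add: M_def)
qed

lemma PT_le_right: "0 < b \<Longrightarrow> PT a b k \<le> exp 12 / sqrt (real b * p)"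
  using PT_le_left[of b a "- k"] by (simp add: PT_commute[of a b])

lemma PT_le:
  assumes "0 < N" "N \<le> 2 * real a \<or> N \<le> 2 * real b"
  shows "PT a b k \<le> 2 * exp 12 / sqrt (N * p)"
proof -
  have *: "exp 12 / sqrt (real c * p) \<le> 2 * exp 12 / sqrt (N * p)" if "N \<le> 2 * real c" for c
  proof -
    have "N * p \<le> 4 * (real c * p)" using that assms mult_right_mono[of N "4 * real c" p] by simp
    then have "sqrt (N * p) \<le> 2 * sqrt (real c * p)"
      by (metis real_sqrt_four real_sqrt_le_iff real_sqrt_mult)
    moreover have "0 < sqrt (N * p)" using assms p_pos by simp
    moreover have "0 < sqrt (real c * p)" using calculation by linarith
    moreover have "exp 12 * sqrt (N * p) \<le> exp 12 * (2 * sqrt (real c * p))"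
      using calculation(1) by (intro mult_left_mono) auto
    ultimately show ?thesis by (simp only: frac_le_eq divide_le_eq pos_le_divide_eq) (simp add: field_simps)
  qed
  from assms(2) show ?thesis
  proof
    assume a: "N \<le> 2 * real a"
    then have "0 < a" using assms by simp
    then show ?thesis using * [OF a] PT_le_left[of a b k] by linarith
  next
    assume b: "N \<le> 2 * real b"
    then have "0 < b" using assms by simp
    then show ?thesis using * [OF b] PT_le_right[of b a k] by linarith
  qed
qed

text \<open>The sum over the second variable is restricted to values \<open>j\<close> within one
  \<open>sqrt (b * p)\<close> of its mean; there both \<open>j\<close> and \<open>k + j\<close> are
  typical values of their binomial variables.\<close>

lemma PT_ge:
  fixes N L :: real
  assumes ab: "N / 4 \<le> real a" "real a \<le> N" "N / 4 \<le> real b" "real b \<le> N"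
    and L: "1 \<le> L" "12 * (4 * L + 2) \<le> sqrt (N * p)"
    and d: "\<bar>real a - real b\<bar> * p \<le> L * sqrt (N * p)" "\<bar>real_of_int k\<bar> \<le> L * sqrt (N * p)"
  shows "exp (- 24 * (4 * L + 2)\<^sup>2) / (128 * sqrt (N * p)) \<le> PT a b k"
proof -
  define y where "y = sqrt (N * p)"
  \<comment> \<open>Deviations up to \<open>(2 * L + 1) * y\<close> occur: \<open>L * y\<close> from
    \<open>k\<close>, \<open>L * y\<close> from the unequal means, and \<open>y\<close> from
    \<open>j\<close>. As \<open>sqrt (c * p)\<close> may be as small as \<open>y / 2\<close>, the
    window in these units is twice as wide.\<close>
  define M where "M = 4 * L + 2"
  define t where "t = exp (- 12 * M\<^sup>2) / (8 * y)"
  have M6: "6 \<le> M" using L by (simp add: M_def)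
  have y72: "72 \<le> y" using L M6 by (simp add: y_def M_def)
  have sq: "y / 2 \<le> sqrt (real c * p)" "sqrt (real c * p) \<le> y" if "N / 4 \<le> real c" "real c \<le> N" for c
  proof -
    have "N * p \<le> 4 * (real c * p)" using that mult_right_mono[of N "4 * real c" p] by simp
    then have "sqrt (N * p) \<le> 2 * sqrt (real c * p)"
      by (metis real_sqrt_four real_sqrt_le_iff real_sqrt_mult)
    then show "y / 2 \<le> sqrt (real c * p)" by (simp add: y_def)
    show "sqrt (real c * p) \<le> y"
      using that mult_right_mono[of "real c" N p] by (simp add: y_def)
  qed
  note sa = sq[OF ab(1,2)] and sb = sq[OF ab(3,4)]
  have low: "t \<le> Bernstein c i p"
    if c: "N / 4 \<le> real c" "real c \<le> N" and i: "\<bar>real i - real c * p\<bar> \<le> (2 * L + 1) * y" for c i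
  proof -
    note sc = sq[OF c]
    have "(2 * L + 1) * y \<le> M * sqrt (real c * p)"
      using sc(1) L mult_left_mono[of y "2 * sqrt (real c * p)" "2 * L + 1"] by (simp add: M_def algebra_simps)
    then have "exp (- 12 * M\<^sup>2) / (8 * sqrt (real c * p)) \<le> Bernstein c i p"
      using M6 i sc L by (intro Bernstein_ge) (auto simp: M_def y_def[symmetric])
    moreover have "t \<le> exp (- 12 * M\<^sup>2) / (8 * sqrt (real c * p))"
    proof -
      have "0 < sqrt (real c * p)" using sc y72 by linarith
      then show ?thesis
        unfolding t_def using sc y72 by (intro divide_left_mono mult_pos_pos) auto
    qed
    ultimately show ?thesis by linarith
  qed
  have t0: "0 \<le> t" using y72 by (simp add: t_def)
  define u where "u = real b * p - sqrt (real b * p)"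
  define v where "v = real b * p + sqrt (real b * p)"
  define J where "J = {nat \<lceil>u\<rceil>..nat \<lfloor>v\<rfloor>}"
  have "sqrt (real b * p) * 1 \<le> sqrt (real b * p) * sqrt (real b * p)"
  proof (rule mult_left_mono)
    show "1 \<le> sqrt (real b * p)" using sb y72 by linarith
  qed simp
  then have u0: "0 \<le> u" unfolding u_def by simp
  have v0: "0 \<le> v" unfolding v_def by simp
  have "v - u - 1 \<le> real (card J)" unfolding J_def by (rule card_nat_interval_ge[OF u0])
  moreover have "v - u - 1 \<ge> y / 2" using sb y72 unfolding u_def v_def by linarith
  ultimately have cardJ: "y / 2 \<le> real (card J)" by linarith
  have Jin: "\<bar>real j - real b * p\<bar> \<le> sqrt (real b * p)" if "j \<in> J" for j
  proof -
    have "u \<le> real j" "real j \<le> v" using that u0 v0 unfolding J_def by (auto simp: nat_le_iff le_nat_iff) linarith+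
    then show ?thesis unfolding u_def v_def by linarith
  qed
  have each: "t * t \<le> Bernstein b j p * (\<Sum>i\<le>a. Bernstein a i p * of_bool (int i - int j = k)) \<and> j \<le> b"
    if j: "j \<in> J" for j
  proof -
    have ge_t: "t \<le> Bernstein b j p"
    proof (rule low[OF ab(3,4)])
      have "1 * y \<le> (2 * L + 1) * y" using L y72 by (intro mult_right_mono) auto
      then show "\<bar>real j - real b * p\<bar> \<le> (2 * L + 1) * y" using Jin[OF j] sb by linarith
    qed
    have tpos: "0 < t" using y72 by (simp add: t_def)
    have jb: "j \<le> b"
    proof (rule ccontr)
      assume "\<not> j \<le> b"
      then have "Bernstein b j p = 0" by (simp add: Bernstein_def binomial_eq_0)
      then show False using ge_t tpos by simp
    qed
    define i where "i = nat (k + int j)"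
    have apd: "\<bar>real a * p - real b * p\<bar> \<le> L * y"
      using d(1) p_pos by (simp add: y_def abs_mult left_diff_distrib[symmetric])
    have dev: "\<bar>real_of_int (k + int j) - real a * p\<bar> \<le> (2 * L + 1) * y"
    proof -
      have "real_of_int (k + int j) = real_of_int k + real j" by simp
      moreover have "(2 * L + 1) * y = L * y + L * y + y" by (simp add: algebra_simps)
      moreover have "\<bar>real_of_int k\<bar> \<le> L * y" using d(2) by (simp add: y_def)
      ultimately show ?thesis using Jin[OF j] sb apd by linarith
    qed
    have "(2 * L + 1) * y \<le> real a * p"
    proof -
      have "(4 * L + 2) * sqrt (real a * p) \<le> sqrt (real a * p) * sqrt (real a * p)"
        using L sa y72 by (intro mult_right_mono) (auto simp: y_def)
      moreover have "(2 * L + 1) * y \<le> (4 * L + 2) * sqrt (real a * p)"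
        using sa L mult_left_mono[of y "2 * sqrt (real a * p)" "2 * L + 1"] by (simp add: algebra_simps)
      ultimately show ?thesis by simp
    qed
    then have "0 \<le> real_of_int (k + int j)" using dev by linarith
    then have kj: "0 \<le> k + int j" by linarith
    then have ri: "real i = real_of_int (k + int j)" unfolding i_def by simp
    have ti: "t \<le> Bernstein a i p" by (rule low[OF ab(1,2)]) (use dev ri in simp)
    have ia: "i \<le> a"
    proof (rule ccontr)
      assume "\<not> i \<le> a"
      then have "Bernstein a i p = 0" by (simp add: Bernstein_def binomial_eq_0)
      then show False using ti tpos by simp
    qed
    have "Bernstein a i p * of_bool (int i - int j = k) \<le> (\<Sum>i\<le>a. Bernstein a i p * of_bool (int i - int j = k))"
      by (rule member_le_sum) (use ia in auto)
    moreover have "int i - int j = k" using kj unfolding i_def by simp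
    ultimately have "t \<le> (\<Sum>i\<le>a. Bernstein a i p * of_bool (int i - int j = k))" using ti by simp
    then show ?thesis using ge_t jb t0 by (auto intro!: mult_mono)
  qed
  have "y / 2 * (t * t) \<le> real (card J) * (t * t)"
    by (rule mult_right_mono[OF cardJ]) (rule mult_nonneg_nonneg[OF t0 t0])
  also have "\<dots> = (\<Sum>j\<in>J. t * t)"
    by (rule sum_constant[symmetric])
  also have "\<dots> \<le> (\<Sum>j\<in>J. Bernstein b j p * (\<Sum>i\<le>a. Bernstein a i p * of_bool (int i - int j = k)))"
    by (rule sum_mono) (use each in blast)
  also have "\<dots> \<le> PT a b k"
    unfolding PT_eq_sum using each by (intro sum_mono2) (auto intro!: mult_nonneg_nonneg sum_nonneg)
  finally have "y / 2 * (t * t) \<le> PT a b k" .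
  \<comment> \<open>The constant in \<open>gam\<close>: at least \<open>y / 2\<close> values of
    \<open>j\<close>, each contributing the square of \<open>t\<close>.\<close>
  moreover have "y / 2 * (t * t) = exp (- 24 * M\<^sup>2) / (128 * y)"
  proof -
    have *: "y / 2 * (E / (8 * y) * (E / (8 * y))) = E * E / (128 * y)" for E
      using y72 by (simp add: field_simps)
    have "- 24 * M\<^sup>2 = - 12 * M\<^sup>2 + - 12 * M\<^sup>2" by simp
    then have "exp (- 24 * M\<^sup>2) = exp (- 12 * M\<^sup>2) * exp (- 12 * M\<^sup>2)" by (simp only: exp_add)
    then show ?thesis unfolding t_def * by (simp only:)
  qed
  ultimately show ?thesis unfolding y_def M_def by (simp only:)
qed

text \<open>One of \<open>a\<close> and \<open>b\<close> is at least \<open>n / 4\<close>, and one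
  concentrated summand is enough to spread out the difference.\<close>

lemma PT_le_sum:
  fixes n :: real
  assumes "0 < n" "n \<le> 2 * (real a + real b)"
  shows "PT a b k \<le> 4 * exp 12 / sqrt (n * p)"
proof -
  have "PT a b k \<le> 2 * exp 12 / sqrt (n / 2 * p)"
    by (rule PT_le) (use assms in auto)
  also have "\<dots> \<le> 4 * exp 12 / sqrt (n * p)"
  proof -
    have "n * p \<le> 4 * (n / 2 * p)" using assms p_pos by simp
    then have "sqrt (n * p) \<le> 2 * sqrt (n / 2 * p)"
      by (metis real_sqrt_four real_sqrt_le_iff real_sqrt_mult)
    then have "2 * exp 12 * sqrt (n * p) \<le> 2 * exp 12 * (2 * sqrt (n / 2 * p))"
      by (intro mult_left_mono) auto
    then have "2 * exp 12 * sqrt (n * p) \<le> 4 * exp 12 * sqrt (n / 2 * p)" by simp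
    moreover have "0 < sqrt (n * p)" "0 < sqrt (n / 2 * p)" using assms p_pos by auto
    ultimately show ?thesis by (simp only: frac_le_eq divide_le_eq pos_le_divide_eq) (simp add: field_simps)
  qed
  finally show ?thesis .
qed

section \<open>The chance of a strict majority as a function of the first-day count\<close>

text \<open>The probability that a vertex adjacent to each of \<open>N\<close> vertices with probability \<open>p\<close>,
  of which \<open>a\<close> have opinion \<open>+1\<close>, sees a strict majority of \<open>+1\<close>.\<close>

definition F :: "nat \<Rightarrow> nat \<Rightarrow> real" where
  "F N a = GT a (N - a) 1"

lemma F_bounds [simp]: "0 \<le> F N a" "F N a \<le> 1"
  by (simp_all add: F_def)

text \<open>Turning one \<open>-1\<close> into \<open>+1\<close> adds a positive trial and removes a
  negative one; each change contributes one point probability of the configuration without that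
  vertex.\<close>

lemma F_Suc:
  assumes "a < N"
  shows "F N (Suc a) = F N a + p * (PT a (N - Suc a) 0 + PT a (N - Suc a) 1)"
proof -
  have "N - a = Suc (N - Suc a)" using assms by simp
  then have "F N a = GT a (N - Suc a) 1 - p * PT a (N - Suc a) 1"
    unfolding F_def by (simp only: GT_Suc2)
  then show ?thesis by (simp add: F_def GT_Suc1 algebra_simps)
qed

lemma F_mono:
  assumes "a \<le> b" "b \<le> N"
  shows "F N a \<le> F N b"
  using assms
proof (induction b rule: dec_induct)
  case (step m)
  have "0 \<le> p * (PT m (N - Suc m) 0 + PT m (N - Suc m) 1)"
    by (intro mult_nonneg_nonneg add_nonneg_nonneg) auto
  moreover have "F N (Suc m) = F N m + p * (PT m (N - Suc m) 0 + PT m (N - Suc m) 1)"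
    using step by (intro F_Suc) auto
  ultimately show ?case using step by linarith
qed simp

definition lip :: "nat \<Rightarrow> real" where
  "lip N = 8 * exp 12 * p / sqrt (real N * p)"

lemma lip_nonneg [simp]: "0 \<le> lip N"
  by (simp add: lip_def)

lemma F_upper:
  assumes "a \<le> b" "b \<le> N" "2 \<le> N"
  shows "F N b \<le> F N a + lip N * (real b - real a)"
  using assms(1,2)
proof (induction b rule: dec_induct)
  case (step m)
  have "PT m (N - Suc m) k \<le> 4 * exp 12 / sqrt (real N * p)" for k
    by (rule PT_le_sum) (use step assms in auto)
  from this[of 0] this[of 1]
  have "p * (PT m (N - Suc m) 0 + PT m (N - Suc m) 1) \<le> p * (2 * (4 * exp 12 / sqrt (real N * p)))"
    by (intro mult_left_mono) auto
  also have "\<dots> = lip N" by (simp add: lip_def)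
  finally show ?case using step F_Suc[of m N] by (simp add: algebra_simps)
qed simp

lemma F_Lipschitz:
  assumes "a \<le> N" "b \<le> N" "2 \<le> N"
  shows "\<bar>F N a - F N b\<bar> \<le> lip N * \<bar>real a - real b\<bar>"
proof (cases "a \<le> b")
  case True
  then show ?thesis using F_upper[of a b N] F_mono[of a b N] assms by (simp add: abs_if algebra_simps)
next
  case False
  then show ?thesis using F_upper[of b a N] F_mono[of b a N] assms by (simp add: abs_if algebra_simps)
qed

text \<open>Exchanging the opinions swaps the two strict majorities; only the probability of a tie
  is missing.\<close>

lemma F_reflect:
  assumes "a \<le> N" "0 < N"
  shows "1 - 4 * exp 12 / sqrt (real N * p) \<le> F N a + F N (N - a)"
proof -
  have "GT a (N - a) 1 + PT a (N - a) 0 + GT (N - a) a 1 = 1"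
    using GT_reflect[of a "N - a" 0] GT_Suc_arg[of a "N - a" 0] by simp
  moreover have "PT a (N - a) 0 \<le> 4 * exp 12 / sqrt (real N * p)"
    by (rule PT_le_sum) (use assms in auto)
  ultimately show ?thesis using assms by (simp add: F_def)
qed

lemma PT_ge_balanced:
  fixes N L :: real
  assumes L: "1 \<le> L" "12 * (4 * L + 2) \<le> sqrt (N * p)"
    and ab: "3 * N \<le> 4 * (real a + real b)" "real a + real b \<le> N + 2"
    and d: "\<bar>real a - real b\<bar> * p \<le> L * sqrt (N * p)" "\<bar>real_of_int k\<bar> \<le> L * sqrt (N * p)"
  shows "gam L / sqrt (N * p) \<le> PT a b k"
proof -
  define X where "X = sqrt (N * p)"
  have X: "72 \<le> X" "12 * (4 * L + 2) \<le> X" using L unfolding X_def by auto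
  have Np0: "0 < N * p"
  proof (rule ccontr)
    assume "\<not> 0 < N * p"
    then have "X \<le> 0" unfolding X_def by simp
    then show False using X by simp
  qed
  then have Np: "N * p = X\<^sup>2" "0 < N * p" by (auto simp: X_def)
  have N0: "0 < N" using Np0 p_pos by (rule zero_less_mult_pos2)
  have X2: "X\<^sup>2 \<le> N / 2" using mult_left_mono[OF p_half, of N] N0 Np by simp
  have "72 * 72 \<le> X * X" using X by (intro mult_mono) auto
  then have N1: "10368 \<le> N" using X2 by (simp add: power2_eq_square)
  have "\<bar>real a - real b\<bar> * p * (48 * X) \<le> L * X * (48 * X)"
    using d X unfolding X_def[symmetric] by (intro mult_right_mono) auto
  also have "\<dots> = (48 * L) * X\<^sup>2" by (simp add: power2_eq_square)
  also have "\<dots> \<le> X * X\<^sup>2" using X by (intro mult_right_mono) auto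
  also have "\<dots> = N * p * X" using Np by (simp add: mult.commute)
  finally have "(\<bar>real a - real b\<bar> * 48) * (p * X) \<le> N * (p * X)" by (simp add: mult_ac)
  then have ab48: "\<bar>real a - real b\<bar> * 48 \<le> N"
    using p_pos X by (simp add: mult_le_cancel_right_pos)
  have "exp (- 24 * (4 * L + 2)\<^sup>2) / (128 * sqrt (N * p)) \<le> PT a b k"
  proof (rule PT_ge)
    show "N / 4 \<le> real a" "real a \<le> N" "N / 4 \<le> real b" "real b \<le> N"
      using nearly_equal_bounds[OF ab48 ab N1] by auto
  qed (use L d in auto)
  then show ?thesis by (simp add: gam_def)
qed

text \<open>The window for \<open>a\<close> is \<open>L - 1\<close> instead of \<open>L\<close>,
  since the increment of \<open>F\<close> concerns \<open>N - 1\<close> vertices and the balance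
  moves by one.\<close>

lemma F_slope:
  assumes L: "1 \<le> L" "12 * (4 * L + 2) \<le> sqrt (real N * p)"
    and a: "a < N" "\<bar>2 * real a - real N\<bar> * p \<le> (L - 1) * sqrt (real N * p)"
  shows "F N a + 2 * p * gam L / sqrt (real N * p) \<le> F N (Suc a)"
proof -
  have X: "72 \<le> sqrt (real N * p)" using L by simp
  have "\<bar>real a - real (N - Suc a)\<bar> * p \<le> (\<bar>2 * real a - real N\<bar> + 1) * p"
    using a by (intro mult_right_mono) auto
  also have "\<dots> \<le> (L - 1) * sqrt (real N * p) + sqrt (real N * p)"
    using a X p_half by (simp add: algebra_simps)
  finally have d: "\<bar>real a - real (N - Suc a)\<bar> * p \<le> L * sqrt (real N * p)" by (simp add: algebra_simps)
  have "1 * 1 \<le> L * sqrt (real N * p)"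
  proof (rule mult_mono)
    show "1 \<le> sqrt (real N * p)" using X by linarith
  qed (use L in auto)
  moreover have "4 \<le> N"
  proof (rule ccontr)
    assume "\<not> 4 \<le> N"
    then have "real N * p \<le> 4 * 1" using p_half by (intro mult_mono) auto
    then have "sqrt (real N * p) \<le> sqrt 4" by (intro real_sqrt_le_mono) simp
    then show False using X by simp
  qed
  ultimately have "gam L / sqrt (real N * p) \<le> PT a (N - Suc a) k" if "k = 0 \<or> k = 1" for k
    using that a d by (intro PT_ge_balanced[OF L]) auto
  from this[of 0] this[of 1]
  have "p * (2 * (gam L / sqrt (real N * p))) \<le> p * (PT a (N - Suc a) 0 + PT a (N - Suc a) 1)"
    by (intro mult_left_mono) auto
  moreover have "p * (2 * (gam L / sqrt (real N * p))) = 2 * p * gam L / sqrt (real N * p)" by simp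
  ultimately show ?thesis using F_Suc[OF a(1)] by linarith
qed

lemma F_slope_interval:
  assumes L: "1 \<le> L" "12 * (4 * L + 2) \<le> sqrt (real N * p)"
    and ab: "a \<le> b" "b \<le> N"
    and w: "\<bar>2 * real a - real N\<bar> * p \<le> (L - 1) * sqrt (real N * p)"
           "\<bar>2 * real b - real N\<bar> * p \<le> (L - 1) * sqrt (real N * p)"
  shows "F N a + 2 * p * gam L / sqrt (real N * p) * (real b - real a) \<le> F N b"
proof -
  have "F N a + 2 * p * gam L / sqrt (real N * p) * (real c - real a) \<le> F N c" if "a \<le> c" "c \<le> b" for c
    using that
  proof (induction c rule: dec_induct)
    case (step m)
    have "\<bar>2 * real m - real N\<bar> \<le> max \<bar>2 * real a - real N\<bar> \<bar>2 * real b - real N\<bar>"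
      using step by auto
    then have "\<bar>2 * real m - real N\<bar> * p \<le> max \<bar>2 * real a - real N\<bar> \<bar>2 * real b - real N\<bar> * p"
      by (rule mult_right_mono) auto
    also have "\<dots> \<le> (L - 1) * sqrt (real N * p)"
      using w by (auto simp: max_def)
    finally have "F N m + 2 * p * gam L / sqrt (real N * p) \<le> F N (Suc m)"
      using step ab by (intro F_slope[OF L]) auto
    then show ?case using step by (simp add: algebra_simps add_divide_distrib diff_divide_distrib)
  qed simp
  then show ?thesis using ab by blast
qed

text \<open>The cancellation: reflect \<open>b1\<close> to \<open>N - b1\<close>, where
  \<open>F\<close> is about \<open>1 - F N b1\<close>, and climb from there to \<open>b2\<close>.
  The distance is \<open>b1 + b2 - N \<ge> g\<close>, so only the sum of the two counts matters,
  however far each lies from \<open>N / 2\<close> within the window.\<close>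

lemma F_sum_ge:
  assumes L: "1 \<le> L" "12 * (4 * L + 2) \<le> sqrt (real N * p)"
    and b: "b1 \<le> N" "b2 \<le> N" "0 \<le> g" "real N + g \<le> real b1 + real b2"
    and w: "\<bar>2 * real b1 - real N\<bar> * p \<le> (L - 1) * sqrt (real N * p)"
           "\<bar>2 * real b2 - real N\<bar> * p \<le> (L - 1) * sqrt (real N * p)"
  shows "1 - 4 * exp 12 / sqrt (real N * p) + 2 * p * gam L / sqrt (real N * p) * g \<le> F N b1 + F N b2"
proof -
  have X: "72 \<le> sqrt (real N * p)" using L by simp
  then have N: "0 < N" by (cases "N = 0") auto
  have "N \<le> b1 + b2" using b by linarith
  then have "F N (N - b1) + 2 * p * gam L / sqrt (real N * p) * (real b2 - real (N - b1)) \<le> F N b2"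
  proof (intro F_slope_interval[OF L])
    have "2 * real (N - b1) - real N = - (2 * real b1 - real N)" using b by (simp add: of_nat_diff)
    then show "\<bar>2 * real (N - b1) - real N\<bar> * p \<le> (L - 1) * sqrt (real N * p)"
      using w(1) by (simp only: abs_minus_cancel)
  qed (use b w in auto)
  moreover have "2 * p * gam L / sqrt (real N * p) * g
      \<le> 2 * p * gam L / sqrt (real N * p) * (real b2 - real (N - b1))"
    using b by (intro mult_left_mono) (auto simp: of_nat_diff intro!: divide_nonneg_nonneg mult_nonneg_nonneg less_imp_le[OF gam_pos])
  ultimately show ?thesis using F_reflect[OF b(1) N] by linarith
qed

text \<open>By symmetry the tails at 0 and 1 add up to 1, and thresholds from -1 to 2 are at most
  two point probabilities away from the middle.\<close>

lemma GT_centre: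
  assumes "0 < n" "n \<le> 4 * real Q" "j \<in> {-1..2}"
  shows "\<bar>GT Q Q j - 1/2\<bar> \<le> 8 * exp 12 / sqrt (n * p)"
proof -
  define \<kappa> where "\<kappa> = 4 * exp 12 / sqrt (n * p)"
  have \<kappa>: "PT Q Q k \<le> \<kappa>" for k
    unfolding \<kappa>_def by (rule PT_le_sum) (use assms in auto)
  have "GT Q Q (-1) = GT Q Q 0 + PT Q Q (-1)" "GT Q Q 0 = GT Q Q 1 + PT Q Q 0" "GT Q Q 1 = GT Q Q 2 + PT Q Q 1"
    using GT_Suc_arg[of Q Q "-1"] GT_Suc_arg[of Q Q 0] GT_Suc_arg[of Q Q 1] by simp_all
  moreover have "GT Q Q 0 + GT Q Q 1 = 1" using GT_reflect[of Q Q 0] by simp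
  moreover have "j = -1 \<or> j = 0 \<or> j = 1 \<or> j = 2" using assms(3) by auto
  moreover note \<kappa>[of "-1"] \<kappa>[of 0] \<kappa>[of 1] PT_nonneg[of Q Q "-1"] PT_nonneg[of Q Q 0] PT_nonneg[of Q Q 1]
  moreover have "8 * exp 12 / sqrt (n * p) = 2 * \<kappa>" by (simp add: \<kappa>_def)
  ultimately show ?thesis
    unfolding abs_le_iff by - (elim disjE; hypsubst; intro conjI; linarith)
qed

lemma GT_mono_left: "a \<le> a' \<Longrightarrow> GT a b k \<le> GT a' b k"
proof (induction a' rule: dec_induct)
  case (step m)
  have "0 \<le> p * PT m b (k - 1)" by (intro mult_nonneg_nonneg) auto
  then show ?case using step unfolding GT_Suc1 by linarith
qed simp

lemma GT_Suc2_le: "GT a (Suc b) k \<le> GT a b k"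
proof -
  have "0 \<le> p * PT a b k" by (intro mult_nonneg_nonneg) auto
  then show ?thesis by (simp add: GT_Suc2)
qed

text \<open>A lead \<open>P - Q\<close> of size about \<open>sqrt N\<close> yields first-day means whose sum exceeds \<open>N\<close>; the
  two means themselves may be as far as \<open>sqrt (N / p)\<close> from \<open>N / 2\<close>, but in opposite directions.\<close>

lemma F_mean_ge:
  fixes P Q N :: nat and lam :: real
  defines "X \<equiv> sqrt (real N * p)"
  defines "L \<equiv> 10 * lam + 64 * exp 12 + 5"
  assumes PQ: "N = P + Q" "0 < Q" "real P - real Q \<le> 3 * sqrt (real N)" "3 + sqrt (real N) / 2 \<le> real P - real Q"
    and lam: "0 < lam" "sqrt (real N) * p \<le> lam"
    and X: "12 * (4 * L + 2) \<le> X" "32 / gam L \<le> X"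
    and e: "\<And>\<tau>. e \<tau> = real P * GT (P - 1) Q (- \<tau>) + real Q * GT P (Q - 1) (1 - \<tau>)"
  shows "\<exists>b1 b2. b1 \<le> N \<and> b2 \<le> N \<and> real b1 \<le> e 1 \<and> real b2 \<le> e (-1) \<and>
     1 - 4 * exp 12 / X + (gam L)\<^sup>2 * (sqrt (real N) * p) \<le> F N b1 + F N b2"
proof -
  define r where "r = sqrt (real N)"
  define g where "g = gam L"
  have r2: "r * r = real N" by (simp add: r_def)
  have g: "0 < g" "g \<le> 1" by (auto simp: g_def gam_le_1)
  have e12: "0 < exp (12::real)" by simp
  have L1: "5 \<le> L" using lam e12 unfolding L_def by linarith
  have X0: "264 \<le> X" using X L1 by simp
  have XX: "X * X = real N * p" by (simp add: X_def)
  have rp: "r * p \<le> lam" using lam by (simp add: r_def)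
  have "real N * p \<le> real N * 1" using p_half by (intro mult_left_mono) auto
  then have "X \<le> r" unfolding X_def r_def by simp
  then have r: "264 \<le> r" using X0 by simp
  have r12: "12 * r \<le> real N" unfolding r2[symmetric] using r by (intro mult_right_mono) auto
  \<comment> \<open>The number of extra positive trials when \<open>GT Q Q\<close> is compared with
    \<open>GT (P - 1) Q\<close>; a \<open>+1\<close> vertex does not count itself. Each trial raises
    the tail by at least \<open>p * g / X\<close>, whence \<open>ga\<close>.\<close>
  define D where "D = real P - 1 - real Q"
  define ga where "ga = D * (p * g / X)"
  have dl: "r / 2 + 2 \<le> D" "D \<le> 3 * r" "real P - real Q \<le> 3 * r" using PQ by (auto simp: r_def D_def)
  have PQ': "Q < P" using dl r unfolding D_def by linarith
  have Q: "3 * real N \<le> 8 * real Q" "2 * real Q \<le> real N" using dl r12 PQ PQ' by auto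
  have pgX: "0 \<le> p * g / X" using g X0 by simp
  have ga0: "0 \<le> ga" unfolding ga_def using dl r pgX by (intro mult_nonneg_nonneg) auto
  have ptge: "g / X \<le> PT a Q k" if a: "Q \<le> a" "a < P" and k: "k \<in> {-2..1}" for a k
    unfolding g_def X_def
  proof (rule PT_ge_balanced)
    show "1 \<le> L" using L1 by simp
    show "12 * (4 * L + 2) \<le> sqrt (real N * p)" using X by (simp add: X_def)
    show "real a + real Q \<le> real N + 2" "3 * real N \<le> 4 * (real a + real Q)" using a PQ Q by auto
    have "\<bar>real a - real Q\<bar> * p \<le> (3 * r) * p" using a dl by (intro mult_right_mono) auto
    also have "\<dots> \<le> 3 * lam" using rp by simp
    also have "\<dots> \<le> L" using lam e12 unfolding L_def by linarith
    also have "\<dots> \<le> L * X" using X0 L1 mult_left_mono[of 1 X L] by simp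
    finally show "\<bar>real a - real Q\<bar> * p \<le> L * sqrt (real N * p)" by (simp add: X_def)
    have "\<bar>real_of_int k\<bar> \<le> 1 * X" using k X0 by auto
    also have "\<dots> \<le> L * X" using X0 L1 by (intro mult_right_mono) auto
    finally show "\<bar>real_of_int k\<bar> \<le> L * sqrt (real N * p)" by (simp add: X_def)
  qed
  have GT1: "GT Q Q k + ga \<le> GT (P - 1) Q k" if k: "k \<in> {-1..2}" for k
  proof -
    have "GT Q Q k + (real a - real Q) * (p * g / X) \<le> GT a Q k" if "Q \<le> a" "a \<le> P - 1" for a
      using that
    proof (induction a rule: dec_induct)
      case (step m)
      have "g / X \<le> PT m Q (k - 1)" by (rule ptge) (use step k in auto)
      then have "p * (g / X) \<le> p * PT m Q (k - 1)" by (rule mult_left_mono) simp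
      moreover have "GT Q Q k + (real m - real Q) * (p * g / X) \<le> GT m Q k" using step by simp
      moreover have "(real (Suc m) - real Q) * c = (real m - real Q) * c + c" for c
        by (simp add: algebra_simps)
      from this[of "p * g / X"]
      have "(real (Suc m) - real Q) * (p * g / X) = (real m - real Q) * (p * g / X) + p * (g / X)"
        by (simp only: times_divide_eq_right)
      ultimately show ?case unfolding GT_Suc1 by linarith
    qed simp
    from this[of "P - 1"] show ?thesis using PQ' by (simp add: ga_def D_def of_nat_diff)
  qed
  have GT2: "GT Q Q k + ga \<le> GT P (Q - 1) k" if k: "k \<in> {-1..2}" for k
  proof -
    have "GT (P - 1) Q k \<le> GT P Q k" by (rule GT_mono_left) simp
    also have "\<dots> \<le> GT P (Q - 1) k" using GT_Suc2_le[of P "Q - 1" k] PQ by simp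
    finally show ?thesis using GT1[OF k] by simp
  qed
  \<comment> \<open>A lower bound for \<open>e \<tau>\<close> at \<open>k = - \<tau>\<close>: the
    factor \<open>P\<close> is lowered to \<open>Q\<close>, so that the balanced tails can be paired
    by reflection.\<close>
  define c where "c k = real Q * (GT Q Q k + GT Q Q (k + 1) + 2 * ga)" for k
  have c_le: "c (- \<tau>) \<le> e \<tau>" if \<tau>: "\<tau> = 1 \<or> \<tau> = -1" for \<tau>
  proof -
    have "real Q * (GT Q Q (- \<tau>) + ga) \<le> real P * GT (P - 1) Q (- \<tau>)"
      using GT1[of "- \<tau>"] \<tau> PQ' ga0 by (intro mult_mono) auto
    moreover have "real Q * (GT Q Q (1 - \<tau>) + ga) \<le> real Q * GT P (Q - 1) (1 - \<tau>)"
      using GT2[of "1 - \<tau>"] \<tau> by (intro mult_left_mono) auto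
    ultimately show ?thesis unfolding e c_def by (simp add: algebra_simps)
  qed
  have e_le: "e \<tau> \<le> real N" for \<tau>
  proof -
    have "real P * GT (P - 1) Q (- \<tau>) \<le> real P * 1" "real Q * GT P (Q - 1) (1 - \<tau>) \<le> real Q * 1"
      by (intro mult_left_mono; simp)+
    moreover have "real N = real P + real Q" using PQ by simp
    ultimately show ?thesis unfolding e by linarith
  qed
  have c0: "0 \<le> c k" for k unfolding c_def using ga0 by (intro mult_nonneg_nonneg add_nonneg_nonneg) auto
  define b where "b k = nat \<lfloor>c k\<rfloor>" for k
  have b: "real (b k) \<le> c k" "c k - 1 \<le> real (b k)" for k
    unfolding b_def using c0[of k] by linarith+
  have bN: "real (b (- \<tau>)) \<le> e \<tau>" "b (- \<tau>) \<le> N" if "\<tau> = 1 \<or> \<tau> = -1" for \<tau>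
  proof -
    show *: "real (b (- \<tau>)) \<le> e \<tau>" using b[of "- \<tau>"] c_le[OF that] by linarith
    then show "b (- \<tau>) \<le> N" using e_le[of \<tau>] by linarith
  qed
  \<comment> \<open>The surplus of the two counts over \<open>N\<close>: the gain, less the
    \<open>P - Q\<close> lost by lowering \<open>P\<close> to \<open>Q\<close>, less 2 for rounding
    down.\<close>
  define G where "G = 4 * (real Q * ga) - (real P - real Q) - 2"
  have sumc: "c (-1) + c 1 = 2 * real Q + 4 * (real Q * ga)"
  proof -
    have "GT Q Q (-1) + GT Q Q 2 = 1" "GT Q Q 0 + GT Q Q 1 = 1"
      using GT_reflect[of Q Q "-1"] GT_reflect[of Q Q 0] by simp_all
    moreover have "c (-1) + c 1 = real Q * ((GT Q Q (-1) + GT Q Q 2) + (GT Q Q 0 + GT Q Q 1)) + 4 * (real Q * ga)"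
      unfolding c_def by (simp add: algebra_simps)
    ultimately show ?thesis by simp
  qed
  have sumb: "real N + G \<le> real (b (-1)) + real (b 1)"
    using sumc b(2)[of "-1"] b(2)[of 1] PQ unfolding G_def by linarith
  have G: "X * r * g / 2 \<le> G"
  proof -
    have "(3 / 8 * real N) * (r / 2 * (p * g / X)) \<le> real Q * ga"
      unfolding ga_def using Q dl r pgX by (intro mult_mono mult_right_mono mult_nonneg_nonneg) auto
    moreover have "(3 / 8 * real N) * (r / 2 * (p * g / X)) = 3 / 16 * (real N * p) * r * g / X"
      by simp
    moreover have "3 / 16 * (real N * p) * r * g / X = 3 / 16 * X * r * g"
      unfolding XX[symmetric] using X0 by simp
    ultimately have 1: "3 / 16 * X * r * g \<le> real Q * ga" by linarith
    \<comment> \<open>The lead itself is of order \<open>r\<close>, while the amplified gain is of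
      order \<open>X * r\<close>; a large \<open>X\<close> makes the loss \<open>P - Q + 2\<close>
      negligible.\<close>
    have "32 \<le> X * g" using X(2) g by (simp add: g_def pos_divide_le_eq)
    then have "32 * r \<le> (X * g) * r" using r by (intro mult_right_mono) auto
    then have 2: "16 * r \<le> X * r * g / 2" by (simp add: mult_ac)
    define Y where "Y = X * r * g"
    have "3 / 16 * Y \<le> real Q * ga" "16 * r \<le> Y / 2" using 1 2 by (simp_all only: Y_def mult.assoc)
    then show ?thesis using dl r unfolding G_def Y_def[symmetric] by linarith
  qed
  have G0: "0 \<le> G" using G X0 r g by (smt (verit) divide_nonneg_nonneg mult_nonneg_nonneg)
  \<comment> \<open>The contributions to the window are \<open>3 * lam\<close> from the lead,
    \<open>16 * exp 12\<close> from the shift caused by the observing vertex, \<open>6 * lam\<close>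
    from the gain and 1 from rounding.\<close>
  have win: "\<bar>2 * real (b k) - real N\<bar> * p \<le> (L - 1) * X" if k: "k = -1 \<or> k = 1" for k
  proof -
    define \<theta> where "\<theta> = GT Q Q k + GT Q Q (k + 1) - 1"
    have "\<bar>GT Q Q j - 1/2\<bar> \<le> 8 * exp 12 / X" if "j \<in> {-1..2}" for j
      unfolding X_def by (rule GT_centre) (use Q PQ that in auto)
    from this[of k] this[of "k + 1"] have th: "\<bar>\<theta>\<bar> \<le> 16 * exp 12 / X"
      using k unfolding \<theta>_def by auto
    have ck: "2 * c k - real N = - (real P - real Q) + 2 * (real Q * \<theta>) + 4 * (real Q * ga)"
      using PQ unfolding c_def \<theta>_def by (simp add: algebra_simps)
    have Qp: "real Q * p \<le> X * X / 2" using mult_right_mono[OF Q(2), of p] XX by simp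
    have "real Q * \<bar>\<theta>\<bar> * p = (real Q * p) * \<bar>\<theta>\<bar>" by simp
    also have "\<dots> \<le> (X * X / 2) * (16 * exp 12 / X)" using Qp th by (intro mult_mono) auto
    also have "\<dots> = 8 * exp 12 * X" using X0 by simp
    finally have t1: "real Q * \<bar>\<theta>\<bar> * p \<le> 8 * exp 12 * X" .
    have "ga \<le> 3 * r * (p * g / X)" unfolding ga_def using dl pgX by (intro mult_right_mono) auto
    also have "\<dots> = 3 * (r * p) * g / X" by simp
    also have "\<dots> \<le> 3 * lam * 1 / X" using rp g X0 lam r by (intro divide_right_mono mult_mono) auto
    finally have gale: "ga \<le> 3 * lam / X" by simp
    have "real Q * ga * p = (real Q * p) * ga" by simp
    also have "\<dots> \<le> (X * X / 2) * (3 * lam / X)" using Qp gale ga0 by (intro mult_mono) auto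
    also have "\<dots> = 3 / 2 * lam * X" using X0 by simp
    finally have t2: "real Q * ga * p \<le> 3 / 2 * lam * X" .
    have "\<bar>2 * real (b k) - real N\<bar> \<le> \<bar>2 * c k - real N\<bar> + 2" using b[of k] by linarith
    also have "\<bar>2 * c k - real N\<bar> \<le> 3 * r + 2 * (real Q * \<bar>\<theta>\<bar>) + 4 * (real Q * ga)"
    proof -
      have "\<bar>real Q * \<theta>\<bar> = real Q * \<bar>\<theta>\<bar>" "0 \<le> real Q * ga" using ga0 by (auto simp: abs_mult)
      then show ?thesis unfolding ck using dl PQ' by linarith
    qed
    finally have "\<bar>2 * real (b k) - real N\<bar> * p \<le> (3 * r + 2 * (real Q * \<bar>\<theta>\<bar>) + 4 * (real Q * ga) + 2) * p"
      by (intro mult_right_mono) auto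
    also have "\<dots> = 3 * (r * p) + 2 * (real Q * \<bar>\<theta>\<bar> * p) + 4 * (real Q * ga * p) + 2 * p"
      by (simp add: algebra_simps)
    also have "\<dots> \<le> 3 * lam + 16 * exp 12 * X + 6 * lam * X + 1"
      using rp t1 t2 p_half by linarith
    also have "\<dots> \<le> 3 * lam * X + 16 * exp 12 * X + 6 * lam * X + 1 * X"
      using X0 lam by (intro add_mono) auto
    also have "\<dots> = (9 * lam + 16 * exp 12 + 1) * X" by (simp add: algebra_simps)
    also have "\<dots> \<le> (L - 1) * X"
      using X0 lam e12 unfolding L_def by (intro mult_right_mono) auto
    finally show ?thesis .
  qed
  have "1 - 4 * exp 12 / X + 2 * p * g / X * G \<le> F N (b (-1)) + F N (b 1)"
    unfolding X_def g_def
  proof (rule F_sum_ge)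
    show "1 \<le> L" using L1 by simp
    show "12 * (4 * L + 2) \<le> sqrt (real N * p)" using X by (simp add: X_def)
  qed (use bN[of 1] bN[of "-1"] G0 sumb win in \<open>auto simp: X_def\<close>)
  moreover have "g\<^sup>2 * (r * p) \<le> 2 * p * g / X * G"
  proof -
    have "2 * p * g / X * (X * r * g / 2) \<le> 2 * p * g / X * G"
      using G g X0 by (intro mult_left_mono) auto
    moreover have "2 * p * g / X * (X * r * g / 2) = g\<^sup>2 * (r * p)"
      using X0 by (simp add: power2_eq_square)
    ultimately show ?thesis by simp
  qed
  ultimately have "1 - 4 * exp 12 / X + g\<^sup>2 * (r * p) \<le> F N (b (-1)) + F N (b 1)" by linarith
  then show ?thesis
    using bN[of 1] bN[of "-1"] by (intro exI[of _ "b (-1)"] exI[of _ "b 1"]) (auto simp: g_def r_def)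
qed

section \<open>Exposing the edges at one or two vertices\<close>

lemma expect_pairs_insert:
  assumes "finite W" "v \<notin> W"
  shows "expect (pairs (insert v W)) f = expect (pairs W) (\<lambda>G. expect W (\<lambda>A. f (G \<union> star v A)))"
proof -
  have "finite (star v W)" using assms by (simp add: star_def)
  moreover have "inj_on (\<lambda>x. {v, x}) W" by (auto simp: inj_on_def doubleton_eq_iff)
  ultimately show ?thesis
    using assms unfolding pairs_insert[OF assms(2)]
    by (subst expect_Un) (auto simp: star_disjoint, simp add: star_def expect_image)
qed

text \<open>Here \<open>A\<close> and \<open>B\<close> are the neighbourhoods of \<open>v\<close>
  and \<open>w\<close> inside \<open>U\<close>, independent of each other and of \<open>G\<close>;
  the edge between \<open>v\<close> and \<open>w\<close> is split off with weight
  \<open>p\<close>.\<close>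

lemma expect_pairs_insert2:
  assumes "finite U" "v \<notin> U" "w \<notin> U" "v \<noteq> w"
  shows "expect (pairs (insert v (insert w U))) f
    = expect (pairs U) (\<lambda>G. expect U (\<lambda>B. expect U (\<lambda>A.
        p * f (insert {v, w} (G \<union> star w B \<union> star v A)) + (1 - p) * f (G \<union> star w B \<union> star v A))))"
  using assms
  by (simp add: expect_pairs_insert expect_insert star_insert expect_add expect_cmult)

lemma expect_majority:
  assumes "finite U" "\<And>u. u \<in> U \<Longrightarrow> g u = 1 \<or> g u = (-1::int)"
  shows "expect U (\<lambda>A. of_bool (1 \<le> (\<Sum>u\<in>A. g u))) = F (card U) (card {u\<in>U. g u = 1})"
proof -
  have "{u\<in>U. g u = -1} = U - {u\<in>U. g u = 1}" using assms by force
  then have "card {u\<in>U. g u = -1} = card U - card {u\<in>U. g u = 1}"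
    using assms by (simp add: card_Diff_subset)
  then show ?thesis
    using expect_signed_sum[where W = U and s = g and \<phi> = "\<lambda>y. of_bool (1 \<le> y)" and z = 0] assms
    by (simp add: F_def GT_def)
qed

text \<open>Monotonicity makes the absolute value a plain difference, so its expectation is a
  difference of two values of \<open>F\<close>.\<close>

lemma expect_majority_diff_mono:
  assumes U: "finite U" "2 \<le> card U"
    and f: "\<And>u. u \<in> U \<Longrightarrow> f u = 1 \<or> f u = (-1::int)"
    and g: "\<And>u. u \<in> U \<Longrightarrow> g u = 1 \<or> g u = (-1::int)"
    and fg: "\<And>u. u \<in> U \<Longrightarrow> f u \<le> g u" and B: "B \<subseteq> U" "\<And>u. u \<in> U - B \<Longrightarrow> f u = g u"
  shows "expect U (\<lambda>A. \<bar>of_bool (1 \<le> (\<Sum>u\<in>A. f u)) - of_bool (1 \<le> (\<Sum>u\<in>A. g u))\<bar>) \<le> lip (card U) * real (card B)"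
proof -
  have "expect U (\<lambda>A. \<bar>of_bool (1 \<le> (\<Sum>u\<in>A. f u)) - of_bool (1 \<le> (\<Sum>u\<in>A. g u))\<bar>)
      = expect U (\<lambda>A. of_bool (1 \<le> (\<Sum>u\<in>A. g u)) - of_bool (1 \<le> (\<Sum>u\<in>A. f u)))"
  proof (rule expect_cong[OF refl])
    fix A assume "A \<subseteq> U"
    then have "(\<Sum>u\<in>A. f u) \<le> (\<Sum>u\<in>A. g u)" using fg by (intro sum_mono) auto
    then show "\<bar>of_bool (1 \<le> (\<Sum>u\<in>A. f u)) - of_bool (1 \<le> (\<Sum>u\<in>A. g u))\<bar>
      = (of_bool (1 \<le> (\<Sum>u\<in>A. g u)) - of_bool (1 \<le> (\<Sum>u\<in>A. f u)) :: real)" by auto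
  qed
  also have "\<dots> = F (card U) (card {u\<in>U. g u = 1}) - F (card U) (card {u\<in>U. f u = 1})"
    using f g U by (simp add: expect_diff expect_majority)
  also have "\<dots> \<le> lip (card U) * \<bar>real (card {u\<in>U. g u = 1}) - real (card {u\<in>U. f u = 1})\<bar>"
    using F_Lipschitz[of "card {u\<in>U. g u = 1}" "card U" "card {u\<in>U. f u = 1}"] U
    by (auto simp: card_mono)
  also have "\<dots> \<le> lip (card U) * real (card B)"
  proof (rule mult_left_mono)
    have sub: "{u\<in>U. f u = 1} \<subseteq> {u\<in>U. g u = 1}" using fg g by fastforce
    have "card {u\<in>U. g u = 1} \<le> card ({u\<in>U. f u = 1} \<union> B)"
      using B U by (intro card_mono) (auto intro: finite_subset)
    also have "\<dots> \<le> card {u\<in>U. f u = 1} + card B" by (rule card_Un_le)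
    finally show "\<bar>real (card {u\<in>U. g u = 1}) - real (card {u\<in>U. f u = 1})\<bar> \<le> real (card B)"
      using card_mono[OF _ sub] U by auto
  qed simp
  finally show ?thesis .
qed

text \<open>A tie is counted as 0. This bounds the indicator of opinion \<open>+1\<close> on day 2
  from below and removes the dependence on the first-day opinion of \<open>x\<close> itself.\<close>

definition day2_plus :: "(nat \<Rightarrow> int) \<Rightarrow> nat \<Rightarrow> nat set set \<Rightarrow> real" where
  "day2_plus s x E = of_bool (1 \<le> score (majority_dynamics E s 1) E x)"

context
  fixes s :: "nat \<Rightarrow> int" and U :: "nat set" and v w :: nat
  assumes finU: "finite U" and vU: "v \<notin> U" and wU: "w \<notin> U" and vw: "v \<noteq> w"
    and sU: "\<And>u. u \<in> U \<Longrightarrow> s u = 1 \<or> s u = -1"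
    and sv: "s v = 1 \<or> s v = -1" and sw: "s w = 1 \<or> s w = -1"
    and cardU: "4 \<le> card U"
begin

abbreviation exposed :: "nat set set \<Rightarrow> nat set \<Rightarrow> nat set \<Rightarrow> nat set set" where
  "exposed G A B \<equiv> G \<union> star w B \<union> star v A"

lemma opin_values: "u \<in> U \<Longrightarrow> opin s G \<tau> u = 1 \<or> opin s G \<tau> u = -1"
  unfolding opin_def using sU maj_values by blast

lemma neighbours_exposed:
  assumes "G \<subseteq> pairs U" "A \<subseteq> U" "B \<subseteq> U"
  shows "neighbours (exposed G A B) v = A" "neighbours (exposed G A B) w = B"
    and "u \<in> U \<Longrightarrow> neighbours (exposed G A B) u
      = neighbours G u \<union> (if u \<in> B then {w} else {}) \<union> (if u \<in> A then {v} else {})"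
proof -
  have GB: "G \<union> star w B \<subseteq> pairs (insert w U)"
    using assms wU by (auto simp: pairs_insert star_def)
  have "v \<notin> insert w U" "A \<subseteq> insert w U" using vU vw assms by auto
  note 1 = neighbours_insert_star[OF GB this] and 2 = neighbours_insert_star[OF assms(1) wU assms(3)]
  show "neighbours (exposed G A B) v = A" by (rule 1(1))
  have "w \<notin> A" using assms wU by auto
  then show "neighbours (exposed G A B) w = B" using 1(2)[of w] 2(1) vw by simp
  assume "u \<in> U"
  then have "u \<noteq> v" "u \<noteq> w" using vU wU by auto
  then show "neighbours (exposed G A B) u
      = neighbours G u \<union> (if u \<in> B then {w} else {}) \<union> (if u \<in> A then {v} else {})"
    using 1(2)[of u] 2(2)[of u] by simp
qed

lemma score_exposed:
  assumes "G \<subseteq> pairs U" "A \<subseteq> U" "B \<subseteq> U" "u \<in> U"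
  shows "score s (exposed G A B) u
    = score s G u + (if u \<in> B then s w else 0) + (if u \<in> A then s v else 0)"
proof -
  have sub: "neighbours G u \<subseteq> U" using assms neighbours_subset by blast
  then have fin: "finite (neighbours G u)" using finU finite_subset by blast
  have "w \<notin> neighbours G u" "v \<notin> neighbours G u" using sub vU wU by auto
  then show ?thesis
    using fin vw unfolding score_def neighbours_exposed(3)[OF assms] by auto
qed

text \<open>Every \<open>u\<close> in \<open>A\<close> has \<open>v\<close> as a neighbour, so the
  shift \<open>s v\<close> is the same for all of \<open>A\<close>, and the opinions with this shift
  are determined by \<open>G\<close>. The other observed vertex enters only at common neighbours of
  \<open>v\<close> and \<open>w\<close>.\<close>

lemma day2_score_v:
  assumes "G \<subseteq> pairs U" "A \<subseteq> U" "B \<subseteq> U"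
  shows "score (majority_dynamics (exposed G A B) s 1) (exposed G A B) v
    = (\<Sum>u\<in>A. opin s G (s v + (if u \<in> B then s w else 0)) u)"
  unfolding score_def[of "majority_dynamics (exposed G A B) s 1"] neighbours_exposed(1)[OF assms]
proof (rule sum.cong[OF refl])
  fix u assume "u \<in> A"
  then show "majority_dynamics (exposed G A B) s 1 u = opin s G (s v + (if u \<in> B then s w else 0)) u"
    using assms score_exposed[OF assms, of u] majority_dynamics_Suc[of "exposed G A B" s 0 u]
    by (auto simp: opin_def add_ac)
qed

lemma day2_score_w:
  assumes "G \<subseteq> pairs U" "A \<subseteq> U" "B \<subseteq> U"
  shows "score (majority_dynamics (exposed G A B) s 1) (exposed G A B) w
    = (\<Sum>u\<in>B. opin s G (s w + (if u \<in> A then s v else 0)) u)"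
  unfolding score_def[of "majority_dynamics (exposed G A B) s 1"] neighbours_exposed(2)[OF assms]
proof (rule sum.cong[OF refl])
  fix u assume "u \<in> B"
  then show "majority_dynamics (exposed G A B) s 1 u = opin s G (s w + (if u \<in> A then s v else 0)) u"
    using assms score_exposed[OF assms, of u] majority_dynamics_Suc[of "exposed G A B" s 0 u]
    by (auto simp: opin_def add_ac)
qed

lemma opin_mono: "\<sigma> \<le> \<tau> \<Longrightarrow> u \<in> U \<Longrightarrow> opin s G \<sigma> u \<le> opin s G \<tau> u"
  unfolding opin_def using sU by (intro maj_mono) auto

lemma opin_perturb:
  assumes "B \<subseteq> U" "\<tau> = 1 \<or> \<tau> = -1"
  shows "expect U (\<lambda>A. \<bar>of_bool (1 \<le> (\<Sum>u\<in>A. opin s G (\<sigma> + (if u \<in> B then \<tau> else 0)) u))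
      - of_bool (1 \<le> (\<Sum>u\<in>A. opin s G \<sigma> u))\<bar>) \<le> lip (card U) * real (card B)"
  using assms(2)
proof
  assume \<tau>: "\<tau> = 1"
  show ?thesis
    by (subst abs_minus_commute, rule expect_majority_diff_mono)
       (use finU cardU opin_values assms \<tau> in \<open>auto intro!: opin_mono\<close>)
next
  assume \<tau>: "\<tau> = -1"
  show ?thesis
    by (rule expect_majority_diff_mono)
       (use finU cardU opin_values assms \<tau> in \<open>auto intro!: opin_mono\<close>)
qed

text \<open>The error has two sources: the edge between \<open>v\<close> and \<open>w\<close> is
  present with probability \<open>p\<close>, and \<open>w\<close> alters the opinions of at most
  \<open>card B\<close> vertices, on average \<open>p * card U\<close>.\<close>

lemma expect_day2_ge:
  "expect (pairs U) (\<lambda>G. F (card U) (num_plus U s G (s v))) - (p + lip (card U) * (p * real (card U)))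
    \<le> expect (pairs (insert v (insert w U))) (day2_plus s v)"
proof -
  let ?X = "\<lambda>G A. of_bool (1 \<le> (\<Sum>u\<in>A. opin s G (s v) u)) :: real"
  let ?F = "\<lambda>G. F (card U) (num_plus U s G (s v))"
  have 1: "?F G - p - lip (card U) * real (card B)
      \<le> expect U (\<lambda>A. p * day2_plus s v (insert {v, w} (exposed G A B)) + (1 - p) * day2_plus s v (exposed G A B))"
    if G: "G \<subseteq> pairs U" and B: "B \<subseteq> U" for G B
  proof -
    let ?d = "\<lambda>A. \<bar>of_bool (1 \<le> (\<Sum>u\<in>A. opin s G (s v + (if u \<in> B then s w else 0)) u)) - ?X G A\<bar>"
    have d: "expect U ?d \<le> lip (card U) * real (card B)" by (rule opin_perturb[OF B sw])
    have d0: "0 \<le> expect U ?d" by (rule expect_nonneg) simp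
    have "expect U (?X G) = ?F G"
      unfolding num_plus_def by (rule expect_majority[OF finU opin_values])
    then have "expect U (\<lambda>A. (1 - p) * (?X G A - ?d A)) = (1 - p) * (?F G - expect U ?d)"
      by (simp only: expect_cmult expect_diff)
    moreover have "expect U (\<lambda>A. (1 - p) * (?X G A - ?d A))
      \<le> expect U (\<lambda>A. p * day2_plus s v (insert {v, w} (exposed G A B)) + (1 - p) * day2_plus s v (exposed G A B))"
    proof (rule expect_mono)
      fix A assume A: "A \<subseteq> U"
      have "?X G A - ?d A \<le> day2_plus s v (exposed G A B)"
        unfolding day2_plus_def day2_score_v[OF G A B] by linarith
      then have "(1 - p) * (?X G A - ?d A) \<le> (1 - p) * day2_plus s v (exposed G A B)"
        by (rule mult_left_mono) simp
      moreover have "0 \<le> p * day2_plus s v (insert {v, w} (exposed G A B))"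
        by (rule mult_nonneg_nonneg) (auto simp: day2_plus_def)
      ultimately show "(1 - p) * (?X G A - ?d A)
        \<le> p * day2_plus s v (insert {v, w} (exposed G A B)) + (1 - p) * day2_plus s v (exposed G A B)" by linarith
    qed
    moreover have "?F G - p - lip (card U) * real (card B) \<le> (1 - p) * (?F G - expect U ?d)"
    proof -
      have "p * ?F G \<le> p * 1" by (rule mult_left_mono) auto
      moreover have "0 \<le> p * expect U ?d" using d0 by (intro mult_nonneg_nonneg) auto
      ultimately show ?thesis using d by (simp add: algebra_simps)
    qed
    ultimately show ?thesis by linarith
  qed
  have "expect (pairs U) ?F - (p + lip (card U) * (p * real (card U)))
      = expect (pairs U) (\<lambda>G. expect U (\<lambda>B. ?F G - p - lip (card U) * real (card B)))"
    using finU by (simp add: expect_diff expect_cmult expect_card)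
  also have "\<dots> \<le> expect (pairs (insert v (insert w U))) (day2_plus s v)"
    unfolding expect_pairs_insert2[OF finU vU wU vw] by (intro expect_mono 1)
  finally show ?thesis .
qed

text \<open>Given \<open>G\<close>, and without interference, the two indicators depend on the
  independent sets \<open>A\<close> and \<open>B\<close>, so the product of the two values of
  \<open>F\<close> appears. Replacing each indicator costs one perturbation term.\<close>

lemma expect_day2_product_le:
  "expect (pairs (insert v (insert w U))) (\<lambda>E. day2_plus s v E * day2_plus s w E)
    \<le> expect (pairs U) (\<lambda>G. F (card U) (num_plus U s G (s v)) * F (card U) (num_plus U s G (s w)))
      + (p + 2 * (lip (card U) * (p * real (card U))))"
proof -
  let ?X = "\<lambda>\<sigma> G A. of_bool (1 \<le> (\<Sum>u\<in>A. opin s G \<sigma> u)) :: real"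
  let ?F = "\<lambda>\<sigma> G. F (card U) (num_plus U s G \<sigma>)"
  let ?d = "\<lambda>\<sigma> \<tau> G A B. \<bar>of_bool (1 \<le> (\<Sum>u\<in>A. opin s G (\<sigma> + (if u \<in> B then \<tau> else 0)) u)) - ?X \<sigma> G A\<bar>"
  let ?f = "\<lambda>E. day2_plus s v E * day2_plus s w E"
  have X: "expect U (?X \<sigma> G) = ?F \<sigma> G" for \<sigma> G
    unfolding num_plus_def by (rule expect_majority[OF finU opin_values])
  have d: "expect U (\<lambda>B. expect U (\<lambda>A. ?d \<sigma> \<tau> G A B)) \<le> lip (card U) * (p * real (card U))"
    if "\<tau> = 1 \<or> \<tau> = -1" for \<sigma> \<tau> G
  proof -
    have "expect U (\<lambda>B. expect U (\<lambda>A. ?d \<sigma> \<tau> G A B)) \<le> expect U (\<lambda>B. lip (card U) * real (card B))"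
      by (intro expect_mono opin_perturb that)
    then show ?thesis using finU by (simp add: expect_cmult expect_card)
  qed
  have 1: "expect U (\<lambda>B. expect U (\<lambda>A. p * ?f (insert {v, w} (exposed G A B)) + (1 - p) * ?f (exposed G A B)))
      \<le> ?F (s v) G * ?F (s w) G + (p + 2 * (lip (card U) * (p * real (card U))))"
    if G: "G \<subseteq> pairs U" for G
  proof -
    have "expect U (\<lambda>B. expect U (\<lambda>A. p * ?f (insert {v, w} (exposed G A B)) + (1 - p) * ?f (exposed G A B)))
      \<le> expect U (\<lambda>B. expect U (\<lambda>A. p + ?X (s v) G A * ?X (s w) G B + ?d (s v) (s w) G A B + ?d (s w) (s v) G B A))"
    proof (intro expect_mono)
      fix A B assume B: "B \<subseteq> U" and A: "A \<subseteq> U"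
      have "p * ?f (insert {v, w} (exposed G A B)) \<le> p * 1"
        by (rule mult_left_mono) (auto simp: day2_plus_def)
      moreover have "(1 - p) * ?f (exposed G A B) \<le> 1 * ?f (exposed G A B)"
        by (rule mult_right_mono) (auto simp: day2_plus_def)
      moreover have "?f (exposed G A B) \<le> ?X (s v) G A * ?X (s w) G B + ?d (s v) (s w) G A B + ?d (s w) (s v) G B A"
        unfolding day2_plus_def day2_score_v[OF G A B] day2_score_w[OF G A B]
        by (auto simp: of_bool_def)
      ultimately show "p * ?f (insert {v, w} (exposed G A B)) + (1 - p) * ?f (exposed G A B)
        \<le> p + ?X (s v) G A * ?X (s w) G B + ?d (s v) (s w) G A B + ?d (s w) (s v) G B A" by linarith
    qed
    also have "\<dots> = p + ?F (s v) G * ?F (s w) G + expect U (\<lambda>B. expect U (\<lambda>A. ?d (s v) (s w) G A B))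
        + expect U (\<lambda>B. expect U (\<lambda>A. ?d (s w) (s v) G B A))"
      by (simp only: expect_add expect_const[OF finU] expect_cmult expect_multc X)
    \<comment> \<open>The averages are exchanged so that the neighbourhood of the observing vertex,
      now \<open>w\<close>, is the inner one.\<close>
    also have "expect U (\<lambda>B. expect U (\<lambda>A. ?d (s w) (s v) G B A)) = expect U (\<lambda>A. expect U (\<lambda>B. ?d (s w) (s v) G B A))"
      by (rule expect_commute)
    finally have "expect U (\<lambda>B. expect U (\<lambda>A. p * ?f (insert {v, w} (exposed G A B)) + (1 - p) * ?f (exposed G A B)))
      \<le> p + ?F (s v) G * ?F (s w) G + expect U (\<lambda>B. expect U (\<lambda>A. ?d (s v) (s w) G A B))
        + expect U (\<lambda>A. expect U (\<lambda>B. ?d (s w) (s v) G B A))" .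
    moreover have "expect U (\<lambda>B. expect U (\<lambda>A. ?d (s v) (s w) G A B)) \<le> lip (card U) * (p * real (card U))"
      by (rule d[OF sw])
    moreover have "expect U (\<lambda>A. expect U (\<lambda>B. ?d (s w) (s v) G B A)) \<le> lip (card U) * (p * real (card U))"
      by (rule d[OF sv])
    ultimately show ?thesis by linarith
  qed
  have "expect (pairs (insert v (insert w U))) ?f
    \<le> expect (pairs U) (\<lambda>G. ?F (s v) G * ?F (s w) G + (p + 2 * (lip (card U) * (p * real (card U)))))"
    unfolding expect_pairs_insert2[OF finU vU wU vw] by (intro expect_mono 1)
  also have "\<dots> = expect (pairs U) (\<lambda>G. ?F (s v) G * ?F (s w) G) + (p + 2 * (lip (card U) * (p * real (card U))))"
    unfolding expect_add using finU by simp
  finally show ?thesis .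
qed

end

section \<open>Moments of the first day\<close>

lemma GT_diff_sign:
  assumes "t = 1 \<or> t = (-1::int)"
  shows "\<bar>GT a b (k - t) - GT a b k\<bar> \<le> max (PT a b (k - 1)) (PT a b k)"
proof -
  have 1: "GT a b (k - 1) - GT a b k = PT a b (k - 1)"
    using GT_Suc_arg[of a b "k - 1"] by (simp only: diff_add_cancel)
  have 2: "GT a b (k - - 1) - GT a b k = - PT a b k"
    unfolding diff_minus_eq_add using GT_Suc_arg[of a b k] by linarith
  from assms show ?thesis
  proof
    assume "t = 1"
    then show ?thesis using 1 by simp
  next
    assume "t = -1"
    then show ?thesis using 2 by simp
  qed
qed

lemma expect_signed_GT:
  assumes "finite W" "\<And>x. x \<in> W \<Longrightarrow> s x = 1 \<or> s x = (-1::int)"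
  shows "expect W (\<lambda>T. of_bool (k \<le> (\<Sum>x\<in>T. s x))) = GT (card {x\<in>W. s x = 1}) (card {x\<in>W. s x = -1}) k"
  using expect_signed_sum[where W = W and s = s and \<phi> = "\<lambda>y. of_bool (k \<le> y)" and z = 0] assms
  by (simp add: GT_def)

context
  fixes s :: "nat \<Rightarrow> int" and U :: "nat set"
  assumes finU: "finite U" and sU: "\<And>u. u \<in> U \<Longrightarrow> s u = 1 \<or> s u = -1" and cardU: "6 \<le> card U"
begin

text \<open>The least score that gives opinion \<open>+1\<close>; it depends on the old opinion
  because a tie keeps it.\<close>

definition thr :: "nat \<Rightarrow> int" where
  "thr u = (if s u = 1 then 0 else 1)"

lemma opin_eq_1_iff: "u \<in> U \<Longrightarrow> opin s G \<tau> u = 1 \<longleftrightarrow> thr u - \<tau> \<le> score s G u"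
  unfolding opin_def thr_def using maj_eq_1_iff[OF sU, of u "score s G u + \<tau>"] by auto

lemma expect_opin:
  assumes "u \<in> U"
  shows "expect (pairs U) (\<lambda>G. of_bool (opin s G \<tau> u = 1))
    = GT (card {x\<in>U - {u}. s x = 1}) (card {x\<in>U - {u}. s x = -1}) (thr u - \<tau>)"
proof -
  define W where "W = U - {u}"
  have W: "finite W" "u \<notin> W" "U = insert u W" using finU assms by (auto simp: W_def)
  have "expect (pairs U) (\<lambda>G. of_bool (opin s G \<tau> u = 1))
      = expect (pairs W) (\<lambda>G. expect W (\<lambda>A. of_bool (thr u - \<tau> \<le> (\<Sum>x\<in>A. s x))))"
    unfolding W(3) expect_pairs_insert[OF W(1,2)]
  proof (intro expect_cong refl)
    fix G A assume "G \<subseteq> pairs W" "A \<subseteq> W"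
    then have "score s (G \<union> star u A) u = (\<Sum>x\<in>A. s x)"
      unfolding score_def by (simp add: neighbours_insert_star(1)[OF _ W(2)])
    then show "of_bool (opin s (G \<union> star u A) \<tau> u = 1) = (of_bool (thr u - \<tau> \<le> (\<Sum>x\<in>A. s x)) :: real)"
      using opin_eq_1_iff[OF assms] by simp
  qed
  also have "expect W (\<lambda>A. of_bool (thr u - \<tau> \<le> (\<Sum>x\<in>A. s x)))
      = GT (card {x\<in>W. s x = 1}) (card {x\<in>W. s x = -1}) (thr u - \<tau>)"
    by (rule expect_signed_GT) (use W sU in auto)
  finally show ?thesis using W(1) unfolding W_def[symmetric] by simp
qed

lemma expect_num_plus:
  assumes PQ: "P = card {x\<in>U. s x = 1}" "Q = card {x\<in>U. s x = -1}"
  shows "expect (pairs U) (\<lambda>G. real (num_plus U s G \<tau>))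
    = real P * GT (P - 1) Q (- \<tau>) + real Q * GT P (Q - 1) (1 - \<tau>)"
proof -
  have "expect (pairs U) (\<lambda>G. real (num_plus U s G \<tau>))
      = (\<Sum>u\<in>U. expect (pairs U) (\<lambda>G. of_bool (opin s G \<tau> u = 1)))"
    unfolding num_plus_def real_card_eq_sum[OF finU] by (rule expect_sum)
  also have "\<dots> = (\<Sum>u\<in>U. if s u = 1 then GT (P - 1) Q (- \<tau>) else GT P (Q - 1) (1 - \<tau>))"
  proof (rule sum.cong[OF refl])
    fix u assume u: "u \<in> U"
    show "expect (pairs U) (\<lambda>G. of_bool (opin s G \<tau> u = 1))
        = (if s u = 1 then GT (P - 1) Q (- \<tau>) else GT P (Q - 1) (1 - \<tau>))"
    proof (cases "s u = 1")
      case True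
      have "{x\<in>U - {u}. s x = 1} = {x\<in>U. s x = 1} - {u}" "{x\<in>U - {u}. s x = -1} = {x\<in>U. s x = -1}"
        using True by auto
      then show ?thesis
        unfolding expect_opin[OF u] using True u finU PQ by (simp add: thr_def card_Diff_singleton)
    next
      case False
      have "{x\<in>U - {u}. s x = -1} = {x\<in>U. s x = -1} - {u}" "{x\<in>U - {u}. s x = 1} = {x\<in>U. s x = 1}"
        using False by auto
      then show ?thesis
        unfolding expect_opin[OF u] using False sU[OF u] u finU PQ by (simp add: thr_def card_Diff_singleton)
    qed
  qed
  also have "\<dots> = (\<Sum>u\<in>{x\<in>U. s x = 1}. GT (P - 1) Q (- \<tau>)) + (\<Sum>u\<in>U - {x\<in>U. s x = 1}. GT P (Q - 1) (1 - \<tau>))"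
    by (subst sum.subset_diff[of "{x\<in>U. s x = 1}" U]) (use finU in auto)
  also have "U - {x\<in>U. s x = 1} = {x\<in>U. s x = -1}" using sU by force
  finally show ?thesis by (simp add: PQ)
qed

text \<open>The scores of \<open>u\<close> and \<open>u'\<close> share only the edge between them.
  Given its state they are independent, so the covariance is \<open>p * (1 - p)\<close> times the
  product of the two effects of that edge, and each effect is at most one point probability.\<close>

lemma Cov_opin_le:
  assumes u: "u \<in> U" "u' \<in> U" "u \<noteq> u'"
  shows "Cov (pairs U) (\<lambda>G. of_bool (opin s G \<tau> u = 1)) (\<lambda>G. of_bool (opin s G \<tau> u' = 1))
    \<le> 16 * (exp 12)\<^sup>2 / real (card U)"
proof -
  define W where "W = U - {u, u'}"
  have W: "finite W" "u \<notin> W" "u' \<notin> W" "U = insert u (insert u' W)" using finU u by (auto simp: W_def)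
  have cW: "card U = card W + 2" unfolding W(4) using W(1,2,3) u(3) by simp
  have sW: "\<And>x. x \<in> W \<Longrightarrow> s x = 1 \<or> s x = -1" using sU unfolding W_def by auto
  define a where "a = card {x\<in>W. s x = 1}"
  define b where "b = card {x\<in>W. s x = -1}"
  have ab: "a + b = card W" unfolding a_def b_def by (rule card_signs[OF W(1) sW])
  define I where "I k = (\<lambda>A. of_bool (k \<le> (\<Sum>x\<in>A. s x)) :: real)" for k
  have EI: "expect W (I k) = GT a b k" for k
    unfolding I_def a_def b_def by (rule expect_signed_GT[OF W(1) sW])
  define k where "k = thr u - \<tau>"
  define k' where "k' = thr u' - \<tau>"
  have c4: "4 \<le> card W" using cW cardU by simp
  have sc: "score s (G \<union> star u' B \<union> star u A) u = (\<Sum>x\<in>A. s x)"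
      "score s (insert {u, u'} (G \<union> star u' B \<union> star u A)) u = s u' + (\<Sum>x\<in>A. s x)"
      "score s (G \<union> star u' B \<union> star u A) u' = (\<Sum>x\<in>B. s x)"
      "score s (insert {u, u'} (G \<union> star u' B \<union> star u A)) u' = s u + (\<Sum>x\<in>B. s x)"
    if GAB: "G \<subseteq> pairs W" "A \<subseteq> W" "B \<subseteq> W" for G A B
  proof -
    have nb: "neighbours (G \<union> star u' B \<union> star u A) u = A" "neighbours (G \<union> star u' B \<union> star u A) u' = B"
      by (rule neighbours_exposed(1,2)[OF W(1,2,3) u(3) _ sU[OF u(1)] sU[OF u(2)] c4 GAB], erule sW)+
    have fin: "finite A" "finite B" "u' \<notin> A" "u \<notin> B" using GAB W finite_subset by auto
    show "score s (G \<union> star u' B \<union> star u A) u = (\<Sum>x\<in>A. s x)"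
      "score s (insert {u, u'} (G \<union> star u' B \<union> star u A)) u = s u' + (\<Sum>x\<in>A. s x)"
      "score s (G \<union> star u' B \<union> star u A) u' = (\<Sum>x\<in>B. s x)"
      "score s (insert {u, u'} (G \<union> star u' B \<union> star u A)) u' = s u + (\<Sum>x\<in>B. s x)"
      unfolding score_def neighbours_insert_edge nb using fin by auto
  qed
  have op: "of_bool (opin s (G \<union> star u' B \<union> star u A) \<tau> u = 1) = I k A"
      "of_bool (opin s (insert {u, u'} (G \<union> star u' B \<union> star u A)) \<tau> u = 1) = I (k - s u') A"
      "of_bool (opin s (G \<union> star u' B \<union> star u A) \<tau> u' = 1) = I k' B"
      "of_bool (opin s (insert {u, u'} (G \<union> star u' B \<union> star u A)) \<tau> u' = 1) = I (k' - s u) B"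
    if "G \<subseteq> pairs W" "A \<subseteq> W" "B \<subseteq> W" for G A B
    using sc[OF that] u by (auto simp: opin_eq_1_iff I_def k_def k'_def)
  define \<alpha>0 where "\<alpha>0 = GT a b k"
  define \<alpha>1 where "\<alpha>1 = GT a b (k - s u')"
  define \<beta>0 where "\<beta>0 = GT a b k'"
  define \<beta>1 where "\<beta>1 = GT a b (k' - s u)"
  note exp2 = expect_pairs_insert2[OF W(1,2,3) u(3), folded W(4)]
  have E1: "expect (pairs U) (\<lambda>G. of_bool (opin s G \<tau> u = 1)) = p * \<alpha>1 + (1 - p) * \<alpha>0"
  proof -
    have "expect (pairs U) (\<lambda>G. of_bool (opin s G \<tau> u = 1))
      = expect (pairs W) (\<lambda>G. expect W (\<lambda>B. expect W (\<lambda>A. p * I (k - s u') A + (1 - p) * I k A)))"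
      unfolding exp2 by (intro expect_cong refl) (simp only: op)
    then show ?thesis
      unfolding expect_add expect_cmult EI using W(1) by (simp add: \<alpha>0_def \<alpha>1_def)
  qed
  have E2: "expect (pairs U) (\<lambda>G. of_bool (opin s G \<tau> u' = 1)) = p * \<beta>1 + (1 - p) * \<beta>0"
  proof -
    have "expect (pairs U) (\<lambda>G. of_bool (opin s G \<tau> u' = 1))
      = expect (pairs W) (\<lambda>G. expect W (\<lambda>B. expect W (\<lambda>A. p * I (k' - s u) B + (1 - p) * I k' B)))"
      unfolding exp2 by (intro expect_cong refl) (simp only: op)
    also have "\<dots> = expect (pairs W) (\<lambda>G. expect W (\<lambda>B. p * I (k' - s u) B + (1 - p) * I k' B))"
      using W(1) by simp
    finally show ?thesis
      unfolding expect_add expect_cmult EI using W(1) by (simp add: \<beta>0_def \<beta>1_def)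
  qed
  have E12: "expect (pairs U) (\<lambda>G. of_bool (opin s G \<tau> u = 1) * of_bool (opin s G \<tau> u' = 1))
      = p * (\<alpha>1 * \<beta>1) + (1 - p) * (\<alpha>0 * \<beta>0)"
  proof -
    have "expect (pairs U) (\<lambda>G. of_bool (opin s G \<tau> u = 1) * of_bool (opin s G \<tau> u' = 1))
      = expect (pairs W) (\<lambda>G. expect W (\<lambda>B. expect W (\<lambda>A.
          p * (I (k - s u') A * I (k' - s u) B) + (1 - p) * (I k A * I k' B))))"
      unfolding exp2 by (intro expect_cong refl) (simp only: op)
    also have "\<dots> = expect (pairs W) (\<lambda>G. p * (\<alpha>1 * \<beta>1) + (1 - p) * (\<alpha>0 * \<beta>0))"
      unfolding expect_add expect_cmult expect_multc EI \<alpha>0_def \<alpha>1_def \<beta>0_def \<beta>1_def ..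
    finally show ?thesis using W(1) by simp
  qed
  define \<kappa> where "\<kappa> = 4 * exp 12 / sqrt (real (card U) * p)"
  have PTk: "PT a b j \<le> \<kappa>" for j
    unfolding \<kappa>_def by (rule PT_le_sum) (use ab cW c4 in auto)
  then have d: "\<bar>GT a b (j - t) - GT a b j\<bar> \<le> \<kappa>" if "t = 1 \<or> t = -1" for j t
    using GT_diff_sign[OF that, of a b j] PTk[of j] PTk[of "j - 1"] by (meson max.boundedI order_trans)
  have "Cov (pairs U) (\<lambda>G. of_bool (opin s G \<tau> u = 1)) (\<lambda>G. of_bool (opin s G \<tau> u' = 1))
      = p * (1 - p) * ((\<alpha>1 - \<alpha>0) * (\<beta>1 - \<beta>0))"
    unfolding Cov_def E1 E2 E12 by (simp add: algebra_simps)
  also have "\<dots> \<le> p * (\<kappa> * \<kappa>)"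
  proof -
    have "\<bar>(\<alpha>1 - \<alpha>0) * (\<beta>1 - \<beta>0)\<bar> \<le> \<kappa> * \<kappa>"
      unfolding abs_mult \<alpha>0_def \<alpha>1_def \<beta>0_def \<beta>1_def
      using d[OF sU[OF u(2)], of k] d[OF sU[OF u(1)], of k'] by (intro mult_mono) auto
    then have "(1 - p) * \<bar>(\<alpha>1 - \<alpha>0) * (\<beta>1 - \<beta>0)\<bar> \<le> 1 * (\<kappa> * \<kappa>)" by (intro mult_mono) auto
    moreover have "(1 - p) * ((\<alpha>1 - \<alpha>0) * (\<beta>1 - \<beta>0)) \<le> (1 - p) * \<bar>(\<alpha>1 - \<alpha>0) * (\<beta>1 - \<beta>0)\<bar>"
      by (intro mult_left_mono) auto
    ultimately have "(1 - p) * ((\<alpha>1 - \<alpha>0) * (\<beta>1 - \<beta>0)) \<le> \<kappa> * \<kappa>" by linarith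
    then have "p * ((1 - p) * ((\<alpha>1 - \<alpha>0) * (\<beta>1 - \<beta>0))) \<le> p * (\<kappa> * \<kappa>)" by (rule mult_left_mono) simp
    then show ?thesis by (simp only: mult.assoc)
  qed
  also have "\<dots> = 16 * (exp 12)\<^sup>2 / real (card U)"
  proof -
    have "\<kappa> * \<kappa> = (4 * exp 12)\<^sup>2 / (sqrt (real (card U) * p))\<^sup>2"
      by (simp only: \<kappa>_def power2_eq_square times_divide_times_eq)
    also have "(sqrt (real (card U) * p))\<^sup>2 = real (card U) * p" by simp
    finally show ?thesis using p_pos by (simp add: power_mult_distrib)
  qed
  finally show ?thesis .
qed

lemma Var_num_plus_le: "Var (pairs U) (\<lambda>G. real (num_plus U s G \<tau>)) \<le> sd_const * real (card U)"
proof -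
  let ?I = "\<lambda>u G. of_bool (opin s G \<tau> u = 1) :: real"
  have "Var (pairs U) (\<lambda>G. real (num_plus U s G \<tau>)) = (\<Sum>u\<in>U. \<Sum>u'\<in>U. Cov (pairs U) (?I u) (?I u'))"
    unfolding num_plus_def real_card_eq_sum[OF finU] by (rule Var_sum)
  also have "\<dots> \<le> (\<Sum>u\<in>U. \<Sum>u'\<in>U. of_bool (u = u') + 16 * (exp 12)\<^sup>2 / real (card U))"
  proof (intro sum_mono)
    fix u u' assume u: "u \<in> U" "u' \<in> U"
    show "Cov (pairs U) (?I u) (?I u') \<le> of_bool (u = u') + 16 * (exp 12)\<^sup>2 / real (card U)"
    proof (cases "u = u'")
      case True
      have "expect (pairs U) (\<lambda>S. ?I u S * ?I u S) \<le> 1"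
        using finU by (intro expect_le_const) auto
      moreover have "0 \<le> expect (pairs U) (?I u) * expect (pairs U) (?I u)" by simp
      ultimately have "Cov (pairs U) (?I u) (?I u) \<le> 1" unfolding Cov_def by linarith
      moreover have "0 \<le> 16 * (exp 12)\<^sup>2 / real (card U)" by simp
      moreover have "of_bool (u = u') = (1::real)" using True by simp
      ultimately show ?thesis unfolding True by linarith
    next
      case False
      then show ?thesis using Cov_opin_le[OF u] by simp
    qed
  qed
  also have "\<dots> = sd_const * real (card U)"
    using finU cardU by (simp add: sum.distrib sd_const_def algebra_simps)
  finally show ?thesis .
qed

lemma num_plus_le: "num_plus U s G \<tau> \<le> card U"
  unfolding num_plus_def by (rule card_mono) (use finU in auto)

text \<open>Only a lower bound \<open>b\<close> for the mean is known. \<open>F\<close> is monotone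
  above \<open>b\<close> and Lipschitz below it, and the mean absolute deviation is at most the
  square root of the variance.\<close>

lemma expect_F_ge:
  assumes "b \<le> card U" "real b \<le> expect (pairs U) (\<lambda>G. real (num_plus U s G \<tau>))"
  shows "F (card U) b - lip (card U) * sqrt (sd_const * real (card U))
    \<le> expect (pairs U) (\<lambda>G. F (card U) (num_plus U s G \<tau>))"
proof -
  let ?a = "\<lambda>G. real (num_plus U s G \<tau>)"
  have "F (card U) b - lip (card U) * expect (pairs U) (\<lambda>G. \<bar>?a G - expect (pairs U) ?a\<bar>)
      = expect (pairs U) (\<lambda>G. F (card U) b - lip (card U) * \<bar>?a G - expect (pairs U) ?a\<bar>)"
    using finU by (simp add: expect_diff expect_cmult)
  also have "\<dots> \<le> expect (pairs U) (\<lambda>G. F (card U) (num_plus U s G \<tau>))"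
  proof (rule expect_mono)
    fix G
    show "F (card U) b - lip (card U) * \<bar>?a G - expect (pairs U) ?a\<bar> \<le> F (card U) (num_plus U s G \<tau>)"
    proof (cases "b \<le> num_plus U s G \<tau>")
      case True
      then have "F (card U) b \<le> F (card U) (num_plus U s G \<tau>)" by (rule F_mono[OF _ num_plus_le])
      moreover have "0 \<le> lip (card U) * \<bar>?a G - expect (pairs U) ?a\<bar>" by simp
      ultimately show ?thesis by linarith
    next
      case False
      have "F (card U) b \<le> F (card U) (num_plus U s G \<tau>) + lip (card U) * (real b - ?a G)"
        using False assms cardU by (intro F_upper) auto
      moreover have "lip (card U) * (real b - ?a G) \<le> lip (card U) * \<bar>?a G - expect (pairs U) ?a\<bar>"
        using assms by (intro mult_left_mono) auto
      ultimately show ?thesis by linarith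
    qed
  qed
  finally have "F (card U) b - lip (card U) * expect (pairs U) (\<lambda>G. \<bar>?a G - expect (pairs U) ?a\<bar>)
    \<le> expect (pairs U) (\<lambda>G. F (card U) (num_plus U s G \<tau>))" .
  moreover have "lip (card U) * expect (pairs U) (\<lambda>G. \<bar>?a G - expect (pairs U) ?a\<bar>)
      \<le> lip (card U) * sqrt (sd_const * real (card U))"
    using finU by (intro mult_left_mono expect_abs_dev_le Var_num_plus_le) auto
  ultimately show ?thesis by linarith
qed

lemma expect_F_mono:
  assumes "\<sigma> \<le> \<tau>"
  shows "expect (pairs U) (\<lambda>G. F (card U) (num_plus U s G \<sigma>)) \<le> expect (pairs U) (\<lambda>G. F (card U) (num_plus U s G \<tau>))"
proof (intro expect_mono F_mono num_plus_le)
  fix G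
  have "opin s G \<tau> u = 1" if u: "u \<in> U" "opin s G \<sigma> u = 1" for u
    using u assms opin_eq_1_iff[OF u(1)] by fastforce
  then show "num_plus U s G \<sigma> \<le> num_plus U s G \<tau>"
    unfolding num_plus_def using finU by (intro card_mono) auto
qed

text \<open>The count of first-day opinions is common to both observers, so the covariance does not
  vanish. It is at most the mean of the variances, where \<open>(lip N)^2\<close> turns a variance
  of order \<open>N\<close> into one of order \<open>p\<close>.\<close>

lemma Cov_F_le:
  "Cov (pairs U) (\<lambda>G. F (card U) (num_plus U s G \<sigma>)) (\<lambda>G. F (card U) (num_plus U s G \<tau>))
    \<le> 64 * (exp 12)\<^sup>2 * sd_const * p"
proof -
  have V: "Var (pairs U) (\<lambda>G. F (card U) (num_plus U s G \<tau>)) \<le> 64 * (exp 12)\<^sup>2 * sd_const * p" for \<tau>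
  proof -
    have "Var (pairs U) (\<lambda>G. F (card U) (num_plus U s G \<tau>))
      \<le> (lip (card U))\<^sup>2 * Var (pairs U) (\<lambda>G. real (num_plus U s G \<tau>))"
      using finU cardU by (intro Var_Lipschitz F_Lipschitz num_plus_le) auto
    also have "\<dots> \<le> (lip (card U))\<^sup>2 * (sd_const * real (card U))"
      by (intro mult_left_mono Var_num_plus_le) auto
    also have "(lip (card U))\<^sup>2 = (8 * exp 12 * p)\<^sup>2 / (real (card U) * p)"
      by (simp add: lip_def power_divide)
    also have "(8 * exp 12 * p)\<^sup>2 / (real (card U) * p) * (sd_const * real (card U)) = 64 * (exp 12)\<^sup>2 * sd_const * p"
      using p_pos cardU by (simp add: power2_eq_square)
    finally show ?thesis .
  qed
  show ?thesis
    using Cov_le_Var[of "pairs U" "\<lambda>G. F (card U) (num_plus U s G \<sigma>)" "\<lambda>G. F (card U) (num_plus U s G \<tau>)"]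
      V[of \<sigma>] V[of \<tau>] finU by simp
qed

end

section \<open>The second day\<close>

text \<open>Adjacency of the two observed vertices, plus the Lipschitz constant times the expected
  number of neighbours of the other vertex.\<close>

definition day2_err :: "nat \<Rightarrow> real" where
  "day2_err n = p + lip n * (p * real n)"

lemma day2_err_nonneg: "0 \<le> day2_err n"
  unfolding day2_err_def by (intro add_nonneg_nonneg mult_nonneg_nonneg) auto

context
  fixes s :: "nat \<Rightarrow> int" and V :: "nat set" and n :: nat
  assumes finV: "finite V" and sV: "\<And>u. u \<in> V \<Longrightarrow> s u = 1 \<or> s u = -1" and cardV: "card V = n + 2" and n6: "6 \<le> n"
begin

lemma remove2:
  assumes "v \<in> V" "w \<in> V" "v \<noteq> w"
  shows "finite (V - {v, w})" "v \<notin> V - {v, w}" "w \<notin> V - {v, w}" "insert v (insert w (V - {v, w})) = V"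
    "card (V - {v, w}) = n"
  using assms finV cardV by (auto simp: card_Diff_subset)

lemma day2_plus_bounds: "0 \<le> day2_plus s v E" "day2_plus s v E \<le> 1"
  by (auto simp: day2_plus_def)

lemma expect_day2_plus_ge:
  assumes "v \<in> V" "w \<in> V" "v \<noteq> w"
  shows "expect (pairs (V - {v, w})) (\<lambda>G. F n (num_plus (V - {v, w}) s G (s v))) - day2_err n
    \<le> expect (pairs V) (day2_plus s v)"
proof -
  note r = remove2[OF assms]
  have s': "s u = 1 \<or> s u = -1" if "u \<in> V - {v, w}" for u using sV that by auto
  have "4 \<le> card (V - {v, w})" using r n6 by simp
  from expect_day2_ge[OF r(1-3) assms(3) s' sV[OF assms(1)] sV[OF assms(2)] this] show ?thesis
    unfolding day2_err_def r(4,5) by simp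
qed

text \<open>Twice the error comes from the product of the two means, twice from the joint
  expectation; the last term is the covariance of the two values of \<open>F\<close>.\<close>

lemma Cov_day2_le:
  assumes "v \<in> V" "w \<in> V" "v \<noteq> w"
  shows "Cov (pairs V) (day2_plus s v) (day2_plus s w) \<le> 4 * day2_err n + 64 * (exp 12)\<^sup>2 * sd_const * p"
proof -
  note r = remove2[OF assms]
  let ?U = "V - {v, w}"
  have s': "s u = 1 \<or> s u = -1" if "u \<in> ?U" for u using sV that by auto
  have c4: "4 \<le> card ?U" and c6: "6 \<le> card ?U" using r n6 by simp_all
  let ?F = "\<lambda>\<sigma>. expect (pairs ?U) (\<lambda>G. F n (num_plus ?U s G \<sigma>))"
  have v: "?F (s v) - day2_err n \<le> expect (pairs V) (day2_plus s v)"
    by (rule expect_day2_plus_ge[OF assms])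
  have "expect (pairs (V - {w, v})) (\<lambda>G. F n (num_plus (V - {w, v}) s G (s w))) - day2_err n
    \<le> expect (pairs V) (day2_plus s w)"
    by (rule expect_day2_plus_ge) (use assms in auto)
  then have w: "?F (s w) - day2_err n \<le> expect (pairs V) (day2_plus s w)"
    by (simp add: insert_commute)
  have F01: "0 \<le> ?F \<sigma>" "?F \<sigma> \<le> 1" for \<sigma>
    using r(1) by (auto intro!: expect_nonneg expect_le_const)
  have X01: "0 \<le> expect (pairs V) (day2_plus s u)" "expect (pairs V) (day2_plus s u) \<le> 1" for u
    using finV by (auto intro!: expect_nonneg expect_le_const day2_plus_bounds)
  have "?F (s v) * ?F (s w) - 2 * day2_err n \<le> expect (pairs V) (day2_plus s v) * expect (pairs V) (day2_plus s w)"
    by (rule mult_unit_diff_le[OF F01 F01 X01 X01 v w day2_err_nonneg])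
  moreover have "expect (pairs V) (\<lambda>E. day2_plus s v E * day2_plus s w E)
    \<le> expect (pairs ?U) (\<lambda>G. F n (num_plus ?U s G (s v)) * F n (num_plus ?U s G (s w)))
      + (p + 2 * (lip n * (p * real n)))"
    using expect_day2_product_le[OF r(1-3) assms(3) s' sV[OF assms(1)] sV[OF assms(2)] c4]
    unfolding r(4,5) by simp
  moreover have "Cov (pairs ?U) (\<lambda>G. F n (num_plus ?U s G (s v))) (\<lambda>G. F n (num_plus ?U s G (s w)))
      \<le> 64 * (exp 12)\<^sup>2 * sd_const * p"
    using Cov_F_le[OF r(1) s' c6] unfolding r(5) by simp
  moreover have "p + 2 * (lip n * (p * real n)) \<le> 2 * day2_err n" unfolding day2_err_def by simp
  ultimately show ?thesis unfolding Cov_def by linarith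
qed

lemma Var_day2_le:
  "Var (pairs V) (\<lambda>E. \<Sum>v\<in>V. day2_plus s v E)
    \<le> real (card V) + (real (card V))\<^sup>2 * (4 * day2_err n + 64 * (exp 12)\<^sup>2 * sd_const * p)"
proof -
  define K where "K = 4 * day2_err n + 64 * (exp 12)\<^sup>2 * sd_const * p"
  have K0: "0 \<le> K" unfolding K_def sd_const_def
    by (intro add_nonneg_nonneg mult_nonneg_nonneg day2_err_nonneg) auto
  have "Var (pairs V) (\<lambda>E. \<Sum>v\<in>V. day2_plus s v E) = (\<Sum>v\<in>V. \<Sum>w\<in>V. Cov (pairs V) (day2_plus s v) (day2_plus s w))"
    by (rule Var_sum)
  also have "\<dots> \<le> (\<Sum>v\<in>V. \<Sum>w\<in>V. of_bool (v = w) + K)"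
  proof (intro sum_mono)
    fix v w assume vw: "v \<in> V" "w \<in> V"
    show "Cov (pairs V) (day2_plus s v) (day2_plus s w) \<le> of_bool (v = w) + K"
    proof (cases "v = w")
      case True
      have "expect (pairs V) (\<lambda>E. day2_plus s v E * day2_plus s v E) \<le> 1"
        using finV by (intro expect_le_const) (auto simp: day2_plus_def)
      moreover have "0 \<le> expect (pairs V) (day2_plus s v) * expect (pairs V) (day2_plus s v)" by simp
      ultimately have "Cov (pairs V) (day2_plus s v) (day2_plus s v) \<le> 1" unfolding Cov_def by linarith
      moreover have "of_bool (v = w) = (1::real)" using True by simp
      ultimately show ?thesis using K0 True by simp
    next
      case False
      then show ?thesis using Cov_day2_le[OF vw False] by (simp add: K_def)
    qed
  qed
  also have "\<dots> = real (card V) + (real (card V))\<^sup>2 * K"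
    using finV by (simp add: sum.distrib power2_eq_square algebra_simps)
  finally show ?thesis by (simp add: K_def)
qed

text \<open>The opposite shifts of the two means by the opinion of the observing vertex cancel between
  a \<open>+1\<close> and a \<open>-1\<close> vertex; the surplus of \<open>+1\<close> vertices only helps.\<close>

lemma expect_day2_sum_ge:
  fixes lam :: real and Pn Qn :: nat
  defines "X \<equiv> sqrt (real n * p)"
  defines "L \<equiv> 10 * lam + 64 * exp 12 + 5"
  assumes PQ: "Pn = card {u\<in>V. s u = 1}" "Qn = card {u\<in>V. s u = -1}" "2 \<le> Qn"
     "real Pn - real Qn \<le> 3 * sqrt (real n)" "3 + sqrt (real n) / 2 \<le> real Pn - real Qn"
    and lam: "0 < lam" "sqrt (real n) * p \<le> lam"
    and X: "12 * (4 * L + 2) \<le> X" "32 / gam L \<le> X"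
    and gain: "gain \<le> (gam L)\<^sup>2 * (sqrt (real n) * p) - 4 * exp 12 / X - 2 * (lip n * sqrt (sd_const * real n)) - 2 * day2_err n"
    and gain0: "0 \<le> 1 + gain"
  shows "real (card V) / 2 * (1 + gain) \<le> expect (pairs V) (\<lambda>E. \<Sum>v\<in>V. day2_plus s v E)"
proof -
  define x where "x v = expect (pairs V) (day2_plus s v)" for v
  define VP where "VP = {u\<in>V. s u = 1}"
  define VM where "VM = {u\<in>V. s u = -1}"
  have fin: "finite VP" "finite VM" using finV by (auto simp: VP_def VM_def)
  have dj: "VP \<inter> VM = {}" "VP \<union> VM = V" using sV by (auto simp: VP_def VM_def)
  have cPQ: "card VP = Pn" "card VM = Qn" using PQ by (auto simp: VP_def VM_def)
  have sumPQ: "Pn + Qn = card V" using card_signs[OF finV sV] PQ by simp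
  have PgQ: "Qn \<le> Pn" using PQ(5) real_sqrt_ge_zero[of "real n"] by linarith
  have key: "1 + gain \<le> x v + x w \<and> (1 + gain) / 2 \<le> x v" if v: "v \<in> VP" and w: "w \<in> VM" for v w
  proof -
    have vw: "v \<in> V" "w \<in> V" "v \<noteq> w" and sv: "s v = 1" and sw: "s w = -1"
      using v w by (auto simp: VP_def VM_def)
    note r = remove2[OF vw]
    let ?U = "V - {v, w}"
    have s': "s u = 1 \<or> s u = -1" if "u \<in> ?U" for u using sV that by auto
    have c6: "6 \<le> card ?U" using r n6 by simp
    define P where "P = card {u\<in>?U. s u = 1}"
    define Q where "Q = card {u\<in>?U. s u = -1}"
    have "{u\<in>?U. s u = 1} = VP - {v}" "{u\<in>?U. s u = -1} = VM - {w}"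
      using sv sw by (auto simp: VP_def VM_def)
    \<comment> \<open>Removing one vertex of each opinion leaves the lead unchanged.\<close>
    then have P: "P = Pn - 1" and Q: "Q = Qn - 1"
      using v w fin cPQ by (simp_all add: P_def Q_def card_Diff_singleton)
    have Pn1: "1 \<le> Pn" using PgQ PQ(3) by simp
    have rP: "real P = real Pn - 1" and rQ: "real Q = real Qn - 1" using P Q Pn1 PQ(3) by auto
    have nPQ: "n = P + Q" using P Q Pn1 PQ(3) sumPQ cardV by simp
    let ?e = "\<lambda>\<tau>. expect (pairs ?U) (\<lambda>G. real (num_plus ?U s G \<tau>))"
    have e: "?e \<tau> = real P * GT (P - 1) Q (- \<tau>) + real Q * GT P (Q - 1) (1 - \<tau>)" for \<tau>
      by (rule expect_num_plus[OF r(1) s' c6 P_def Q_def])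
    have "\<exists>b1 b2. b1 \<le> n \<and> b2 \<le> n \<and> real b1 \<le> ?e 1 \<and> real b2 \<le> ?e (-1) \<and>
       1 - 4 * exp 12 / X + (gam L)\<^sup>2 * (sqrt (real n) * p) \<le> F n b1 + F n b2"
      unfolding X_def L_def
    proof (rule F_mean_ge[OF nPQ])
      show "0 < Q" using Q PQ(3) by simp
      show "real P - real Q \<le> 3 * sqrt (real n)" using PQ(4) rP rQ by simp
      show "3 + sqrt (real n) / 2 \<le> real P - real Q" using PQ(5) rP rQ by simp
    qed (use lam X e in \<open>simp_all add: X_def L_def\<close>)
    then obtain b1 b2 where b: "b1 \<le> n" "b2 \<le> n" "real b1 \<le> ?e 1" "real b2 \<le> ?e (-1)"
      "1 - 4 * exp 12 / X + (gam L)\<^sup>2 * (sqrt (real n) * p) \<le> F n b1 + F n b2" by blast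
    let ?F = "\<lambda>\<tau>. expect (pairs ?U) (\<lambda>G. F n (num_plus ?U s G \<tau>))"
    have 1: "F n b1 - lip n * sqrt (sd_const * real n) \<le> ?F 1"
      using expect_F_ge[OF r(1) s' c6, where b = b1 and \<tau> = 1] b unfolding r(5) by simp
    have 2: "F n b2 - lip n * sqrt (sd_const * real n) \<le> ?F (-1)"
      using expect_F_ge[OF r(1) s' c6, where b = b2 and \<tau> = "-1"] b unfolding r(5) by simp
    have 3: "?F (-1) \<le> ?F 1"
      using expect_F_mono[OF r(1) s' c6, where \<sigma> = "-1" and \<tau> = 1] unfolding r(5) by simp
    have 4: "?F 1 - day2_err n \<le> x v"
      using expect_day2_plus_ge[OF vw] sv by (simp add: x_def)
    have 5: "?F (-1) - day2_err n \<le> x w"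
      using expect_day2_plus_ge[OF vw(2,1) vw(3)[symmetric]] sw by (simp add: x_def insert_commute)
    show ?thesis using 1 2 3 4 5 b(5) gain by auto
  qed
  obtain w0 where w0: "w0 \<in> VM" using cPQ(2) PQ(3) by (cases "VM = {}") auto
  have half: "(1 + gain) / 2 \<le> x v" if "v \<in> VP" for v using key[OF that w0] by simp
  define SP where "SP = (\<Sum>v\<in>VP. x v)"
  define SM where "SM = (\<Sum>w\<in>VM. x w)"
  \<comment> \<open>All mixed pairs are summed: each \<open>+1\<close> vertex is counted
    \<open>Qn\<close> times, each \<open>-1\<close> vertex \<open>Pn\<close> times. The missing
    \<open>Pn - Qn\<close> copies of \<open>SP\<close> are supplied by \<open>half\<close>.\<close>
  have "(\<Sum>v\<in>VP. \<Sum>w\<in>VM. 1 + gain) \<le> (\<Sum>v\<in>VP. \<Sum>w\<in>VM. x v + x w)"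
    using key by (intro sum_mono) auto
  also have "\<dots> = real Qn * SP + real Pn * SM"
    by (simp add: sum.distrib sum_distrib_left cPQ SP_def SM_def)
  finally have A: "real Pn * real Qn * (1 + gain) \<le> real Qn * SP + real Pn * SM"
    by (simp add: cPQ mult.assoc)
  have "(\<Sum>v\<in>VP. (1 + gain) / 2) \<le> SP" unfolding SP_def using half by (intro sum_mono) auto
  then have "real Pn * (1 + gain) \<le> 2 * SP" by (simp add: cPQ)
  then have B: "(real Pn - real Qn) * (real Pn * (1 + gain)) \<le> (real Pn - real Qn) * (2 * SP)"
    using PgQ by (intro mult_left_mono) auto
  have "real Pn * ((real Pn + real Qn) / 2 * (1 + gain)) \<le> real Pn * (SP + SM)"
    using A B by (simp add: field_simps)
  moreover have "0 < real Pn" using PgQ PQ(3) by simp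
  ultimately have "(real Pn + real Qn) / 2 * (1 + gain) \<le> SP + SM" by (rule mult_left_le_imp_le)
  moreover have "expect (pairs V) (\<lambda>E. \<Sum>v\<in>V. day2_plus s v E) = SP + SM"
    unfolding expect_sum SP_def SM_def x_def dj(2)[symmetric]
    by (rule sum.union_disjoint[OF fin dj(1)])
  moreover have "real (card V) = real Pn + real Qn" using sumPQ by (metis of_nat_add)
  ultimately show ?thesis by simp
qed

end

section \<open>Expansion of the majority\<close>

lemma expect_union_bound:
  assumes "finite I"
  shows "expect A (\<lambda>E. of_bool (\<exists>i\<in>I. Q i E)) \<le> (\<Sum>i\<in>I. expect A (\<lambda>E. of_bool (Q i E)))"
  unfolding expect_sum[symmetric]
proof (rule expect_mono)
  fix E
  show "of_bool (\<exists>i\<in>I. Q i E) \<le> (\<Sum>i\<in>I. of_bool (Q i E) :: real)"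
  proof (cases "\<exists>i\<in>I. Q i E")
    case True
    then obtain i where i: "i \<in> I" "Q i E" by blast
    have "(of_bool (Q i E) :: real) \<le> (\<Sum>i\<in>I. of_bool (Q i E))"
      by (rule member_le_sum) (use i assms in auto)
    then show ?thesis using True i by simp
  qed (simp add: sum_nonneg)
qed

text \<open>A Chernoff bound for the sum of the scores over \<open>C\<close>. An edge inside
  \<open>C\<close> is counted in both directions, so edges carry weights \<open>w e\<close> of size
  at most \<open>k e \<le> 2\<close>. Leaving out \<open>v\<close> itself lowers the lead by at most
  1, which the hypothesis \<open>1 \<le> D * card V\<close> absorbs.\<close>

lemma expect_score_nonpos_le:
  assumes V: "finite V" "C \<subseteq> V" and s: "\<And>x. x \<in> V \<Longrightarrow> s x = 1 \<or> s x = (-1::int)"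
    and D: "0 < D" "D \<le> 1" "1 \<le> D * real (card V)"
    and m: "2 * D * real (card V) \<le> real_of_int (\<Sum>x\<in>V. s x)"
  shows "expect (pairs V) (\<lambda>E. of_bool (\<forall>v\<in>C. score s E v \<le> 0))
    \<le> exp (- p * real (card C) * D\<^sup>2 * real (card V) / 8)"
proof -
  define n where "n = real (card V)"
  \<comment> \<open>The minimum of \<open>- \<theta> * D + 2 * \<theta>^2\<close>, with value
    \<open>- D^2 / 8\<close>.\<close>
  define \<theta> where "\<theta> = D / 4"
  define J where "J = C \<times> V"
  define h where "h z = {snd z, fst z}" for z :: "nat \<times> nat"
  define w where "w e = (\<Sum>z\<in>J. of_bool (h z = e) * real_of_int (s (snd z)))" for e
  define k where "k e = (\<Sum>z\<in>J. of_bool (h z = e) :: real)" for e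
  have fin: "finite J" "finite C" "finite (pairs V)"
    using V finite_subset[OF V(2,1)] by (auto simp: J_def)
  have T: "(\<Sum>v\<in>C. real_of_int (score s E v)) = (\<Sum>e\<in>E. w e)" if E: "E \<subseteq> pairs V" for E
  proof -
    have finE: "finite E" using E fin(3) by (rule finite_subset)
    have "real_of_int (score s E v) = (\<Sum>x\<in>V. of_bool ({x, v} \<in> E) * real_of_int (s x))" for v
    proof -
      have "neighbours E v = {x\<in>V. {x, v} \<in> E}"
        using neighbours_subset(1)[OF E, of v] by (auto simp: neighbours_def)
      then have "score s E v = (\<Sum>x\<in>V. if {x, v} \<in> E then s x else 0)"
        unfolding score_def by (simp only: sum.inter_filter[OF V(1)])
      then have "real_of_int (score s E v) = (\<Sum>x\<in>V. real_of_int (if {x, v} \<in> E then s x else 0))"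
        by (simp only: of_int_sum)
      also have "\<dots> = (\<Sum>x\<in>V. of_bool ({x, v} \<in> E) * real_of_int (s x))"
        by (rule sum.cong) auto
      finally show ?thesis .
    qed
    then have "(\<Sum>v\<in>C. real_of_int (score s E v)) = (\<Sum>z\<in>J. of_bool (h z \<in> E) * real_of_int (s (snd z)))"
      unfolding J_def h_def by (simp add: sum.cartesian_product case_prod_unfold)
    also have "\<dots> = (\<Sum>z\<in>J. \<Sum>e\<in>E. of_bool (h z = e) * real_of_int (s (snd z)))"
    proof (rule sum.cong[OF refl])
      fix z
      show "of_bool (h z \<in> E) * real_of_int (s (snd z)) = (\<Sum>e\<in>E. of_bool (h z = e) * real_of_int (s (snd z)))"
        using finE by (simp add: sum_distrib_right[symmetric] of_bool_def)
    qed
    also have "\<dots> = (\<Sum>e\<in>E. w e)"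
      unfolding w_def by (rule sum.swap)
    finally show ?thesis .
  qed
  have hV: "h z \<in> pairs V \<longleftrightarrow> fst z \<noteq> snd z" if "z \<in> J" for z
    using that V(2) by (auto simp: h_def J_def pairs_def card_insert_if)
  have total: "(\<Sum>e\<in>pairs V. \<Sum>z\<in>J. of_bool (h z = e) * g z) = (\<Sum>z\<in>J. of_bool (fst z \<noteq> snd z) * g z)"
    for g :: "nat \<times> nat \<Rightarrow> real"
  proof -
    have "(\<Sum>e\<in>pairs V. \<Sum>z\<in>J. of_bool (h z = e) * g z) = (\<Sum>z\<in>J. \<Sum>e\<in>pairs V. of_bool (h z = e) * g z)"
      by (rule sum.swap)
    also have "\<dots> = (\<Sum>z\<in>J. of_bool (fst z \<noteq> snd z) * g z)"
    proof (rule sum.cong[OF refl])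
      fix z assume "z \<in> J"
      then show "(\<Sum>e\<in>pairs V. of_bool (h z = e) * g z) = of_bool (fst z \<noteq> snd z) * g z"
        using hV[of z] fin(3) by (simp add: sum_distrib_right[symmetric] of_bool_def)
    qed
    finally show ?thesis .
  qed
  have sumw: "real (card C) * (D * n) \<le> (\<Sum>e\<in>pairs V. w e)"
  proof -
    have "(\<Sum>e\<in>pairs V. w e) = (\<Sum>v\<in>C. \<Sum>x\<in>V. of_bool (v \<noteq> x) * real_of_int (s x))"
      unfolding w_def total by (simp add: J_def sum.cartesian_product case_prod_unfold)
    also have "\<dots> \<ge> (\<Sum>v\<in>C. D * n)"
    proof (rule sum_mono)
      fix v assume v: "v \<in> C"
      have "(\<Sum>x\<in>V. of_bool (v \<noteq> x) * real_of_int (s x)) = (\<Sum>x\<in>V. real_of_int (s x) - (if v = x then real_of_int (s x) else 0))"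
        by (rule sum.cong) auto
      also have "\<dots> = real_of_int (\<Sum>x\<in>V. s x) - real_of_int (s v)"
        using v V by (auto simp: sum_subtractf)
      also have "\<dots> \<ge> D * n"
      proof -
        have "v \<in> V" using v V by blast
        then have "real_of_int (s v) \<le> 1" using s[of v] by auto
        then show ?thesis using m D(3) unfolding n_def by linarith
      qed
      finally show "D * n \<le> (\<Sum>x\<in>V. of_bool (v \<noteq> x) * real_of_int (s x))" .
    qed
    finally show ?thesis by simp
  qed
  have sumk: "(\<Sum>e\<in>pairs V. k e) \<le> real (card C) * n"
  proof -
    have "(\<Sum>e\<in>pairs V. k e) = (\<Sum>z\<in>J. of_bool (fst z \<noteq> snd z) :: real)"
      using total[of "\<lambda>_. 1"] by (simp add: k_def)
    also have "\<dots> \<le> (\<Sum>z\<in>J. 1)" by (intro sum_mono) auto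
    also have "\<dots> = real (card C) * n" by (simp add: J_def n_def card_cartesian_product)
    finally show ?thesis .
  qed
  have k2: "k e \<le> 2" if "e \<in> pairs V" for e
  proof -
    have "card e = 2" using that by (simp add: pairs_def)
    then obtain a b where e: "e = {a, b}" "a \<noteq> b" by (meson card_2_iff)
    define S where "S = {(a, b), (b, a)}"
    have "k e \<le> (\<Sum>z\<in>J. of_bool (z \<in> S))"
      unfolding k_def
    proof (rule sum_mono)
      fix z
      have "z \<in> S" if "h z = e"
        using that unfolding e(1) by (cases z) (auto simp: h_def S_def doubleton_eq_iff)
      then show "of_bool (h z = e) \<le> (of_bool (z \<in> S) :: real)" by auto
    qed
    also have "\<dots> = real (card (J \<inter> {z. z \<in> S}))" by (intro sum_of_bool_eq fin)
    also have "\<dots> \<le> real (card S)"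
    proof -
      have "finite S" unfolding S_def by simp
      then have "card (J \<inter> {z. z \<in> S}) \<le> card S" by (rule card_mono) auto
      then show ?thesis by simp
    qed
    also have "\<dots> \<le> 2"
    proof -
      have "card S \<le> Suc (card {(b, a)})" unfolding S_def by (rule card_insert_le_m1) auto
      then show ?thesis by simp
    qed
    finally show ?thesis .
  qed
  have wk: "\<bar>w e\<bar> \<le> k e" for e
  proof -
    have "\<bar>w e\<bar> \<le> (\<Sum>z\<in>J. \<bar>of_bool (h z = e) * real_of_int (s (snd z))\<bar>)"
      unfolding w_def by (rule sum_abs)
    also have "\<dots> \<le> k e" unfolding k_def
    proof (rule sum_mono)
      fix z assume "z \<in> J"
      then have "snd z \<in> V" by (auto simp: J_def)
      then have "s (snd z) = 1 \<or> s (snd z) = -1" by (rule s)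
      then show "\<bar>of_bool (h z = e) * real_of_int (s (snd z))\<bar> \<le> of_bool (h z = e)" by auto
    qed
    finally show ?thesis .
  qed
  have th: "0 < \<theta>" "\<theta> \<le> 1/4" using D by (auto simp: \<theta>_def)
  have one: "p * exp (- \<theta> * w e) + (1 - p) \<le> exp (p * (- \<theta> * w e + 2 * \<theta>\<^sup>2 * k e))" if e: "e \<in> pairs V" for e
  proof -
    have kk: "0 \<le> k e" "k e \<le> 2" using k2[OF e] by (auto simp: k_def intro: sum_nonneg)
    have w2: "(w e)\<^sup>2 \<le> 2 * k e"
    proof -
      have "\<bar>w e\<bar>\<^sup>2 \<le> (k e)\<^sup>2" using wk by (intro power_mono) auto
      also have "\<dots> \<le> 2 * k e" unfolding power2_eq_square using kk by (intro mult_right_mono) auto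
      finally show ?thesis by simp
    qed
    have "\<bar>\<theta> * w e\<bar> \<le> 1/4 * 2"
      unfolding abs_mult using th wk[of e] kk by (intro mult_mono) auto
    then have "exp (- \<theta> * w e) \<le> 1 + (- \<theta> * w e) + (- \<theta> * w e)\<^sup>2"
      by (intro exp_le_quadratic) auto
    also have "(- \<theta> * w e)\<^sup>2 = \<theta>\<^sup>2 * (w e)\<^sup>2" by (simp add: power_mult_distrib)
    also have "1 + (- \<theta> * w e) + \<theta>\<^sup>2 * (w e)\<^sup>2 \<le> 1 + (- \<theta> * w e) + \<theta>\<^sup>2 * (2 * k e)"
      using w2 by (intro add_left_mono mult_left_mono) auto
    finally have "p * exp (- \<theta> * w e) \<le> p * (1 + (- \<theta> * w e) + \<theta>\<^sup>2 * (2 * k e))"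
      by (rule mult_left_mono) simp
    then have "p * exp (- \<theta> * w e) + (1 - p) \<le> 1 + p * (- \<theta> * w e + 2 * \<theta>\<^sup>2 * k e)"
      by (simp add: algebra_simps)
    also have "\<dots> \<le> exp (p * (- \<theta> * w e + 2 * \<theta>\<^sup>2 * k e))" by (rule exp_ge_add_one_self)
    finally show ?thesis .
  qed
  have "expect (pairs V) (\<lambda>E. of_bool (\<forall>v\<in>C. score s E v \<le> 0)) \<le> expect (pairs V) (\<lambda>E. \<Prod>e\<in>E. exp (- \<theta> * w e))"
  proof (rule expect_mono)
    fix E assume E: "E \<subseteq> pairs V"
    then have finE: "finite E" using fin finite_subset by blast
    have eq: "(\<Prod>e\<in>E. exp (- \<theta> * w e)) = exp (- \<theta> * (\<Sum>v\<in>C. real_of_int (score s E v)))"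
      unfolding T[OF E] using finE by (simp add: exp_sum sum_distrib_left)
    show "of_bool (\<forall>v\<in>C. score s E v \<le> 0) \<le> (\<Prod>e\<in>E. exp (- \<theta> * w e))"
    proof (cases "\<forall>v\<in>C. score s E v \<le> 0")
      case True
      then have "(\<Sum>v\<in>C. real_of_int (score s E v)) \<le> 0" by (intro sum_nonpos) auto
      then have "0 \<le> - \<theta> * (\<Sum>v\<in>C. real_of_int (score s E v))"
        using th by (simp add: mult_nonneg_nonpos)
      then show ?thesis unfolding eq by simp
    next
      case False
      then have "of_bool (\<forall>v\<in>C. score s E v \<le> 0) = (0::real)" by (simp only: of_bool_eq)
      then show ?thesis by (simp only:) (intro prod_nonneg ballI exp_ge_zero)
    qed
  qed
  also have "\<dots> = (\<Prod>e\<in>pairs V. p * exp (- \<theta> * w e) + (1 - p))"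
    by (rule expect_prod[OF fin(3)])
  also have "\<dots> \<le> (\<Prod>e\<in>pairs V. exp (p * (- \<theta> * w e + 2 * \<theta>\<^sup>2 * k e)))"
  proof (rule prod_mono)
    fix e assume e: "e \<in> pairs V"
    have "0 \<le> p * exp (- \<theta> * w e) + (1 - p)" by (intro add_nonneg_nonneg mult_nonneg_nonneg) auto
    then show "0 \<le> p * exp (- \<theta> * w e) + (1 - p) \<and>
        p * exp (- \<theta> * w e) + (1 - p) \<le> exp (p * (- \<theta> * w e + 2 * \<theta>\<^sup>2 * k e))"
      using one[OF e] by (rule conjI)
  qed
  also have "\<dots> = exp (\<Sum>e\<in>pairs V. p * (- \<theta> * w e + 2 * \<theta>\<^sup>2 * k e))"
    by (rule exp_sum[OF fin(3), symmetric])
  also have "(\<Sum>e\<in>pairs V. p * (- \<theta> * w e + 2 * \<theta>\<^sup>2 * k e))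
      = p * (- \<theta> * (\<Sum>e\<in>pairs V. w e) + 2 * \<theta>\<^sup>2 * (\<Sum>e\<in>pairs V. k e))"
    unfolding sum_distrib_left sum.distrib[symmetric] ..
  also have "exp (p * (- \<theta> * (\<Sum>e\<in>pairs V. w e) + 2 * \<theta>\<^sup>2 * (\<Sum>e\<in>pairs V. k e)))
      \<le> exp (- p * real (card C) * D\<^sup>2 * n / 8)"
  proof -
    have "\<theta> * (real (card C) * (D * n)) \<le> \<theta> * (\<Sum>e\<in>pairs V. w e)"
      using sumw th by (intro mult_left_mono) auto
    moreover have "2 * \<theta>\<^sup>2 * (\<Sum>e\<in>pairs V. k e) \<le> 2 * \<theta>\<^sup>2 * (real (card C) * n)"
      using sumk by (intro mult_left_mono) auto
    ultimately have "- \<theta> * (\<Sum>e\<in>pairs V. w e) + 2 * \<theta>\<^sup>2 * (\<Sum>e\<in>pairs V. k e)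
      \<le> - \<theta> * (real (card C) * (D * n)) + 2 * \<theta>\<^sup>2 * (real (card C) * n)" by linarith
    also have "\<dots> = - (real (card C) * D\<^sup>2 * n / 8)"
      by (simp add: \<theta>_def power2_eq_square field_simps)
    finally have "p * (- \<theta> * (\<Sum>e\<in>pairs V. w e) + 2 * \<theta>\<^sup>2 * (\<Sum>e\<in>pairs V. k e))
      \<le> p * - (real (card C) * D\<^sup>2 * n / 8)" by (rule mult_left_mono) simp
    then show ?thesis by simp
  qed
  finally show ?thesis by (simp add: n_def)
qed

lemma expect_stuck_le:
  assumes V: "finite V" "C \<subseteq> V" "B \<subseteq> V"
    and D: "0 < D" "D \<le> 1" "1 \<le> D * real (card V)" "2 * D * real (card V) \<le> real (card V) - 2 * real (card B)"
  shows "expect (pairs V) (\<lambda>E. of_bool (stuck B C E)) \<le> exp (- p * real (card C) * D\<^sup>2 * real (card V) / 8)"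
  unfolding stuck_def
  by (rule expect_score_nonpos_le) (use assms sum_signs[OF V(1,3)] in \<open>auto simp: signs_def\<close>)

text \<open>The union over \<open>B\<close> and \<open>C\<close> has \<open>4 ^ card V\<close>
  terms, and \<open>C\<close> is at least a tenth of the vertices, whence
  \<open>80 = 8 * 10\<close>.\<close>

lemma expect_stuck_large:
  assumes V: "finite V" and D: "0 < D" "D \<le> 1" "1 \<le> D * real (card V)"
  shows "expect (pairs V) (\<lambda>E. of_bool (stuck_large V D E))
    \<le> 4 ^ card V * exp (- p * D\<^sup>2 * (real (card V))\<^sup>2 / 80)"
proof -
  define n where "n = real (card V)"
  define M where "M = exp (- p * D\<^sup>2 * n\<^sup>2 / 80)"
  let ?Q = "\<lambda>B C E. 2 * D * n \<le> n - 2 * real (card B) \<and> n \<le> 10 * real (card C) \<and> stuck B C E"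
  have "expect (pairs V) (\<lambda>E. of_bool (?Q B C E)) \<le> M" if BC: "B \<in> Pow V" "C \<in> Pow V" for B C
  proof (cases "2 * D * n \<le> n - 2 * real (card B) \<and> n \<le> 10 * real (card C)")
    case True
    then have "expect (pairs V) (\<lambda>E. of_bool (?Q B C E)) = expect (pairs V) (\<lambda>E. of_bool (stuck B C E))" by simp
    also have "\<dots> \<le> exp (- p * real (card C) * D\<^sup>2 * n / 8)"
      unfolding n_def by (rule expect_stuck_le) (use True BC V D in \<open>auto simp: n_def\<close>)
    also have "\<dots> \<le> M"
    proof -
      have "n * (p * D\<^sup>2 * n) \<le> 10 * real (card C) * (p * D\<^sup>2 * n)"
        using True by (intro mult_right_mono mult_nonneg_nonneg) (auto simp: n_def)
      then show ?thesis unfolding M_def by (simp add: power2_eq_square field_simps)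
    qed
    finally show ?thesis .
  next
    case False
    then have "expect (pairs V) (\<lambda>E. of_bool (?Q B C E)) = expect (pairs V) (\<lambda>E. 0)"
      by (intro expect_cong) auto
    then show ?thesis using V by (simp add: M_def)
  qed
  then have "(\<Sum>B\<in>Pow V. \<Sum>C\<in>Pow V. expect (pairs V) (\<lambda>E. of_bool (?Q B C E))) \<le> (\<Sum>B\<in>Pow V. \<Sum>C\<in>Pow V. M)"
    by (intro sum_mono) auto
  also have "\<dots> = 2 ^ card V * 2 ^ card V * M" using V by (simp add: card_Pow)
  also have "\<dots> = 4 ^ card V * M" by (simp flip: power_mult_distrib)
  finally have 1: "(\<Sum>B\<in>Pow V. \<Sum>C\<in>Pow V. expect (pairs V) (\<lambda>E. of_bool (?Q B C E))) \<le> 4 ^ card V * M" .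
  have "expect (pairs V) (\<lambda>E. of_bool (\<exists>B\<in>Pow V. \<exists>C\<in>Pow V. ?Q B C E))
    \<le> (\<Sum>B\<in>Pow V. expect (pairs V) (\<lambda>E. of_bool (\<exists>C\<in>Pow V. ?Q B C E)))"
    using V by (intro expect_union_bound) auto
  also have "\<dots> \<le> (\<Sum>B\<in>Pow V. \<Sum>C\<in>Pow V. expect (pairs V) (\<lambda>E. of_bool (?Q B C E)))"
    using V by (intro sum_mono expect_union_bound) auto
  also note 1
  finally show ?thesis by (simp add: n_def M_def stuck_large_def)
qed

text \<open>For \<open>card B \<le> 2 * card C\<close> the weight
  \<open>(1 / n) ^ card B * n ^ (2 * card C)\<close> is at least 1. With it the double sum
  factorizes: the sum over \<open>B\<close> is \<open>(1 + 1 / n) ^ n \<le> exp 1\<close>, and the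
  sum over nonempty \<open>C\<close> is \<open>(1 + n^2 * y) ^ n - 1\<close>.\<close>

lemma expect_stuck_small:
  assumes V: "finite V" and n: "10 \<le> card V"
  shows "expect (pairs V) (\<lambda>E. of_bool (stuck_small V E))
    \<le> exp 1 * (exp ((real (card V)) ^ 3 * exp (- p * real (card V) / 50)) - 1)"
proof -
  define n where "n = real (card V)"
  have n0: "10 \<le> n" using n by (simp add: n_def)
  define y where "y = exp (- p * n / 50)"
  have y0: "0 < y" by (simp add: y_def)
  let ?Q = "\<lambda>B C E. C \<noteq> {} \<and> 10 * real (card B) \<le> n \<and> card B \<le> 2 * card C \<and> stuck B C E"
  have one: "expect (pairs V) (\<lambda>E. of_bool (?Q B C E)) \<le> of_bool (C \<noteq> {}) * ((1 / n) ^ card B * (n\<^sup>2 * y) ^ card C)"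
    if BC: "B \<in> Pow V" "C \<in> Pow V" for B C
  proof (cases "C \<noteq> {} \<and> 10 * real (card B) \<le> n \<and> card B \<le> 2 * card C")
    case True
    then have "expect (pairs V) (\<lambda>E. of_bool (?Q B C E)) = expect (pairs V) (\<lambda>E. of_bool (stuck B C E))" by simp
    \<comment> \<open>A minority of at most a tenth leaves a lead of \<open>4/5 * n\<close>, so
      \<open>D = 2/5\<close> is admissible, and \<open>D^2 / 8 = 1/50\<close>.\<close>
    also have "\<dots> \<le> exp (- p * real (card C) * (2/5)\<^sup>2 * n / 8)"
      unfolding n_def by (rule expect_stuck_le) (use True BC V n0 in \<open>auto simp: n_def\<close>)
    also have "- p * real (card C) * (2/5)\<^sup>2 * n / 8 = real (card C) * (- p * n / 50)"
      by (simp add: power2_eq_square)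
    also have "exp (real (card C) * (- p * n / 50)) = 1 * y ^ card C" by (simp only: exp_of_nat_mult y_def mult_1)
    also have "\<dots> \<le> ((1 / n) ^ card B * n ^ (2 * card C)) * y ^ card C"
    proof (rule mult_right_mono)
      have "n ^ card B \<le> n ^ (2 * card C)" using True n0 by (intro power_increasing) auto
      then show "1 \<le> (1 / n) ^ card B * n ^ (2 * card C)"
        using n0 unfolding power_one_over by (simp add: le_divide_eq_1_pos)
    qed (use y0 in auto)
    also have "\<dots> = of_bool (C \<noteq> {}) * ((1 / n) ^ card B * (n\<^sup>2 * y) ^ card C)"
      unfolding power_mult_distrib power_mult using True by simp
    finally show ?thesis .
  next
    case False
    then have "expect (pairs V) (\<lambda>E. of_bool (?Q B C E)) = expect (pairs V) (\<lambda>E. 0)"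
      by (intro expect_cong) auto
    then show ?thesis using V y0 n0 by simp
  qed
  have "expect (pairs V) (\<lambda>E. of_bool (\<exists>C\<in>Pow V. \<exists>B\<in>Pow V. ?Q B C E))
    \<le> (\<Sum>C\<in>Pow V. expect (pairs V) (\<lambda>E. of_bool (\<exists>B\<in>Pow V. ?Q B C E)))"
    using V by (intro expect_union_bound) auto
  also have "\<dots> \<le> (\<Sum>C\<in>Pow V. \<Sum>B\<in>Pow V. expect (pairs V) (\<lambda>E. of_bool (?Q B C E)))"
    using V by (intro sum_mono expect_union_bound) auto
  also have "\<dots> \<le> (\<Sum>C\<in>Pow V. \<Sum>B\<in>Pow V. of_bool (C \<noteq> {}) * ((1 / n) ^ card B * (n\<^sup>2 * y) ^ card C))"
    using one by (intro sum_mono) auto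
  also have "\<dots> = (\<Sum>C\<in>Pow V. of_bool (C \<noteq> {}) * (n\<^sup>2 * y) ^ card C * (\<Sum>B\<in>Pow V. (1 / n) ^ card B))"
    unfolding sum_distrib_left by (intro sum.cong refl) (simp only: mult_ac)
  also have "\<dots> = (1 + 1 / n) ^ card V * (\<Sum>C\<in>Pow V. of_bool (C \<noteq> {}) * (n\<^sup>2 * y) ^ card C)"
    unfolding sum_power_card[OF V] sum_distrib_left by (intro sum.cong refl) (simp only: mult_ac)
  also have "(\<Sum>C\<in>Pow V. of_bool (C \<noteq> {}) * (n\<^sup>2 * y) ^ card C) = (1 + n\<^sup>2 * y) ^ card V - 1"
  proof -
    have "(\<Sum>C\<in>Pow V. of_bool (C \<noteq> {}) * (n\<^sup>2 * y) ^ card C)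
      = (\<Sum>C\<in>Pow V. (n\<^sup>2 * y) ^ card C - (if {} = C then 1 else 0))"
      by (rule sum.cong) auto
    also have "\<dots> = (\<Sum>C\<in>Pow V. (n\<^sup>2 * y) ^ card C) - (\<Sum>C\<in>Pow V. if {} = C then 1 else 0)"
      by (rule sum_subtractf)
    also have "(\<Sum>C\<in>Pow V. if {} = C then 1 else 0) = (1::real)"
      by (simp add: sum.delta' V)
    finally show ?thesis using sum_power_card[OF V] by simp
  qed
  also have "(1 + 1 / n) ^ card V * ((1 + n\<^sup>2 * y) ^ card V - 1) \<le> exp 1 * (exp (n ^ 3 * y) - 1)"
  proof (rule mult_mono)
    have pw: "(1 + t) ^ card V \<le> exp (n * t)" if "0 \<le> t" for t
    proof -
      have "(1 + t) ^ card V \<le> exp t ^ card V" using that by (intro power_mono exp_ge_add_one_self) auto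
      then show ?thesis by (simp add: n_def exp_of_nat_mult)
    qed
    show "(1 + 1 / n) ^ card V \<le> exp 1" using pw[of "1 / n"] n0 by simp
    have e: "n * (n\<^sup>2 * y) = n ^ 3 * y" by (simp add: power2_eq_square power3_eq_cube)
    have "0 \<le> n\<^sup>2 * y" using y0 by simp
    from pw[OF this] have "(1 + n\<^sup>2 * y) ^ card V \<le> exp (n ^ 3 * y)" unfolding e .
    then show "(1 + n\<^sup>2 * y) ^ card V - 1 \<le> exp (n ^ 3 * y) - 1" by simp
    show "0 \<le> (1 + n\<^sup>2 * y) ^ card V - 1" using y0 by (simp add: one_le_power)
  qed simp
  finally show ?thesis by (simp add: n_def y_def stuck_small_def)
qed

section \<open>Unanimity from a fixed initial opinion\<close>

lemma unanimity_if_good: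
  assumes V: "finite V" and E: "E \<subseteq> pairs V" and s: "\<And>u. u \<in> V \<Longrightarrow> s u = 1 \<or> s u = (-1::int)"
    and day2: "real (card V) / 2 + D * real (card V) \<le> (\<Sum>v\<in>V. day2_plus s v E)"
    and large: "\<not> stuck_large V D E"
    and small: "\<not> stuck_small V E"
  shows "\<exists>t. \<forall>v\<in>V. majority_dynamics E s t v = 1"
proof -
  let ?s2 = "majority_dynamics E s 2"
  let ?B = "{u\<in>V. ?s2 u = -1}"
  let ?s3 = "majority_dynamics E ?s2 1"
  let ?C = "{u\<in>V. ?s3 u = -1}"
  have s2: "?s2 u = 1 \<or> ?s2 u = -1" if "u \<in> V" for u
    by (rule majority_values[OF s that])
  have s3: "?s3 u = 1 \<or> ?s3 u = -1" if "u \<in> V" for u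
    by (rule majority_values[OF s2 that])
  have "(\<Sum>v\<in>V. day2_plus s v E) \<le> (\<Sum>v\<in>V. of_bool (?s2 v = 1))"
  proof (rule sum_mono)
    fix v assume "v \<in> V"
    have "?s2 v = maj (score (majority_dynamics E s 1) E v) (majority_dynamics E s 1 v)"
      using majority_dynamics_Suc[of E s 1 v] by (simp add: numeral_2_eq_2)
    then show "day2_plus s v E \<le> of_bool (?s2 v = 1)" by (auto simp: day2_plus_def maj_def)
  qed
  also have "\<dots> = real (card {u\<in>V. ?s2 u = 1})" by (rule real_card_eq_sum[OF V, symmetric])
  also have "\<dots> = real (card V) - real (card ?B)"
  proof -
    have "card {u\<in>V. ?s2 u = 1} + card ?B = card V" using V s2 by (rule card_signs)
    then show ?thesis by linarith
  qed
  finally have "2 * D * real (card V) \<le> real (card V) - 2 * real (card ?B)"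
    using day2 by (simp add: algebra_simps)
  moreover have "stuck ?B ?C E" by (rule majority_step_stuck[OF E s2])
  moreover have B: "?B \<in> Pow V" and C: "?C \<in> Pow V" by auto
  ultimately have "stuck_large V D E"
    if "real (card V) \<le> 10 * real (card ?C)"
    unfolding stuck_large_def using that by (intro bexI[OF _ B] bexI[OF _ C] conjI)
  then have "\<not> real (card V) \<le> 10 * real (card ?C)" using large by argo
  then have C10: "10 * card ?C \<le> card V" by linarith
  have ok: "\<not> stuck B C E"
    if "B \<subseteq> V" "C \<subseteq> V" "C \<noteq> {}" "10 * card B \<le> card V" "card B \<le> 2 * card C" for B C
  proof
    assume st: "stuck B C E"
    have r: "10 * real (card B) \<le> real (card V)" using that(4) by linarith
    have BC: "B \<in> Pow V" "C \<in> Pow V" using that by auto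
    have "stuck_small V E"
      unfolding stuck_small_def by (rule bexI[OF _ BC(2)], rule bexI[OF _ BC(1)]) (intro conjI that r st)
    with small show False by argo
  qed
  have "\<exists>t. \<forall>v\<in>V. majority_dynamics E ?s3 t v = 1"
  proof (rule unanimity_of_small_minority[OF V E _ C10])
    show "?s3 u = 1 \<or> ?s3 u = -1" if "u \<in> V" for u by (rule s3[OF that])
  qed (rule ok)
  then show ?thesis unfolding majority_dynamics_shift[symmetric] by blast
qed

text \<open>Here \<open>n\<close> counts the vertices other than two observed ones. The three terms
  bound the failure of the lead on day 2, of the step to day 3, and of the later shrinking.\<close>

lemma expect_not_unanimous_le:
  fixes lam :: real and n :: nat
  defines "X \<equiv> sqrt (real n * p)"
  assumes V: "finite V" "card V = n + 2" "8 \<le> n"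
    and s: "\<And>u. u \<in> V \<Longrightarrow> s u = 1 \<or> s u = (-1::int)"
    and PQ: "2 \<le> card {u\<in>V. s u = -1}"
     "real (card {u\<in>V. s u = 1}) - real (card {u\<in>V. s u = -1}) \<le> 3 * sqrt (real n)"
     "3 + sqrt (real n) / 2 \<le> real (card {u\<in>V. s u = 1}) - real (card {u\<in>V. s u = -1})"
    and lam: "0 < lam" "sqrt (real n) * p \<le> lam"
    and X: "threshold lam \<le> X" "threshold lam \<le> sqrt (real n) * p * X"
  shows "expect (pairs V) (\<lambda>E. of_bool (\<not> (\<exists>t. \<forall>v\<in>V. majority_dynamics E s t v = 1)))
    \<le> var_const lam / X + exp (- real (card V))
      + exp 1 * (exp ((real (card V)) ^ 3 * exp (- p * real (card V) / 50)) - 1)"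
proof -
  define N where "N = real (card V)"
  define q where "q = sqrt (real n) * p"
  define \<gamma> where "\<gamma> = lead_const lam"
  define g where "g = \<gamma>\<^sup>2 * q / 2"
  define e12 where "e12 = exp (12::real)"
  note th = threshold_ge[OF lam(1), folded \<gamma>_def e12_def]
  have \<gamma>: "0 < \<gamma>" "\<gamma> \<le> 1" using lead_const_bounds by (auto simp: \<gamma>_def)
  have e12: "0 < e12" by (simp add: e12_def)
  have X1: "1 \<le> X" using th(1) X(1) by linarith
  have n0: "0 < real n" "8 \<le> real n" using V(3) by auto
  have q0: "0 < q" using n0 p_pos by (simp add: q_def)
  have qlam: "q \<le> lam" using lam by (simp add: q_def)
  have XX: "X\<^sup>2 = real n * p" by (simp add: X_def)
  have "(sqrt (real n))\<^sup>2 = real n" by simp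
  then have q2: "q\<^sup>2 = X\<^sup>2 * p" unfolding q_def XX power_mult_distrib by (simp add: power2_eq_square)
  have nN: "real n \<le> N" using V(2) by (simp add: N_def)
  have Xn: "X \<le> sqrt (real n)"
  proof -
    have "real n * p \<le> real n * 1" using p_half by (intro mult_left_mono) auto
    then show ?thesis unfolding X_def by simp
  qed
  have pq: "p \<le> q / X"
  proof -
    have "p * X \<le> p * sqrt (real n)" using Xn by (intro mult_left_mono) auto
    then show ?thesis using X1 by (simp add: q_def pos_le_divide_eq mult.commute)
  qed
  have lipn: "lip n = 8 * e12 * p / X" by (simp add: lip_def X_def e12_def)
  have lipq: "lip n * (p * real n) = 8 * e12 * q\<^sup>2 / X"
  proof -
    have "lip n * (p * real n) = 8 * e12 * (p * (real n * p)) / X" by (simp add: lipn)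
    also have "p * (real n * p) = q\<^sup>2" using q2 XX by (simp add: mult.commute)
    finally show ?thesis .
  qed
  have err: "day2_err n = p + 8 * e12 * q\<^sup>2 / X" by (simp add: day2_err_def lipq)
  have gain: "g \<le> \<gamma>\<^sup>2 * q - 4 * e12 / X - 2 * (lip n * sqrt (sd_const * real n)) - 2 * day2_err n"
  proof -
    have "16 * e12 / \<gamma>\<^sup>2 \<le> q * X" using th(5) X(2) by (simp add: q_def)
    then have "16 * e12 \<le> \<gamma>\<^sup>2 * (q * X)" using \<gamma> by (simp add: pos_divide_le_eq mult.commute)
    then have "16 * e12 / X \<le> \<gamma>\<^sup>2 * q" using X1 by (simp add: pos_divide_le_eq mult_ac)
    then have 1: "4 * e12 / X \<le> \<gamma>\<^sup>2 * q / 4" by simp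
    have "lip n * sqrt (sd_const * real n) = 8 * e12 * sqrt sd_const * q / X"
      by (simp add: lipn real_sqrt_mult q_def)
    then have 2: "2 * (lip n * sqrt (sd_const * real n)) = 16 * e12 * sqrt sd_const * q / X" by simp
    have "q\<^sup>2 \<le> lam * q" unfolding power2_eq_square using qlam q0 by (intro mult_right_mono) auto
    then have "16 * e12 * q\<^sup>2 / X \<le> 16 * e12 * (lam * q) / X"
      using e12 X1 by (intro divide_right_mono mult_left_mono) auto
    then have 3: "2 * day2_err n \<le> 2 * (q / X) + 16 * e12 * lam * q / X" using pq unfolding err by simp
    have "16 * e12 * sqrt sd_const * q / X + (2 * (q / X) + 16 * e12 * lam * q / X) = err_const lam * q / X"
      by (simp add: err_const_def e12_def add_divide_distrib algebra_simps)
    moreover have "err_const lam * q / X \<le> \<gamma>\<^sup>2 * q / 4"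
    proof -
      have "4 * err_const lam / \<gamma>\<^sup>2 \<le> X" using th(4) X(1) by linarith
      then have "4 * err_const lam \<le> X * \<gamma>\<^sup>2" using \<gamma> by (simp add: pos_divide_le_eq)
      then have "4 * err_const lam * q \<le> X * \<gamma>\<^sup>2 * q" using q0 by (intro mult_right_mono) auto
      then show ?thesis using X1 by (simp add: field_simps)
    qed
    ultimately show ?thesis using 1 2 3 unfolding g_def by linarith
  qed
  have g0: "0 < g" using \<gamma> q0 by (simp add: g_def)
  let ?S = "\<lambda>E. \<Sum>v\<in>V. day2_plus s v E"
  have mean: "N / 2 * (1 + g) \<le> expect (pairs V) ?S"
    unfolding N_def
  proof (rule expect_day2_sum_ge[where lam = lam, OF V(1) s V(2)])
    show "12 * (4 * (10 * lam + 64 * exp 12 + 5) + 2) \<le> sqrt (real n * p)"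
      using th(2) X(1) by (simp add: X_def e12_def)
    show "32 / gam (10 * lam + 64 * exp 12 + 5) \<le> sqrt (real n * p)"
      using th(3) X(1) by (simp add: X_def \<gamma>_def lead_const_def)
    show "g \<le> (gam (10 * lam + 64 * exp 12 + 5))\<^sup>2 * (sqrt (real n) * p) - 4 * exp 12 / sqrt (real n * p)
      - 2 * (lip n * sqrt (sd_const * real n)) - 2 * day2_err n"
      using gain by (simp add: X_def q_def e12_def \<gamma>_def lead_const_def)
  qed (use V PQ lam g0 in auto)
  have N0: "0 < N" "10 \<le> N" using V by (auto simp: N_def)
  \<comment> \<open>The bound \<open>g \<le> 1\<close> is read off from the mean, which cannot
    exceed the number of vertices.\<close>
  have "expect (pairs V) ?S \<le> N"
  proof (rule expect_le_const)
    fix E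
    have "?S E \<le> (\<Sum>v\<in>V. 1)" by (intro sum_mono) (auto simp: day2_plus_def)
    then show "?S E \<le> N" by (simp add: N_def)
  qed (use V in simp)
  then have "N / 2 * (1 + g) \<le> N / 2 * 2" using mean by simp
  then have g1: "g \<le> 1" using N0 by (subst (asm) mult_le_cancel_left_pos) auto
  \<comment> \<open>Half of the expected surplus \<open>N * g / 2\<close> is given away in
    Chebyshev's inequality; \<open>N * g / 4\<close> remains.\<close>
  define D where "D = g / 4"
  have D: "0 < D" "D \<le> 1" using g0 g1 by (auto simp: D_def)
  have DN: "1 \<le> D * N"
  proof -
    have "15360 / \<gamma> ^ 4 \<le> X" using th(6) X(1) by linarith
    then have "15360 \<le> X * \<gamma> ^ 4" using \<gamma> by (simp add: pos_divide_le_eq)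
    also have "\<dots> \<le> X * \<gamma>\<^sup>2" using \<gamma> X1 by (intro mult_left_mono power_decreasing) auto
    finally have 1: "15360 \<le> X * \<gamma>\<^sup>2" .
    have "X \<le> q * N"
    proof -
      have "X * 1 \<le> X\<^sup>2" using X1 by (simp add: power2_eq_square)
      also have "\<dots> = X\<^sup>2 * 1" by simp
      also have "\<dots> \<le> X\<^sup>2 * sqrt (real n)" using n0 by (intro mult_left_mono) auto
      also have "\<dots> = q * real n" by (simp add: XX q_def)
      also have "\<dots> \<le> q * N" using nN q0 by (intro mult_left_mono) auto
      finally show ?thesis by simp
    qed
    then have "X * \<gamma>\<^sup>2 \<le> q * N * \<gamma>\<^sup>2" using \<gamma> by (intro mult_right_mono) auto
    then show ?thesis using 1 by (simp add: D_def g_def field_simps)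
  qed
  have var: "Var (pairs V) ?S \<le> N + N\<^sup>2 * (4 * day2_err n + 64 * (exp 12)\<^sup>2 * sd_const * p)"
    unfolding N_def by (rule Var_day2_le[OF V(1) s V(2)]) (use V in auto)
  have cheb: "expect (pairs V) (\<lambda>E. of_bool (?S E < N / 2 * (1 + g) - N * g / 4))
    \<le> (N + N\<^sup>2 * (4 * day2_err n + 64 * (exp 12)\<^sup>2 * sd_const * p)) / (N * g / 4)\<^sup>2"
    by (rule expect_Chebyshev_lower[OF _ var mean]) (use V N0 g0 in auto)
  define K where "K = 64 * e12\<^sup>2 * sd_const"
  have K0: "0 \<le> K" using sd_const_pos by (simp add: K_def)
  have varle: "(N + N\<^sup>2 * (4 * day2_err n + 64 * (exp 12)\<^sup>2 * sd_const * p)) / (N * g / 4)\<^sup>2 \<le> var_const lam / X"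
  proof -
    have eq: "(N + N\<^sup>2 * (4 * day2_err n + 64 * (exp 12)\<^sup>2 * sd_const * p)) / (N * g / 4)\<^sup>2
      = 64 / \<gamma> ^ 4 * ((1 / N + (4 * day2_err n + K * p)) / q\<^sup>2)"
      using N0 \<gamma> q0 by (simp add: g_def K_def e12_def power_mult_distrib power_divide field_simps power2_eq_square power4_eq_xxxx)
    have "(1 / N + (4 * day2_err n + K * p)) / q\<^sup>2 = 1 / (N * q\<^sup>2) + (4 + K) * (p / q\<^sup>2) + 32 * e12 / X"
      using q0 X1 N0 by (simp add: err field_simps)
    \<comment> \<open>Why covariances of order \<open>p\<close> are harmless: compared with the
      squared bias they are only \<open>1 / (n * p)\<close>.\<close>
    also have "p / q\<^sup>2 = 1 / X\<^sup>2" using p_pos X1 by (simp add: q2)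
    also have "1 / (N * q\<^sup>2) + (4 + K) * (1 / X\<^sup>2) + 32 * e12 / X \<le> 1 / X + (4 + K) * (1 / X) + 32 * e12 / X"
    proof (intro add_mono mult_left_mono order_refl)
      have xx: "X \<le> X\<^sup>2" using X1 by (simp add: power2_eq_square)
      show "1 / X\<^sup>2 \<le> 1 / X" using xx X1 by (intro divide_left_mono) auto
      have "X \<le> N * q\<^sup>2"
      proof -
        have "X\<^sup>2 * 1 \<le> X\<^sup>2 * X\<^sup>2" using X1 by (intro mult_left_mono) (auto simp: one_le_power)
        also have "\<dots> = real n * q\<^sup>2" by (simp add: q2 XX)
        also have "\<dots> \<le> N * q\<^sup>2" using nN by (intro mult_right_mono) auto
        finally show ?thesis using xx by simp
      qed
      then show "1 / (N * q\<^sup>2) \<le> 1 / X" using X1 N0 q0 by (intro divide_left_mono) auto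
    qed (use K0 in auto)
    also have "1 / X + (4 + K) * (1 / X) + 32 * e12 / X = (5 + K + 32 * e12) / X"
      by (simp add: add_divide_distrib)
    finally have R: "(1 / N + (4 * day2_err n + K * p)) / q\<^sup>2 \<le> (5 + K + 32 * e12) / X" .
    have "64 / \<gamma> ^ 4 * ((1 / N + (4 * day2_err n + K * p)) / q\<^sup>2) \<le> 64 / \<gamma> ^ 4 * ((5 + K + 32 * e12) / X)"
      by (rule mult_left_mono[OF R]) (use \<gamma> in simp)
    then show ?thesis unfolding eq by (simp add: var_const_def K_def e12_def \<gamma>_def)
  qed
  have large: "expect (pairs V) (\<lambda>E. of_bool (stuck_large V D E))
    \<le> exp (- N)"
  proof -
    have "15360 / \<gamma> ^ 4 \<le> q * X" using th(6) X(2) by (simp add: q_def)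
    moreover have "1 \<le> q * X" using th(1) X(2) by (simp add: q_def)
    then have "q * X * 1 \<le> (q * X) * (q * X)" by (intro mult_left_mono) auto
    ultimately have "15360 / \<gamma> ^ 4 \<le> (q * X) * (q * X)" by linarith
    then have 1: "15360 \<le> q\<^sup>2 * X\<^sup>2 * \<gamma> ^ 4" using \<gamma> by (simp add: pos_divide_le_eq power2_eq_square mult_ac)
    \<comment> \<open>With \<open>D = \<gamma>^2 * q / 8\<close> the denominator is
      \<open>80 * 64 = 5120\<close>, so \<open>15360\<close> yields the factor 3; two of the three
      units pay for \<open>4 ^ card V \<le> exp (2 * N)\<close>.\<close>
    have "3 * N \<le> p * D\<^sup>2 * N\<^sup>2 / 80"
    proof -
      have "15360 * N \<le> q\<^sup>2 * X\<^sup>2 * \<gamma> ^ 4 * N" using 1 N0 by (intro mult_right_mono) auto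
      also have "\<dots> = (q\<^sup>2 * \<gamma> ^ 4 * N * p) * real n" by (simp add: XX)
      also have "\<dots> \<le> (q\<^sup>2 * \<gamma> ^ 4 * N * p) * N" using nN N0 by (intro mult_left_mono) auto
      finally have "15360 * N \<le> (q\<^sup>2 * \<gamma> ^ 4 * N * p) * N" .
      moreover have "p * D\<^sup>2 * N\<^sup>2 / 80 = (q\<^sup>2 * \<gamma> ^ 4 * N * p) * N / 5120"
        by (simp add: D_def g_def power2_eq_square power4_eq_xxxx field_simps)
      ultimately show ?thesis by linarith
    qed
    then have "exp (- p * D\<^sup>2 * N\<^sup>2 / 80) \<le> exp (- (3 * N))" by simp
    moreover have "4 ^ card V \<le> exp (2 * N)"
    proof -
      have "4 \<le> exp (2::real)" using exp_lower_Taylor_quadratic[of 2] by simp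
      then have "4 ^ card V \<le> exp (2::real) ^ card V" by (intro power_mono) auto
      then show ?thesis by (simp add: N_def exp_of_nat_mult[symmetric] mult.commute)
    qed
    ultimately have "4 ^ card V * exp (- p * D\<^sup>2 * N\<^sup>2 / 80) \<le> exp (2 * N) * exp (- (3 * N))"
      by (intro mult_mono) auto
    also have "\<dots> = exp (- N)" by (simp flip: exp_add)
    finally show ?thesis
      using expect_stuck_large[OF V(1) D DN[unfolded N_def]] by (simp add: N_def)
  qed
  have small: "expect (pairs V) (\<lambda>E. of_bool (stuck_small V E))
    \<le> exp 1 * (exp ((real (card V)) ^ 3 * exp (- p * real (card V) / 50)) - 1)"
    by (rule expect_stuck_small) (use V in auto)
  have "expect (pairs V) (\<lambda>E. of_bool (\<not> (\<exists>t. \<forall>v\<in>V. majority_dynamics E s t v = 1)))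
    \<le> expect (pairs V) (\<lambda>E. of_bool (?S E < N / 2 * (1 + g) - N * g / 4) + of_bool (stuck_large V D E) + of_bool (stuck_small V E))"
  proof (rule expect_mono)
    fix E assume E: "E \<subseteq> pairs V"
    have "?S E < N / 2 * (1 + g) - N * g / 4 \<or> stuck_large V D E \<or> stuck_small V E" if "\<not> (\<exists>t. \<forall>v\<in>V. majority_dynamics E s t v = 1)"
    proof (rule ccontr)
      assume a: "\<not> ?thesis"
      then have d: "N / 2 + D * N \<le> ?S E" by (simp add: D_def algebra_simps)
      have lm: "\<not> stuck_large V D E" "\<not> stuck_small V E" using a by argo+
      have "\<exists>t. \<forall>v\<in>V. majority_dynamics E s t v = 1"
        by (rule unanimity_if_good[OF V(1) E s d[unfolded N_def] lm])
      with that show False by argo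
    qed
    then show "of_bool (\<not> (\<exists>t. \<forall>v\<in>V. majority_dynamics E s t v = 1))
      \<le> of_bool (?S E < N / 2 * (1 + g) - N * g / 4) + of_bool (stuck_large V D E) + (of_bool (stuck_small V E) :: real)"
      by (rule of_bool_le_sum3)
  qed
  also have "\<dots> = expect (pairs V) (\<lambda>E. of_bool (?S E < N / 2 * (1 + g) - N * g / 4))
      + expect (pairs V) (\<lambda>E. of_bool (stuck_large V D E)) + expect (pairs V) (\<lambda>E. of_bool (stuck_small V E))"
    by (simp only: expect_add)
  finally show ?thesis
    unfolding N_def[symmetric] using cheb varle large[folded N_def] small[folded N_def] by linarith
qed

end

section \<open>The random graph and the evening opinion\<close>

context bernoulli_param
begin

lemma pmf_gnp:
  assumes "E \<subseteq> pairs {1..n}"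
  shows "pmf (gnp n p) E = p ^ card E * (1 - p) ^ card (pairs {1..n} - E)"
proof -
  let ?A = "pairs {1..n}"
  let ?M = "Pi_pmf ?A False (\<lambda>_. bernoulli_pmf p)"
  have A: "vertex_pairs n = ?A" by (simp add: vertex_pairs_def pairs_def)
  have fin: "finite ?A" by simp
  have "pmf (gnp n p) E = measure_pmf.prob ?M ((\<lambda>X. {e \<in> ?A. X e}) -` {E})"
    unfolding gnp_def A by (rule pmf_map)
  \<comment> \<open>Other functions with edge set \<open>E\<close> differ from the default
    \<open>False\<close> outside the pairs and have probability zero.\<close>
  also have "\<dots> = measure_pmf.prob ?M {\<lambda>e. e \<in> E}"
  proof (rule measure_prob_cong_0)
    fix X assume X: "X \<in> (\<lambda>X. {e \<in> ?A. X e}) -` {E} - {\<lambda>e. e \<in> E}"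
    have "\<exists>x. x \<notin> ?A \<and> X x \<noteq> False"
    proof (rule ccontr)
      assume "\<not> ?thesis"
      then have "X = (\<lambda>e. e \<in> E)" using X by (auto simp: fun_eq_iff)
      then show False using X by simp
    qed
    then show "pmf ?M X = 0" by (rule pmf_Pi_outside[OF fin])
  qed (use assms in auto)
  also have "\<dots> = pmf ?M (\<lambda>e. e \<in> E)" by (rule measure_pmf_single)
  also have "\<dots> = (\<Prod>e\<in>?A. pmf (bernoulli_pmf p) (e \<in> E))"
    by (rule pmf_Pi'[OF fin]) (use assms in auto)
  also have "\<dots> = (\<Prod>e\<in>?A. if e \<in> E then p else 1 - p)"
    by (rule prod.cong) auto
  also have "\<dots> = (\<Prod>e\<in>?A \<inter> {e. e \<in> E}. p) * (\<Prod>e\<in>?A \<inter> - {e. e \<in> E}. 1 - p)"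
    by (rule prod.If_cases[OF fin])
  also have "?A \<inter> {e. e \<in> E} = E" using assms by auto
  also have "?A \<inter> - {e. e \<in> E} = ?A - E" by auto
  finally show ?thesis by simp
qed

lemma prob_gnp: "measure_pmf.prob (gnp n p) {E. R E} = expect (pairs {1..n}) (\<lambda>E. of_bool (R E))"
proof -
  let ?A = "pairs {1..n}"
  have "measure_pmf.prob (gnp n p) {E. R E} = measure_pmf.prob (gnp n p) {E \<in> Pow ?A. R E}"
  proof (rule measure_prob_cong_0)
    fix E assume "E \<in> {E. R E} - {E \<in> Pow ?A. R E}"
    then have "E \<notin> set_pmf (gnp n p)" by (auto simp: gnp_def vertex_pairs_def pairs_def)
    then show "pmf (gnp n p) E = 0" by (simp add: pmf_eq_0_set_pmf)
  qed auto
  also have "\<dots> = (\<Sum>E\<in>{E \<in> Pow ?A. R E}. pmf (gnp n p) E)"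
    by (rule measure_measure_pmf_finite) simp
  also have "\<dots> = (\<Sum>E\<in>Pow ?A. if R E then pmf (gnp n p) E else 0)"
    by (rule sum.inter_filter) simp
  also have "\<dots> = expect ?A (\<lambda>E. of_bool (R E))"
    unfolding expect_def by (rule sum.cong) (auto simp: pmf_gnp)
  finally show ?thesis .
qed

end

text \<open>Every possible evening opinion has the same number of \<open>+1\<close>, so a bound for
  each fixed opinion suffices. The size hypothesis makes both \<open>pmf_of_set\<close> arguments
  nonempty.\<close>

lemma evening_opinion_support:
  assumes s: "s \<in> set_pmf (evening_opinion c n)"
    and le: "nat \<lceil>real n / 2\<rceil> + nat \<lceil>c * sqrt (real n)\<rceil> \<le> n"
  shows "v \<in> {1..n} \<Longrightarrow> s v = 1 \<or> s v = -1"
    and "card {v \<in> {1..n}. s v = 1} = nat \<lceil>real n / 2\<rceil> + nat \<lceil>c * sqrt (real n)\<rceil>"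
proof -
  define k where "k = nat \<lceil>real n / 2\<rceil>"
  define m where "m = nat \<lceil>c * sqrt (real n)\<rceil>"
  have km: "k + m \<le> n" using le by (simp add: k_def m_def)
  obtain A0 where "A0 \<subseteq> {1..n}" "card A0 = k"
    using obtain_subset_with_card_n[of k "{1..n}"] km by auto
  then have ne: "{A. A \<subseteq> {1..n} \<and> card A = k} \<noteq> {}" by blast
  have fin: "finite {A. A \<subseteq> {1..n} \<and> card A = k}" by simp
  obtain r where r: "r \<in> set_pmf (morning_opinion n)"
    and sr: "s \<in> set_pmf (map_pmf (\<lambda>S v. if v \<in> S then 1 else r v)
       (pmf_of_set {S. S \<subseteq> {v \<in> {1..n}. r v = -1} \<and> card S = m}))"
    using s unfolding evening_opinion_def m_def by auto
  obtain A where A: "A \<subseteq> {1..n}" "card A = k" and rA: "r = (\<lambda>v. if v \<in> A then 1 else -1)"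
    using r unfolding morning_opinion_def k_def[symmetric] set_map_pmf set_pmf_of_set[OF ne fin] by blast
  have M: "{v \<in> {1..n}. r v = -1} = {1..n} - A" by (auto simp: rA)
  have finA: "finite A" using A finite_subset by blast
  have "card ({1..n} - A) = n - k" using A finA by (simp add: card_Diff_subset)
  then have "m \<le> card ({1..n} - A)" using km by simp
  then obtain S0 where "S0 \<subseteq> {1..n} - A" "card S0 = m" by (rule obtain_subset_with_card_n)
  then have ne': "{S. S \<subseteq> {1..n} - A \<and> card S = m} \<noteq> {}" by blast
  have fin': "finite {S. S \<subseteq> {1..n} - A \<and> card S = m}" by simp
  obtain S where S: "S \<subseteq> {1..n} - A" "card S = m" and sS: "s = (\<lambda>v. if v \<in> S then 1 else r v)"
    using sr unfolding M set_map_pmf set_pmf_of_set[OF ne' fin'] by blast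
  show "v \<in> {1..n} \<Longrightarrow> s v = 1 \<or> s v = -1" by (simp add: sS rA)
  have "{v \<in> {1..n}. s v = 1} = A \<union> S" using A S by (auto simp: sS rA)
  moreover have "finite S" using S by (meson finite_Diff finite_atLeastAtMost finite_subset)
  moreover have "A \<inter> S = {}" using S by auto
  ultimately show "card {v \<in> {1..n}. s v = 1} = nat \<lceil>real n / 2\<rceil> + nat \<lceil>c * sqrt (real n)\<rceil>"
    using finA A S by (simp add: card_Un_disjoint k_def m_def)
qed

text \<open>Independence is used here: conditioning on the opinion leaves the distribution of the
  graph unchanged.\<close>

lemma prob_pair_pmf_ge:
  assumes "\<And>s. s \<in> set_pmf B \<Longrightarrow> measure_pmf.prob A {E. \<not> Q E s} \<le> \<epsilon>" "0 \<le> \<epsilon>"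
  shows "1 - \<epsilon> \<le> measure_pmf.prob (pair_pmf A B) {(E, s). Q E s}"
proof -
  let ?X = "{(E, s). \<not> Q E s}"
  have "pair_pmf A B = bind_pmf B (\<lambda>s. map_pmf (\<lambda>E. (E, s)) A)"
    unfolding pair_pmf_def map_pmf_def by (rule bind_commute_pmf)
  then have "emeasure (pair_pmf A B) ?X = (\<integral>\<^sup>+s. emeasure (map_pmf (\<lambda>E. (E, s)) A) ?X \<partial>B)"
    by (simp only: emeasure_bind_pmf)
  also have "\<dots> \<le> (\<integral>\<^sup>+s. ennreal \<epsilon> \<partial>B)"
  proof (rule nn_integral_mono_AE, rule AE_pmfI)
    fix s assume "s \<in> set_pmf B"
    then have "measure_pmf.prob A {E. \<not> Q E s} \<le> \<epsilon>" by (rule assms(1))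
    moreover have "(\<lambda>E. (E, s)) -` ?X = {E. \<not> Q E s}" by auto
    ultimately show "emeasure (map_pmf (\<lambda>E. (E, s)) A) ?X \<le> ennreal \<epsilon>"
      by (simp add: measure_pmf.emeasure_eq_measure ennreal_leI)
  qed
  also have "\<dots> = ennreal \<epsilon>" by (simp add: measure_pmf.emeasure_space_1)
  finally have "measure_pmf.prob (pair_pmf A B) ?X \<le> \<epsilon>"
    using assms(2) by (simp add: measure_pmf.emeasure_eq_measure)
  moreover have "?X = UNIV - {(E, s). Q E s}" by auto
  moreover have "measure_pmf.prob (pair_pmf A B) (UNIV - {(E, s). Q E s})
      = 1 - measure_pmf.prob (pair_pmf A B) {(E, s). Q E s}"
    using measure_pmf.prob_compl[of "{(E, s). Q E s}" "pair_pmf A B"] by simp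
  ultimately show ?thesis by simp
qed

section \<open>Asymptotics\<close>

text \<open>The lead lies between \<open>2 * sqrt n\<close> and \<open>2 * sqrt n + 4\<close>, the
  excess coming from the two ceilings; \<open>sqrt (n - 2)\<close> appears because two vertices are
  set aside. The last bound leaves at least two \<open>-1\<close> vertices.\<close>

lemma eventually_opinion_bounds:
  "\<forall>\<^sub>F n in sequentially. 2 * sqrt (real n) + 4 \<le> 3 * sqrt (real n - 2) \<and>
     3 + sqrt (real n - 2) / 2 \<le> 2 * sqrt (real n) \<and> 4 \<le> real n / 2 - sqrt (real n)"
proof -
  have "filterlim (\<lambda>n. 3 * sqrt (real n - 2) - (2 * sqrt (real n) + 4)) at_top sequentially"
    "filterlim (\<lambda>n. 2 * sqrt (real n) - (3 + sqrt (real n - 2) / 2)) at_top sequentially"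
    "filterlim (\<lambda>n. real n / 2 - sqrt (real n)) at_top sequentially"
    by real_asymp+
  then have "\<forall>\<^sub>F n in sequentially. 0 \<le> 3 * sqrt (real n - 2) - (2 * sqrt (real n) + 4)"
    "\<forall>\<^sub>F n in sequentially. 0 \<le> 2 * sqrt (real n) - (3 + sqrt (real n - 2) / 2)"
    "\<forall>\<^sub>F n in sequentially. 4 \<le> real n / 2 - sqrt (real n)"
    unfolding filterlim_at_top by blast+
  then show ?thesis by eventually_elim auto
qed

text \<open>Each estimate improves as \<open>p\<close> grows, so checking it at the smallest
  admissible \<open>p\<close> makes it uniform in \<open>p\<close>.\<close>

lemma eventually_lower_bounds:
  fixes T \<delta> :: real
  assumes "0 < \<delta>"
  defines "p0 \<equiv> \<lambda>n. real n powr (-3/5) * ln (real n)"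
  shows "\<forall>\<^sub>F n in sequentially. T \<le> sqrt ((real n - 2) * p0 n) \<and>
     T \<le> sqrt (real n - 2) * p0 n * sqrt ((real n - 2) * p0 n) \<and>
     exp (- real n) \<le> \<delta> \<and> exp 1 * (exp (real n ^ 3 * exp (- p0 n * real n / 50)) - 1) \<le> \<delta>"
proof -
  have "filterlim (\<lambda>n. sqrt ((real n - 2) * p0 n)) at_top sequentially"
    "filterlim (\<lambda>n. sqrt (real n - 2) * p0 n * sqrt ((real n - 2) * p0 n)) at_top sequentially"
    unfolding p0_def by real_asymp+
  then have "\<forall>\<^sub>F n in sequentially. T \<le> sqrt ((real n - 2) * p0 n)"
    "\<forall>\<^sub>F n in sequentially. T \<le> sqrt (real n - 2) * p0 n * sqrt ((real n - 2) * p0 n)"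
    unfolding filterlim_at_top by blast+
  moreover have "((\<lambda>n. exp (- real n)) \<longlongrightarrow> 0) sequentially" by real_asymp
  from order_tendstoD(2)[OF this assms(1)] have "\<forall>\<^sub>F n in sequentially. exp (- real n) < \<delta>" .
  moreover have "((\<lambda>n. exp 1 * (exp (real n ^ 3 * exp (- p0 n * real n / 50)) - 1)) \<longlongrightarrow> 0) sequentially"
    unfolding p0_def by real_asymp
  from order_tendstoD(2)[OF this assms(1)]
  have "\<forall>\<^sub>F n in sequentially. exp 1 * (exp (real n ^ 3 * exp (- p0 n * real n / 50)) - 1) < \<delta>" .
  ultimately show ?thesis by eventually_elim auto
qed

theorem theorem3p2:
  fixes \<epsilon> lam :: real
  assumes "\<epsilon> > 0" and "lam > 0"
  shows "\<exists>c>0. \<exists>lam'>0. \<forall>\<^sub>F n in sequentially. \<forall>p::real.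
     lam' * real n powr (-3/5) * ln (real n) \<le> p \<and> p \<le> lam * real n powr (-1/2) \<longrightarrow>
     measure_pmf.prob (pair_pmf (gnp n p) (evening_opinion c n))
       {(E, s). \<exists>t. majority_dynamics E s t constant_on {1..n}} \<ge> 1 - \<epsilon>"
proof -
  \<comment> \<open>The second entry makes the Chebyshev term at most \<open>\<epsilon> / 3\<close>;
    the other two failure terms get \<open>\<epsilon> / 3\<close> each.\<close>
  define T where "T = max (threshold lam) (3 * var_const lam / \<epsilon>)"
  define p0 where "p0 n = real n powr (-3/5) * ln (real n)" for n :: nat
  \<comment> \<open>This yields \<open>p \<le> 1/2\<close>, as \<open>bernoulli_param\<close>
    demands.\<close>
  have "((\<lambda>n. lam * real n powr (-1/2)) \<longlongrightarrow> 0) sequentially" by real_asymp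
  then have "\<forall>\<^sub>F n in sequentially. lam * real n powr (-1/2) < 1/2"
    by (rule order_tendstoD(2)) simp
  moreover have "\<forall>\<^sub>F n in sequentially. 10 \<le> n" by (rule eventually_ge_at_top)
  moreover note eventually_opinion_bounds
  moreover have "0 < \<epsilon> / 3" using assms(1) by simp
  note eventually_lower_bounds[OF this, of T, folded p0_def]
  ultimately have "\<forall>\<^sub>F n in sequentially. \<forall>p::real.
     1 * real n powr (-3/5) * ln (real n) \<le> p \<and> p \<le> lam * real n powr (-1/2) \<longrightarrow>
     measure_pmf.prob (pair_pmf (gnp n p) (evening_opinion 1 n))
       {(E, s). \<exists>t. majority_dynamics E s t constant_on {1..n}} \<ge> 1 - \<epsilon>"
  proof (eventually_elim, intro allI impI)
    case (elim n)
    fix p :: real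
    assume "1 * real n powr (-3/5) * ln (real n) \<le> p \<and> p \<le> lam * real n powr (-1/2)"
    then have p: "p0 n \<le> p" "p \<le> lam * real n powr (-1/2)" by (simp_all add: p0_def)
    have n10: "10 \<le> real n" using elim(2) by simp
    have p00: "0 < p0 n" using n10 by (simp add: p0_def)
    interpret bernoulli_param p
      by standard (use p p00 elim(1) in linarith)+
    define n' where "n' = n - 2"
    have n': "real n' = real n - 2" using elim(2) by (simp add: n'_def of_nat_diff)
    define X where "X = sqrt (real n' * p)"
    have "sqrt ((real n - 2) * p0 n) \<le> X"
      unfolding X_def n' using p n10 by (intro real_sqrt_le_mono mult_left_mono) auto
    then have TX: "T \<le> X" using elim(4) assms by linarith
    have "sqrt (real n - 2) * p0 n * sqrt ((real n - 2) * p0 n) \<le> sqrt (real n') * p * X"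
      unfolding X_def n' using p p00 n10
      by (intro mult_mono real_sqrt_le_mono mult_left_mono mult_nonneg_nonneg) auto
    then have TqX: "T \<le> sqrt (real n') * p * X" using elim(4) assms by linarith
    have qlam: "sqrt (real n') * p \<le> lam"
    proof -
      have "sqrt (real n') * p \<le> sqrt (real n) * (lam * real n powr (-1/2))"
        using p n' by (intro mult_mono) auto
      also have "real n powr (-1/2) = 1 / sqrt (real n)"
        using n10 powr_minus_divide[of "real n" "1/2"] by (simp add: powr_half_sqrt)
      finally show ?thesis using n10 by simp
    qed
    have X0: "1 \<le> X" using TX threshold_ge(1)[OF assms(2)] by (simp add: T_def)
    have vX: "var_const lam / X \<le> \<epsilon> / 3"
    proof -
      have "3 * var_const lam / \<epsilon> \<le> X" using TX by (simp add: T_def)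
      then show ?thesis using assms X0 by (simp add: field_simps)
    qed
    have sm: "exp 1 * (exp (real n ^ 3 * exp (- p * real n / 50)) - 1) \<le> \<epsilon> / 3"
    proof -
      have "exp (- p * real n / 50) \<le> exp (- p0 n * real n / 50)" using p n10 by simp
      then have "real n ^ 3 * exp (- p * real n / 50) \<le> real n ^ 3 * exp (- p0 n * real n / 50)"
        by (rule mult_left_mono) simp
      then have "exp 1 * (exp (real n ^ 3 * exp (- p * real n / 50)) - 1)
        \<le> exp 1 * (exp (real n ^ 3 * exp (- p0 n * real n / 50)) - 1)"
        by (intro mult_left_mono diff_right_mono) auto
      then show ?thesis using elim(4) assms by linarith
    qed
    show "1 - \<epsilon> \<le> measure_pmf.prob (pair_pmf (gnp n p) (evening_opinion 1 n))
       {(E, s). \<exists>t. majority_dynamics E s t constant_on {1..n}}"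
    proof (rule prob_pair_pmf_ge)
      fix s assume s: "s \<in> set_pmf (evening_opinion 1 n)"
      define k where "k = nat \<lceil>real n / 2\<rceil>"
      define m where "m = nat \<lceil>1 * sqrt (real n)\<rceil>"
      have k: "real n / 2 \<le> real k" "real k \<le> real n / 2 + 1" unfolding k_def by linarith+
      have "0 \<le> sqrt (real n)" by simp
      then have m: "sqrt (real n) \<le> real m" "real m \<le> sqrt (real n) + 1" unfolding m_def mult_1 by linarith+
      have km: "real k + real m \<le> real n - 2" using k m elim(3) by linarith
      then have le: "k + m \<le> n" by linarith
      note sup = evening_opinion_support[OF s, folded k_def m_def, OF le]
      let ?V = "{1..n}"
      have P: "card {u \<in> ?V. s u = 1} = k + m" by (rule sup(2))
      have sV: "s u = 1 \<or> s u = -1" if "u \<in> ?V" for u using that by (rule sup(1))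
      have "card {u \<in> ?V. s u = 1} + card {u \<in> ?V. s u = -1} = card ?V"
        by (rule card_signs) (use sV in auto)
      then have Q: "real (card {u \<in> ?V. s u = -1}) = real n - (real k + real m)" using P by simp
      have "expect (pairs ?V) (\<lambda>E. of_bool (\<not> (\<exists>t. \<forall>v\<in>?V. majority_dynamics E s t v = 1)))
        \<le> var_const lam / sqrt (real n' * p) + exp (- real (card ?V))
          + exp 1 * (exp ((real (card ?V)) ^ 3 * exp (- p * real (card ?V) / 50)) - 1)"
      proof (rule expect_not_unanimous_le)
        show "card ?V = n' + 2" "8 \<le> n'" using elim(2) by (auto simp: n'_def)
        show "2 \<le> card {u \<in> ?V. s u = -1}" using Q km by linarith
        show "real (card {u \<in> ?V. s u = 1}) - real (card {u \<in> ?V. s u = -1}) \<le> 3 * sqrt (real n')"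
          unfolding Q P n' using k m elim(3) by simp
        show "3 + sqrt (real n') / 2 \<le> real (card {u \<in> ?V. s u = 1}) - real (card {u \<in> ?V. s u = -1})"
          unfolding Q P n' using k m elim(3) by simp
        show "threshold lam \<le> sqrt (real n' * p)" "threshold lam \<le> sqrt (real n') * p * sqrt (real n' * p)"
          using TX TqX by (auto simp: T_def X_def)
      qed (use sV assms qlam in auto)
      also have "\<dots> \<le> \<epsilon>"
      proof -
        have n: "real (card ?V) = real n" by simp
        have "exp (- real n) \<le> \<epsilon> / 3" using elim(4) by blast
        then show ?thesis unfolding n X_def[symmetric] using vX sm by linarith
      qed
      finally have bad: "expect (pairs ?V) (\<lambda>E. of_bool (\<not> (\<exists>t. \<forall>v\<in>?V. majority_dynamics E s t v = 1))) \<le> \<epsilon>" .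
      have "measure_pmf.prob (gnp n p) {E. \<not> (\<exists>t. majority_dynamics E s t constant_on ?V)}
        \<le> measure_pmf.prob (gnp n p) {E. \<not> (\<exists>t. \<forall>v\<in>?V. majority_dynamics E s t v = 1)}"
        by (rule measure_pmf.finite_measure_mono) (auto simp: constant_on_def)
      also have "\<dots> \<le> \<epsilon>" unfolding prob_gnp by (rule bad)
      finally show "measure_pmf.prob (gnp n p) {E. \<not> (\<exists>t. majority_dynamics E s t constant_on ?V)} \<le> \<epsilon>" .
    qed (use assms in simp)
  qed
  then show ?thesis by (intro exI[of _ 1] conjI) auto
qed

end
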